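(* Let $n\ge 1$ and $p>0$. Let $u:\mathbb{R}^n\to(-\infty,+\infty]$ be a convex function whose effective domain $\operatorname{dom}u$ is compact, such that $u$ is Lipschitz on $\operatorname{int}(\operatorname{dom}u)$ and of class $C^2_+$ in $\operatorname{int}(\operatorname{dom}u)$. Then there exists a constant $\delta_{p,n}$, depending only on $n$ and $p$, such that \[ \lim_{m\to+\infty} m^{\frac{2p}{n}}\,\triangle_p(u,P^c_{(m)},1)=\frac{\delta_{p,n}}{2^p}\left(\int_{\operatorname{dom}u}(\det D^2u(x))^{\frac{p}{n+2p}}\,\mathrm{d}x\right)^{\frac{n+2p}{n}}. \]
   Context: $C^2_+$ means twice continuously differentiable with positive definite Hessian $D^2u$. $P^c_{(m)}$ is the class of functions $l_m(x)=\max_{1\le j\le m}\psi_j(x)$ for at most $m$ affine functions $\psi_j:\mathbb{R}^n\to\mathbb{R}$ with $l_m\le u$ on $\operatorname{dom}u$, and for sufficiently large $m$, $\triangle_p(u,P^c_{(m)},1)=\inf\{\int_{\operatorname{dom}u}(u(x)-l_m(x))^p\,\mathrm{d}x: l_m\in P^c_{(m)}\}$. *)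

theory Defs
  imports "HOL-Analysis.Analysis"
begin

definition affmax :: "((real^'n) \<times> real) set \<Rightarrow> real^'n \<Rightarrow> real" where
  "affmax S x = Max ((\<lambda>(a, b). a \<bullet> x + b) ` S)"

text \<open>The class P^c_(m): maxima of at most m affine functions lying below u on dom u = D.\<close>
definition Pc :: "nat \<Rightarrow> (real^'n) set \<Rightarrow> (real^'n \<Rightarrow> real) \<Rightarrow> (real^'n \<Rightarrow> real) set" where
  "Pc m D u = {affmax S | S. finite S \<and> S \<noteq> {} \<and> card S \<le> m \<and> (\<forall>x\<in>D. affmax S x \<le> u x)}"

definition tri_p :: "real \<Rightarrow> (real^'n) set \<Rightarrow> (real^'n \<Rightarrow> real) \<Rightarrow> nat \<Rightarrow> real" where
  "tri_p p D u m = Inf ((\<lambda>l. integral D (\<lambda>x. (u x - l x) powr p)) ` Pc m D u)"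

definition C2plus_hessian :: "(real^'n) set \<Rightarrow> (real^'n \<Rightarrow> real) \<Rightarrow> (real^'n \<Rightarrow> real^'n^'n) \<Rightarrow> bool" where
  "C2plus_hessian U u H \<longleftrightarrow>
     (\<exists>G. \<forall>x\<in>U. (u has_derivative (\<lambda>h. G x \<bullet> h)) (at x) \<and>
                 (G has_derivative (\<lambda>h. H x *v h)) (at x)) \<and>
     continuous_on U H \<and>
     (\<forall>x\<in>U. \<forall>v. v \<noteq> 0 \<longrightarrow> 0 < v \<bullet> (H x *v v))"

end

theory Submission
  imports Defs "HOL-Real_Asymp.Real_Asymp"
begin

text \<open>
  For \<open>u = |x|\<^sup>2\<close> the error of a maximum of tangents at points \<open>a\<^sub>1, \<dots>, a\<^sub>m\<close> is \<open>min\<^sub>j |x - a\<^sub>j|\<^sup>2\<close>, so the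
  problem is optimal quantization. Since a cube tiles itself, \<open>m\<close> to the power \<open>2p/n\<close> times the
  quantization error of the unit cube tends to its infimum \<open>\<delta>\<close> (Zador's constant), which is a lower bound
  for every \<open>m\<close>.

  For general \<open>u\<close>, fill the interior up to a set of small measure with finitely many parallelepipeds on
  which the Hessian is almost constant and which are cubes for the Hessian metric. Distributing the
  tangents over these cells gives the upper bound by choosing optimal proportions and the lower bound by
  Hoelder's inequality; for the latter, a slope belongs to at most one cell because the gradient is
  injective. The set not covered is handled by few extra tangents: as the gradient is monotone and
  bounded, \<open>k\<close> tangents achieve uniform error of order \<open>k\<close> to the power \<open>-2/n\<close> on the whole domain. Combined with
  the lower bound, the same estimate shows that the integral of the determinant is finite.
\<close>

section \<open>Linear images of Lebesgue measure\<close>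

text \<open>The Hessian may blow up or degenerate towards the boundary of \<open>D\<close>. There
  only the Lipschitz constant of \<open>u\<close> is at hand, which bounds the gradient; so neither
  an error estimate near the boundary nor the finiteness of the integral can be read off from
  \<open>H\<close>. This is why the cells are finite in number and stay in the interior: on the rest
  the rate has the right order with a poor constant, and the small measure of the rest makes up for
  it. The affine minorants in the lower bound need not be tangents. A minimum point of the
  difference on a cell replaces the point of tangency, and shrunk cells with a fixed finite net deal
  with minima on the cell boundary. Constants: Taylor's factor 1/2 yields 2 to the power -p. A cell
  of side \<open>h\<close> and shape \<open>L\<close>, where transpose(L) H L = 1, has volume h^n
  |det L|, det H = |det L|^(-2), and error volume times h^(2p) times a quantization error. The
  exponent s = p/(n+2p) is the one for which (volume times (det H)^s)^(1+2p/n) equals volume times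
  h^(2p).\<close>

lemma measure_shear_cbox:
  fixes a b :: "real^'n"
  assumes "m \<noteq> n"
  shows "measure lebesgue ((\<lambda>x. \<chi> i. if i = m then x$m + x$n else x$i) ` cbox a b) = measure lebesgue (cbox a b)"
    (is "measure lebesgue (?f ` _) = _")
proof (cases "cbox a b = {}")
  case False
  have lin: "linear ?f"
    by (rule linearI) (auto simp: vec_eq_iff algebra_simps)
  \<comment> \<open>The lower corner is moved to the origin, where
    \<open>measure_shear_interval\<close> applies; the shear is linear, so it turns the translation
    into a translation.\<close>
  have "cbox a b = (+) a ` cbox 0 (b - a)"
    using cbox_translation[of a 0 "b - a"] by simp
  then have "?f ` cbox a b = (+) (?f a) ` ?f ` cbox 0 (b - a)"
    by (simp add: image_image linear_add[OF lin])
  moreover have "cbox 0 (b - a) \<noteq> {}"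
    using False \<open>cbox a b = (+) a ` cbox 0 (b - a)\<close> by blast
  ultimately have "measure lebesgue (?f ` cbox a b) = measure lebesgue (cbox 0 (b - a))"
    using measure_shear_interval[OF assms, of 0 "b - a"] by (simp only: measure_translation) simp
  also have "\<dots> = measure lebesgue (cbox a b)"
    by (metis \<open>cbox a b = (+) a ` cbox 0 (b - a)\<close> measure_translation)
  finally show ?thesis .
qed simp

lemma det_shear:
  assumes "m \<noteq> n"
  shows "det (\<chi> i j. of_bool (i = m \<and> j = n \<or> i = j) :: real^'n^'n) = 1"
proof -
  have "(\<chi> i j. of_bool (i = m \<and> j = n \<or> i = j) :: real^'n^'n)
      = (\<chi> k. if k = m then row m (mat 1) + 1 *s row n (mat 1) else row k (mat 1))"
    using assms by (auto simp: vec_eq_iff row_def mat_def)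
  then show ?thesis
    by (simp only: det_row_operation[OF assms] det_I)
qed

text \<open>The distribution proves this only for index types in class wellorder.\<close>

lemma matrix_image_lmeasurable_measure:
  fixes A :: "real^'n^'n"
  shows "\<forall>S\<in>lmeasurable. (*v) A ` S \<in> lmeasurable \<and> measure lebesgue ((*v) A ` S) = \<bar>det A\<bar> * measure lebesgue S"
    (is "?P A")
proof (rule induct_matrix_elementary_alt[where P = ?P])
  \<comment> \<open>A matrix with determinant of modulus 1 that preserves the volume of boxes
    preserves the volume of measurable sets. This reduces transpositions and shears to
    boxes.\<close>
  have suff: "?P B" if "\<And>a b. measure lebesgue ((*v) B ` cbox a b) = measure lebesgue (cbox a b)" "\<bar>det B\<bar> = 1"
    for B :: "real^'n^'n"
  proof
    fix S :: "(real^'n) set" assume S: "S \<in> lmeasurable"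
    have "measure lebesgue ((*v) B ` cbox a b) = 1 * measure lebesgue (cbox a b)" for a b
      using that(1) by simp
    from measure_linear_sufficient[OF _ S this] that(2)
    show "(*v) B ` S \<in> lmeasurable \<and> measure lebesgue ((*v) B ` S) = \<bar>det B\<bar> * measure lebesgue S"
      by (simp del: cbox_borel)
  qed
  show "?P (A ** B)" if A: "?P A" and B: "?P B" for A B :: "real^'n^'n"
  proof
    fix S :: "(real^'n) set" assume S: "S \<in> lmeasurable"
    have "(*v) (A ** B) ` S = (*v) A ` (*v) B ` S"
      by (simp add: image_image matrix_vector_mul_assoc)
    then show "(*v) (A ** B) ` S \<in> lmeasurable \<and>
        measure lebesgue ((*v) (A ** B) ` S) = \<bar>det (A ** B)\<bar> * measure lebesgue S"
      using A B S by (simp add: det_mul abs_mult)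
  qed
  show "?P A" if "row i A = 0" for A :: "real^'n^'n" and i
  proof -
    have "det A = 0"
      using that by (metis det_zero_row(2))
    then have "\<not> inj ((*v) A)"
      by (metis det_nz_iff_inj matrix_of_matrix_vector_mul matrix_vector_mul_linear)
    then show ?thesis
      using \<open>det A = 0\<close> negligible_linear_singular_image[of "(*v) A"] negligible_imp_measure0
      by (auto intro: negligible_imp_measurable)
  qed
  show "?P A" if "\<And>i j. i \<noteq> j \<Longrightarrow> A $ i $ j = 0" for A :: "real^'n^'n"
  proof -
    have "(*v) A = (\<lambda>x. \<chi> k. A$k$k * x$k)"
    proof
      fix x
      have "(\<Sum>j\<in>UNIV. A $ i $ j * x $ j) = A$i$i * x$i" for i
        using that by (subst sum.remove[of _ i]) auto
      then show "A *v x = (\<chi> k. A$k$k * x$k)"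
        by (simp add: matrix_vector_mult_def)
    qed
    then show ?thesis
      using measurable_stretch[of _ "\<lambda>k. A$k$k"] measure_stretch[of _ "\<lambda>k. A$k$k"] det_diagonal[of A] that by auto
  qed
  show "?P (\<chi> i j. mat 1 $ i $ Transposition.transpose m n j)" if "m \<noteq> n" for m n :: 'n
  proof (rule suff)
    let ?T = "\<chi> i j. mat 1 $ i $ Transposition.transpose m n j :: real^'n^'n"
    let ?t = "Transposition.transpose m n"
    have T: "(*v) ?T = (\<lambda>x. \<chi> i. x $ ?t i)"
    proof
      fix x :: "real^'n"
      have "(\<Sum>j\<in>UNIV. (if i = ?t j then 1 else 0) * x $ j) = x $ ?t i" for i
      proof -
        have "(\<Sum>j\<in>UNIV. (if i = ?t j then 1 else 0) * x $ j) = (\<Sum>j\<in>UNIV. if j = ?t i then x $ j else 0)"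
          by (rule sum.cong) auto
        then show ?thesis by simp
      qed
      then show "?T *v x = (\<chi> i. x $ ?t i)"
        by (simp add: matrix_vector_mult_def mat_def)
    qed
    show "\<bar>det ?T\<bar> = 1"
      by (simp add: det_permute_columns permutes_swap_id sign_swap_id abs_mult)
    fix a b :: "real^'n"
    have im: "(*v) ?T ` cbox a b = cbox (\<chi> i. a $ ?t i) (\<chi> i. b $ ?t i)"
    proof
      show "cbox (\<chi> i. a $ ?t i) (\<chi> i. b $ ?t i) \<subseteq> (*v) ?T ` cbox a b"
      proof
        fix y assume y: "y \<in> cbox (\<chi> i. a $ ?t i) (\<chi> i. b $ ?t i)"
        have "y = ?T *v (\<chi> i. y $ ?t i)"
          by (simp add: T)
        moreover have "a $ i \<le> y $ ?t i \<and> y $ ?t i \<le> b $ i" for i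
          using y by (auto simp: mem_box_cart dest: spec[of _ "?t i"])
        ultimately show "y \<in> (*v) ?T ` cbox a b"
          by (intro image_eqI[where x = "\<chi> i. y $ ?t i"]) (auto simp: mem_box_cart)
      qed
    qed (auto simp: T mem_box_cart)
    have "(\<Prod>i\<in>UNIV. b $ ?t i - a $ ?t i) = (\<Prod>i\<in>UNIV. b $ i - a $ i)"
      using prod.permute[OF permutes_swap_id, of m UNIV n "\<lambda>i. b $ i - a $ i"] by (simp add: o_def)
    moreover have "(cbox (\<chi> i. a $ ?t i) (\<chi> i. b $ ?t i) = {}) = (cbox a b = {})"
      by (metis im image_is_empty)
    ultimately show "measure lebesgue ((*v) ?T ` cbox a b) = measure lebesgue (cbox a b)"
      by (simp add: im content_cbox_if_cart)
  qed
  show "?P (\<chi> i j. of_bool (i = m \<and> j = n \<or> i = j))" if "m \<noteq> n" for m n :: 'n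
  proof (rule suff)
    let ?T = "\<chi> i j. of_bool (i = m \<and> j = n \<or> i = j) :: real^'n^'n"
    have "(*v) ?T = (\<lambda>x. \<chi> i. if i = m then x$m + x$n else x$i)"
    proof
      fix x :: "real^'n"
      have "(\<Sum>j\<in>UNIV. of_bool (i = m \<and> j = n \<or> i = j) * x $ j) = (if i = m then x$m + x$n else x$i)" for i
      proof -
        have "of_bool (i = m \<and> j = n \<or> i = j) * x $ j
            = (if j = n then (if i = m then x$n else 0) else 0) + (if j = i then x $ i else 0)" for j
          using that by auto
        then show ?thesis
          by (simp add: sum.distrib)
      qed
      then show "?T *v x = (\<chi> i. if i = m then x$m + x$n else x$i)"
        by (simp add: matrix_vector_mult_def)
    qed
    then show "measure lebesgue ((*v) ?T ` cbox a b) = measure lebesgue (cbox a b)" for a b :: "real^'n"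
      using measure_shear_cbox[OF that, of a b] by simp
    show "\<bar>det ?T\<bar> = 1"
      using det_shear[OF that] by simp
  qed
qed

lemma lmeasurable_matrix_image: "S \<in> lmeasurable \<Longrightarrow> (*v) (A::real^'n^'n) ` S \<in> lmeasurable"
  using matrix_image_lmeasurable_measure by blast

lemma measure_matrix_image:
  "S \<in> lmeasurable \<Longrightarrow> measure lebesgue ((*v) (A::real^'n^'n) ` S) = \<bar>det A\<bar> * measure lebesgue S"
  using matrix_image_lmeasurable_measure by blast

section \<open>Substitution of an affine map in integrals\<close>

lemma measure_affine_image:
  fixes A :: "real^'n^'n"
  assumes "S \<in> lmeasurable"
  shows "(\<lambda>y. c + A *v y) ` S \<in> lmeasurable"
    "measure lebesgue ((\<lambda>y. c + A *v y) ` S) = \<bar>det A\<bar> * measure lebesgue S"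
proof -
  have eq: "(\<lambda>y. c + A *v y) ` S = (+) c ` (*v) A ` S"
    by (simp add: image_image)
  show "(\<lambda>y. c + A *v y) ` S \<in> lmeasurable"
    unfolding eq by (intro measurable_translation lmeasurable_matrix_image assms)
  show "measure lebesgue ((\<lambda>y. c + A *v y) ` S) = \<bar>det A\<bar> * measure lebesgue S"
    unfolding eq by (simp add: measure_translation measure_matrix_image assms)
qed

text \<open>Lebesgue measure is determined by its values on open boxes, and the preimage of a box is
  its image under the inverse affine map, whose volume is known. In this form the substitution rule
  follows for integrals.\<close>

lemma lborel_affine_matrix:
  fixes A :: "real^'n^'n"
  assumes "det A \<noteq> 0"
  shows "lborel = density (distr lborel borel (\<lambda>y. c + A *v y)) (\<lambda>_. ennreal \<bar>det A\<bar>)"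
proof (rule lborel_eqI)
  let ?g = "\<lambda>y. c + A *v y"
  have meas [measurable]: "?g \<in> borel_measurable borel"
    by (intro borel_measurable_continuous_onI continuous_intros matrix_vector_mult_linear_continuous_on)
  obtain B where AB: "A ** B = mat 1" "B ** A = mat 1"
    using assms by (auto simp: invertible_det_nz[symmetric] invertible_def)
  have detB: "\<bar>det B\<bar> = 1 / \<bar>det A\<bar>"
    using arg_cong[OF AB(1), of "\<lambda>M. \<bar>det M\<bar>"] assms by (simp add: det_mul abs_mult field_simps)
  fix l u :: "real^'n"
  have vim: "?g -` box l u = (\<lambda>x. - (B *v c) + B *v x) ` box l u"
  proof
    show "?g -` box l u \<subseteq> (\<lambda>x. - (B *v c) + B *v x) ` box l u"
    proof
      fix y assume "y \<in> ?g -` box l u"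
      moreover have "y = - (B *v c) + B *v (?g y)"
        by (simp add: matrix_vector_right_distrib matrix_vector_mul_assoc AB)
      ultimately show "y \<in> (\<lambda>x. - (B *v c) + B *v x) ` box l u" by blast
    qed
    have "?g (- (B *v c) + B *v x) = x" for x
      by (simp add: matrix_vector_right_distrib matrix_vector_mult_diff_distrib matrix_vector_mul_assoc AB vec.neg)
    then show "(\<lambda>x. - (B *v c) + B *v x) ` box l u \<subseteq> ?g -` box l u"
      by auto
  qed
  have bl: "box l u \<in> lmeasurable" by auto
  have "?g -` box l u \<in> sets borel"
    using measurable_sets_borel[OF meas, of "box l u"] by simp
  then have "emeasure lborel (?g -` box l u) = emeasure lebesgue ((\<lambda>x. - (B *v c) + B *v x) ` box l u)"
    by (simp add: vim)
  also have "\<dots> = ennreal (\<bar>det B\<bar> * measure lebesgue (box l u))"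
    using measure_affine_image[OF bl, of "- (B *v c)" B] by (simp add: emeasure_eq_measure2)
  finally have *: "emeasure lborel (?g -` box l u) = ennreal (\<bar>det B\<bar> * measure lebesgue (box l u))" .
  assume "\<And>b. b \<in> Basis \<Longrightarrow> l \<bullet> b \<le> u \<bullet> b"
  then have "measure lebesgue (box l u) = (\<Prod>b\<in>Basis. (u - l) \<bullet> b)"
    by (simp add: measure_lborel_box)
  then have "emeasure (density (distr lborel borel ?g) (\<lambda>_. ennreal \<bar>det A\<bar>)) (box l u)
      = ennreal \<bar>det A\<bar> * ennreal (\<bar>det B\<bar> * (\<Prod>b\<in>Basis. (u - l) \<bullet> b))"
    by (subst emeasure_density) (simp_all add: nn_integral_cmult emeasure_distr *)
  also have "\<dots> = ennreal (\<Prod>b\<in>Basis. (u - l) \<bullet> b)"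
    using assms detB by (simp add: ennreal_mult'[symmetric])
  finally show "emeasure (density (distr lborel borel ?g) (\<lambda>_. ennreal \<bar>det A\<bar>)) (box l u)
      = ennreal (\<Prod>b\<in>Basis. (u - l) \<bullet> b)" by simp
qed simp

text \<open>Continuity on a compact set gives Borel integrability on both sides, so the gauge
  integral may be exchanged for the Lebesgue integral and \<open>lborel_affine_matrix\<close>
  applies.\<close>

lemma integral_affine_image:
  fixes A :: "real^'n^'n" and f :: "real^'n \<Rightarrow> real"
  assumes "det A \<noteq> 0" "compact S" "continuous_on ((\<lambda>y. c + A *v y) ` S) f"
  shows "integral ((\<lambda>y. c + A *v y) ` S) f = \<bar>det A\<bar> * integral S (\<lambda>y. f (c + A *v y))"
proof -
  let ?g = "\<lambda>y. c + A *v y"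
  have contg: "continuous_on X ?g" for X
    by (intro continuous_intros matrix_vector_mult_linear_continuous_on)
  have meas [measurable]: "?g \<in> borel_measurable borel"
    by (intro borel_measurable_continuous_onI contg)
  have comp: "compact (?g ` S)"
    by (intro compact_continuous_image contg assms)
  have int1: "set_integrable lborel (?g ` S) f"
    by (rule borel_integrable_compact[OF comp assms(3), folded set_integrable_def])
  have int2: "set_integrable lborel S (\<lambda>y. f (?g y))"
    by (rule borel_integrable_compact[folded set_integrable_def])
       (auto intro: assms continuous_on_compose2[OF assms(3) contg])
  have fm: "(\<lambda>x. indicat_real (?g ` S) x *\<^sub>R f x) \<in> borel_measurable borel"
    using int1 by (simp add: set_integrable_def integrable_iff_bounded)
  have inj: "inj ?g"
    using assms(1) by (auto simp: inj_on_def det_nz_iff_inj[of "(*v) A", simplified])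
  have "integral (?g ` S) f = (LINT x|lborel. indicat_real (?g ` S) x *\<^sub>R f x)"
    using set_borel_integral_eq_integral(2)[OF int1] by (simp add: set_lebesgue_integral_def)
  also have "\<dots> = (LINT x|density (distr lborel borel ?g) (\<lambda>_. ennreal \<bar>det A\<bar>). indicat_real (?g ` S) x *\<^sub>R f x)"
    by (simp flip: lborel_affine_matrix[OF assms(1)])
  also have "\<dots> = \<bar>det A\<bar> * (LINT y|lborel. indicat_real (?g ` S) (?g y) *\<^sub>R f (?g y))"
    using fm by (simp add: integral_density integral_distr)
  also have "(\<lambda>y. indicat_real (?g ` S) (?g y) *\<^sub>R f (?g y)) = (\<lambda>y. indicat_real S y *\<^sub>R f (?g y))"
    by (simp only: inj_image_mem_iff[OF inj] indicator_def)
  also have "(LINT y|lborel. indicat_real S y *\<^sub>R f (?g y)) = integral S (\<lambda>y. f (?g y))"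
    using set_borel_integral_eq_integral(2)[OF int2] by (simp add: set_lebesgue_integral_def)
  finally show ?thesis .
qed

section \<open>Quantization of the unit cube\<close>

text \<open>Centred at the origin, so that scaling by a factor below 1 moves the cube into its own
  interior.\<close>

definition ucube :: "(real^'n) set" where
  "ucube = cbox (\<chi> i. - 1/2) (\<chi> i. 1/2)"

definition open_ucube :: "(real^'n) set" where
  "open_ucube = box (\<chi> i. - 1/2) (\<chi> i. 1/2)"

text \<open>The exponent is \<open>2 * p\<close> because a tangent to a quadratic errs by a squared
  distance, and errors are raised to the power \<open>p\<close>.\<close>

definition quant_err :: "real \<Rightarrow> (real^'n) set \<Rightarrow> real" where
  "quant_err p S = integral ucube (\<lambda>y. infdist y S powr (2 * p))"

lemma mem_ucube: "y \<in> ucube \<longleftrightarrow> (\<forall>i. \<bar>y $ i\<bar> \<le> 1/2)"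
proof -
  have "(- 1/2 \<le> t \<and> t \<le> 1/2) = (\<bar>t\<bar> \<le> 1/2)" for t :: real
    by linarith
  then show ?thesis
    by (simp only: ucube_def mem_box_cart vec_lambda_beta)
qed

lemma mem_open_ucube: "y \<in> open_ucube \<longleftrightarrow> (\<forall>i. \<bar>y $ i\<bar> < 1/2)"
proof -
  have "(- 1/2 < t \<and> t < 1/2) = (\<bar>t\<bar> < 1/2)" for t :: real
    by linarith
  then show ?thesis
    by (simp only: open_ucube_def mem_box_cart vec_lambda_beta)
qed

lemma compact_ucube: "compact (ucube :: (real^'n) set)"
  by (simp add: ucube_def)

lemma convex_ucube: "convex ucube"
  by (simp add: ucube_def)

lemma zero_in_ucube: "0 \<in> ucube"
  by (simp add: mem_ucube)

lemma open_ucube_subset: "open_ucube \<subseteq> ucube"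
  by (auto simp: mem_ucube mem_open_ucube less_imp_le)

lemma measure_ucube: "measure lebesgue (ucube :: (real^'n) set) = 1"
proof -
  have "(ucube :: (real^'n) set) \<noteq> {}"
    using zero_in_ucube by blast
  then show ?thesis
    unfolding ucube_def by (simp add: content_cbox_cart)
qed

lemma negligible_ucube_diff: "negligible (ucube - open_ucube :: (real^'n) set)"
  unfolding ucube_def open_ucube_def by (rule negligible_frontier_interval)

lemma det_scaleR_matrix: "det (h *\<^sub>R (A :: real^'n^'n)) = h ^ CARD('n) * det A"
proof -
  have "h *\<^sub>R A = (h *\<^sub>R mat 1) ** A"
    by (simp add: scalar_matrix_assoc[symmetric])
  moreover have "det (h *\<^sub>R mat 1 :: real^'n^'n) = h ^ CARD('n)"
    by (subst det_diagonal) (auto simp: mat_def)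
  ultimately show ?thesis
    by (simp add: det_mul)
qed

lemma scaleR_mat_mult_vec: "(h *\<^sub>R mat 1) *v y = h *\<^sub>R (y :: real^'n)"
  by (simp add: scaleR_matrix_vector_assoc[symmetric])

lemma infdist_image_homothety:
  fixes S :: "(real^'n) set"
  assumes "finite S" "S \<noteq> {}" "h > 0"
  shows "infdist (c + h *\<^sub>R y) ((\<lambda>z. c + h *\<^sub>R z) ` S) = h * infdist y S"
proof (rule antisym)
  let ?g = "\<lambda>z. c + h *\<^sub>R z"
  have d: "dist (?g y) (?g z) = h * dist y z" for z
    using assms(3) by (simp add: dist_norm flip: scaleR_diff_right)
  obtain a where "a \<in> S" "infdist y S = dist y a"
    using infdist_attains_inf[OF finite_imp_closed assms(2)] assms(1) by blast
  then show "infdist (?g y) (?g ` S) \<le> h * infdist y S"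
    using infdist_le[of "?g a" "?g ` S" "?g y"] d by auto
  obtain b where b: "b \<in> ?g ` S" "infdist (?g y) (?g ` S) = dist (?g y) b"
    using infdist_attains_inf[OF finite_imp_closed, of "?g ` S"] assms by blast
  then obtain z where "z \<in> S" "b = ?g z" by blast
  then show "h * infdist y S \<le> infdist (?g y) (?g ` S)"
    using b d infdist_le[of z S y] assms(3) by simp
qed

section \<open>Integrals of powers of the distance to a finite set\<close>

lemma continuous_on_infdist_powr:
  assumes "p > 0"
  shows "continuous_on T (\<lambda>y. infdist y S powr (2 * p))"
  using assms by (intro continuous_on_powr' continuous_intros) (auto simp: infdist_nonneg)

lemma integrable_infdist_powr:
  fixes T :: "(real^'n) set"
  assumes "p > 0" "compact T"
  shows "(\<lambda>y. infdist y S powr (2 * p)) integrable_on T"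
  using borel_integrable_compact[OF assms(2) continuous_on_infdist_powr[OF assms(1)], folded set_integrable_def]
    set_borel_integral_eq_integral(1) by blast

lemma integral_homothety_infdist:
  fixes S :: "(real^'n) set"
  assumes "finite S" "S \<noteq> {}" "h > 0" "p > 0"
  shows "integral ((\<lambda>y. c + h *\<^sub>R y) ` ucube) (\<lambda>x. infdist x ((\<lambda>z. c + h *\<^sub>R z) ` S) powr (2 * p))
       = h ^ CARD('n) * h powr (2 * p) * quant_err p S"
proof -
  have "integral ((\<lambda>y. c + (h *\<^sub>R mat 1) *v y) ` ucube) (\<lambda>x. infdist x ((\<lambda>z. c + h *\<^sub>R z) ` S) powr (2 * p))
      = \<bar>det (h *\<^sub>R mat 1 :: real^'n^'n)\<bar>
        * integral ucube (\<lambda>y. infdist (c + (h *\<^sub>R mat 1) *v y) ((\<lambda>z. c + h *\<^sub>R z) ` S) powr (2 * p))"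
    using assms by (intro integral_affine_image compact_ucube continuous_on_infdist_powr) (auto simp: det_scaleR_matrix)
  then show ?thesis
    using assms
    by (simp add: scaleR_mat_mult_vec det_scaleR_matrix infdist_image_homothety powr_mult infdist_nonneg quant_err_def)
qed

text \<open>Zero extensions are compared pointwise. As \<open>f\<close> is nonnegative, overlaps of
  the \<open>T i\<close> only enlarge the right-hand side.\<close>

lemma integral_le_sum_cover:
  fixes f :: "'a::euclidean_space \<Rightarrow> real"
  assumes "finite I" "S \<subseteq> (\<Union>i\<in>I. T i)" "f integrable_on S" "\<And>i. i \<in> I \<Longrightarrow> f integrable_on T i"
    and "\<And>x i. i \<in> I \<Longrightarrow> x \<in> T i \<Longrightarrow> 0 \<le> f x"
  shows "integral S f \<le> (\<Sum>i\<in>I. integral (T i) f)"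
proof -
  let ?r = "\<lambda>X x. if x \<in> X then f x else 0"
  have "integral S f = integral UNIV (?r S)"
    by (simp add: integral_restrict_UNIV)
  also have "\<dots> \<le> integral UNIV (\<lambda>x. \<Sum>i\<in>I. ?r (T i) x)"
  proof (rule integral_le)
    show "(?r S) integrable_on UNIV"
      using assms(3) by (simp add: integrable_restrict_UNIV)
    show "(\<lambda>x. \<Sum>i\<in>I. ?r (T i) x) integrable_on UNIV"
      using assms(1,4) by (intro integrable_sum) (auto simp: integrable_restrict_UNIV)
    fix x
    show "?r S x \<le> (\<Sum>i\<in>I. ?r (T i) x)"
    proof (cases "x \<in> S")
      case True
      then obtain j where j: "j \<in> I" "x \<in> T j"
        using assms(2) by blast
      then have "?r (T j) x \<le> (\<Sum>i\<in>I. ?r (T i) x)"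
        by (intro member_le_sum assms(1)) (auto simp: assms(5))
      then show ?thesis
        using True j by simp
    qed (auto intro!: sum_nonneg assms(5))
  qed
  also have "\<dots> = (\<Sum>i\<in>I. integral (T i) f)"
    using assms(1,4) by (subst integral_sum) (auto simp: integrable_restrict_UNIV integral_restrict_UNIV)
  finally show ?thesis .
qed

section \<open>Subdivision of the cube into subcubes of side 1/k\<close>

definition grid_center :: "nat \<Rightarrow> ('n \<Rightarrow> nat) \<Rightarrow> real^'n" where
  "grid_center k v = (\<chi> i. (2 * real (v i) + 1) / (2 * real k) - 1/2)"

definition grid_index :: "nat \<Rightarrow> ('n::finite \<Rightarrow> nat) set" where
  "grid_index k = (\<Pi>\<^sub>E i\<in>UNIV. {..<k})"

lemma finite_grid_index: "finite (grid_index k)"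
  unfolding grid_index_def by (rule finite_PiE) auto

lemma card_grid_index: "card (grid_index k :: ('n::finite \<Rightarrow> nat) set) = k ^ CARD('n)"
  unfolding grid_index_def by (simp add: card_PiE)

lemma ucube_grid:
  fixes y :: "real^'n"
  assumes "y \<in> ucube" "k > 0"
  obtains v where "v \<in> grid_index k" "\<And>i. \<bar>y $ i - grid_center k v $ i\<bar> \<le> 1 / (2 * real k)"
proof
  \<comment> \<open>The cap at \<open>k - 1\<close> is for the face \<open>y $ i = 1/2\<close>,
    where the floor equals \<open>k\<close>.\<close>
  define v where "v = (\<lambda>i. min (k - 1) (nat \<lfloor>real k * (y $ i + 1/2)\<rfloor>))"
  show "v \<in> grid_index k"
    using assms(2) unfolding v_def grid_index_def by auto
  fix i
  define t where "t = real k * (y $ i + 1/2)"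
  have t: "0 \<le> t" "t \<le> real k"
  proof -
    have "\<bar>y $ i\<bar> \<le> 1/2"
      using assms(1) by (simp add: mem_ucube)
    then have "0 \<le> y $ i + 1/2" "y $ i + 1/2 \<le> 1"
      by linarith+
    then show "0 \<le> t" "t \<le> real k"
      by (auto simp: t_def intro: mult_left_le)
  qed
  have fl: "real (nat \<lfloor>t\<rfloor>) \<le> t" "t < real (nat \<lfloor>t\<rfloor>) + 1"
    using t by (auto simp: of_nat_floor)
  have "\<bar>t - (real (v i) + 1/2)\<bar> \<le> 1/2"
  proof (cases "nat \<lfloor>t\<rfloor> \<le> k - 1")
    case True
    then have "v i = nat \<lfloor>t\<rfloor>"
      by (simp add: v_def t_def)
    then show ?thesis
      using fl by linarith
  next
    case False
    then have "v i = k - 1"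
      by (simp add: v_def t_def)
    moreover have "real k \<le> t"
      using False fl(1) by linarith
    ultimately show ?thesis
      using t assms(2) by (simp add: of_nat_diff)
  qed
  then have "\<bar>t - (real (v i) + 1/2)\<bar> / real k \<le> 1 / 2 / real k"
    by (intro divide_right_mono) auto
  moreover have "y $ i - grid_center k v $ i = (t - (real (v i) + 1/2)) / real k"
    using assms(2) by (simp add: t_def grid_center_def field_simps)
  ultimately show "\<bar>y $ i - grid_center k v $ i\<bar> \<le> 1 / (2 * real k)"
    by (simp add: abs_divide)
qed

lemma ucube_subset_grid_cells:
  assumes "k > 0"
  shows "(ucube :: (real^'n) set) \<subseteq> (\<Union>v\<in>grid_index k. (\<lambda>z. grid_center k v + (1 / real k) *\<^sub>R z) ` ucube)"
proof
  fix y :: "real^'n" assume "y \<in> ucube"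
  then obtain v where v: "v \<in> grid_index k" "\<And>i. \<bar>y $ i - grid_center k v $ i\<bar> \<le> 1 / (2 * real k)"
    using ucube_grid[OF _ assms] by blast
  have "real k *\<^sub>R (y - grid_center k v) \<in> ucube"
  proof -
    have "\<bar>real k * (y $ i - grid_center k v $ i)\<bar> \<le> 1 / 2" for i
      using v(2)[of i] assms by (simp only: abs_mult) (simp add: field_simps)
    then show ?thesis
      by (simp add: mem_ucube)
  qed
  moreover have "y = grid_center k v + (1 / real k) *\<^sub>R (real k *\<^sub>R (y - grid_center k v))"
    using assms by simp
  ultimately show "y \<in> (\<Union>v\<in>grid_index k. (\<lambda>z. grid_center k v + (1 / real k) *\<^sub>R z) ` ucube)"
    using v(1) by blast
qed

lemma quant_err_nonneg: "0 < p \<Longrightarrow> 0 \<le> quant_err p S"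
  unfolding quant_err_def by (intro integral_nonneg integrable_infdist_powr compact_ucube) auto

text \<open>Each of the k^n subcubes receives a copy of \<open>S\<close> scaled by 1/k. A copy
  contributes the factor k^(-n) from the volume and k^(-2p) from the distances, and the k^n copies
  cancel the volume factor.\<close>

lemma quant_err_subdivide:
  fixes S :: "(real^'n) set"
  assumes "finite S" "S \<noteq> {}" "k > 0" "p > 0"
  obtains S' :: "(real^'n) set" where "finite S'" "S' \<noteq> {}" "card S' \<le> k ^ CARD('n) * card S"
    "quant_err p S' \<le> real k powr (- 2 * p) * quant_err p S"
proof
  define g where "g = (\<lambda>v z. grid_center k v + (1 / real k) *\<^sub>R z :: real^'n)"
  define S' where "S' = (\<Union>v\<in>grid_index k. g v ` S)"
  have ne: "grid_index k \<noteq> ({} :: ('n \<Rightarrow> nat) set)"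
    using card_grid_index[where 'n='n, of k] assms(3) by auto
  show fS: "finite S'"
    using assms finite_grid_index by (auto simp: S'_def)
  show "S' \<noteq> {}"
    using assms ne by (auto simp: S'_def)
  have "card S' \<le> (\<Sum>v\<in>(grid_index k :: ('n \<Rightarrow> nat) set). card (g v ` S))"
    unfolding S'_def by (intro card_UN_le finite_grid_index)
  also have "\<dots> \<le> (\<Sum>v\<in>(grid_index k :: ('n \<Rightarrow> nat) set). card S)"
    by (intro sum_mono card_image_le assms)
  finally show "card S' \<le> k ^ CARD('n) * card S"
    by (simp add: card_grid_index)
  have comp: "compact (g v ` ucube)" for v
    unfolding g_def by (intro compact_continuous_image continuous_intros compact_ucube)
  have "quant_err p S' \<le> (\<Sum>v\<in>(grid_index k :: ('n \<Rightarrow> nat) set). integral (g v ` ucube) (\<lambda>y. infdist y S' powr (2 * p)))"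
    unfolding quant_err_def
    using ucube_subset_grid_cells[OF assms(3), where 'n='n]
    by (intro integral_le_sum_cover integrable_infdist_powr assms compact_ucube comp finite_grid_index) (auto simp: g_def)
  also have "\<dots> \<le> (\<Sum>v\<in>(grid_index k :: ('n \<Rightarrow> nat) set). integral (g v ` ucube) (\<lambda>y. infdist y (g v ` S) powr (2 * p)))"
  proof (intro sum_mono integral_le integrable_infdist_powr assms comp)
    fix v :: "'n \<Rightarrow> nat" and x
    assume "v \<in> grid_index k"
    then have "infdist x S' \<le> infdist x (g v ` S)"
      using assms by (intro infdist_mono) (auto simp: S'_def)
    then show "infdist x S' powr (2 * p) \<le> infdist x (g v ` S) powr (2 * p)"
      using assms by (intro powr_mono2) (auto simp: infdist_nonneg)
  qed
  also have "\<dots> = (\<Sum>v\<in>(grid_index k :: ('n \<Rightarrow> nat) set). (1 / real k) ^ CARD('n) * (1 / real k) powr (2 * p) * quant_err p S)"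
    unfolding g_def using assms by (intro sum.cong refl integral_homothety_infdist) auto
  also have "\<dots> = real k powr (- 2 * p) * quant_err p S"
    using assms(3) by (simp add: card_grid_index powr_divide powr_minus_divide power_one_over)
  finally show "quant_err p S' \<le> real k powr (- 2 * p) * quant_err p S" .
qed

text \<open>The nearest-point projection onto the convex cube is 1-Lipschitz and fixes the cube.
  Having the points inside the cube is what lets them be transported into a cell of the domain and
  serve as points of tangency there.\<close>

lemma quant_err_project:
  fixes S :: "(real^'n) set"
  assumes "finite S" "S \<noteq> {}" "p > 0"
  obtains S' :: "(real^'n) set" where "finite S'" "S' \<noteq> {}" "S' \<subseteq> ucube" "card S' \<le> card S"
    "quant_err p S' \<le> quant_err p S"
proof
  let ?c = "closest_point (ucube :: (real^'n) set)"
  have cl: "closed (ucube :: (real^'n) set)" and ne: "(ucube :: (real^'n) set) \<noteq> {}"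
    using compact_ucube compact_imp_closed zero_in_ucube by blast+
  show "finite (?c ` S)" "?c ` S \<noteq> {}" "card (?c ` S) \<le> card S"
    using assms card_image_le by auto
  show "?c ` S \<subseteq> ucube"
    using closest_point_in_set[OF cl ne] by auto
  show "quant_err p (?c ` S) \<le> quant_err p S"
    unfolding quant_err_def
  proof (intro integral_le integrable_infdist_powr assms compact_ucube)
    fix y :: "real^'n" assume y: "y \<in> ucube"
    obtain a where a: "a \<in> S" "infdist y S = dist y a"
      using infdist_attains_inf[OF finite_imp_closed assms(2)] assms(1) by blast
    have "infdist y (?c ` S) \<le> dist y (?c a)"
      using a(1) by (intro infdist_le) auto
    also have "\<dots> = dist (?c y) (?c a)"
      using closest_point_self[OF y] by simp
    also have "\<dots> \<le> dist y a"
      by (rule closest_point_lipschitz[OF convex_ucube cl ne])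
    finally show "infdist y (?c ` S) powr (2 * p) \<le> infdist y S powr (2 * p)"
      using assms a(2) by (intro powr_mono2) (auto simp: infdist_nonneg)
  qed
qed

text \<open>The radius \<open>r\<close> is such that balls of radius \<open>r\<close> around the
  points of \<open>S\<close> have total volume 1/2; on the remaining half of the cube the distance
  to \<open>S\<close> is at least \<open>r\<close>. This makes the infimum in the next theorem
  positive.\<close>

lemma quant_err_lower_bound:
  fixes p :: real
  assumes "p > 0"
  obtains c where "c > 0"
    "\<And>S :: (real^'n) set. finite S \<Longrightarrow> S \<noteq> {} \<Longrightarrow> c * real (card S) powr (- (2 * p / CARD('n))) \<le> quant_err p S"
proof
  let ?n = "real CARD('n)"
  define V where "V = unit_ball_vol ?n"
  have V: "V > 0"
    by (simp add: V_def)
  define c where "c = (1 / (2 * V)) powr (2 * p / ?n) / 2"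
  show "c > 0"
    using V by (simp add: c_def)
  fix S :: "(real^'n) set"
  assume S: "finite S" "S \<noteq> {}"
  define k where "k = real (card S)"
  have k: "k > 0"
    using S by (simp add: k_def card_gt_0_iff)
  define r where "r = (1 / (2 * V * k)) powr (1 / ?n)"
  have r: "r > 0"
    using V k by (simp add: r_def)
  have rn: "r ^ CARD('n) = 1 / (2 * V * k)"
    using V k r by (simp add: r_def powr_powr flip: powr_realpow)
  define A where "A = (\<Union>s\<in>S. ball s r)"
  have A: "A \<in> lmeasurable"
    unfolding A_def using S by (intro fmeasurable.finite_UN) auto
  have "measure lebesgue A \<le> (\<Sum>s\<in>S. measure lebesgue (ball s r))"
    unfolding A_def using S by (intro measure_UNION_le) auto
  also have "\<dots> = k * (V * r ^ CARD('n))"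
    using r by (simp add: content_ball V_def k_def)
  also have "\<dots> = 1 / 2"
    using V k by (simp add: rn)
  finally have mA: "measure lebesgue A \<le> 1 / 2" .
  have U: "(ucube :: (real^'n) set) \<in> lmeasurable"
    by (simp add: lmeasurable_compact compact_ucube)
  have UA: "ucube - A \<in> lmeasurable"
    using U A by (intro fmeasurable.Diff) auto
  have "measure lebesgue (ucube - A) \<ge> measure lebesgue (ucube :: (real^'n) set) - measure lebesgue A"
    by (rule measure_diff_le_measure_setdiff[OF U A])
  then have mU: "measure lebesgue (ucube - A) \<ge> 1 / 2"
    using mA by (simp add: measure_ucube)
  have "r powr (2 * p) / 2 \<le> r powr (2 * p) * measure lebesgue (ucube - A)"
    using mU mult_left_mono[OF mU, of "r powr (2 * p)"] by simp
  also have "\<dots> = integral (ucube - A) (\<lambda>_. r powr (2 * p))"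
    using lmeasure_integral[OF UA] integral_mult_right[of "ucube - A" "r powr (2 * p)" "\<lambda>_. 1::real"] by simp
  also have "\<dots> = integral UNIV (\<lambda>x. if x \<in> ucube - A then r powr (2 * p) else 0)"
    by (simp only: integral_restrict_UNIV)
  also have "\<dots> \<le> integral UNIV (\<lambda>x. if x \<in> ucube then infdist x S powr (2 * p) else 0)"
  proof (rule integral_le)
    show "(\<lambda>x. if x \<in> ucube - A then r powr (2 * p) else 0) integrable_on UNIV"
      using integrable_on_const[OF UA] by (simp only: integrable_restrict_UNIV)
    show "(\<lambda>x. if x \<in> ucube then infdist x S powr (2 * p) else 0) integrable_on UNIV"
      using integrable_infdist_powr[OF assms compact_ucube] by (simp only: integrable_restrict_UNIV)
    fix x :: "real^'n"
    obtain a where a: "a \<in> S" "infdist x S = dist x a"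
      using infdist_attains_inf[OF finite_imp_closed S(2)] S(1) by blast
    show "(if x \<in> ucube - A then r powr (2 * p) else 0) \<le> (if x \<in> ucube then infdist x S powr (2 * p) else 0)"
    proof (cases "x \<in> ucube - A")
      case True
      then have "r \<le> infdist x S"
        using a by (auto simp: A_def dist_commute not_less)
      then show ?thesis
        using True r assms by (auto intro!: powr_mono2)
    qed auto
  qed
  also have "\<dots> = quant_err p S"
    by (simp only: integral_restrict_UNIV quant_err_def)
  finally have "r powr (2 * p) / 2 \<le> quant_err p S" .
  moreover have "r powr (2 * p) = (1 / (2 * V)) powr (2 * p / ?n) * k powr (- (2 * p / ?n))"
    using V k by (simp add: r_def powr_powr powr_mult powr_divide powr_minus_divide)
  ultimately show "c * real (card S) powr (- (2 * p / ?n)) \<le> quant_err p S"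
    by (simp add: c_def k_def)
qed

text \<open>Subdividing a nearly optimal \<open>S0\<close> with \<open>m\<close> points gives only
  the cardinalities k^n m. For \<open>M\<close> in between, the largest such cardinality below
  \<open>M\<close> is used; the loss is at most the factor ((k+1)/k)^(2p), which tends to 1.\<close>

theorem quantization_constant:
  fixes p :: real
  assumes "p > 0"
  obtains \<delta> :: real where "\<delta> > 0"
    "\<And>S :: (real^'n) set. finite S \<Longrightarrow> S \<noteq> {} \<Longrightarrow> \<delta> * real (card S) powr (- (2 * p / CARD('n))) \<le> quant_err p S"
    "\<And>\<epsilon>. \<epsilon> > 0 \<Longrightarrow> \<forall>\<^sub>F k in sequentially. \<exists>S :: (real^'n) set. finite S \<and> S \<noteq> {} \<and> S \<subseteq> ucube \<and> card S \<le> k \<and>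
       quant_err p S \<le> (\<delta> + \<epsilon>) * real k powr (- (2 * p / CARD('n)))"
proof -
  let ?n = "real CARD('n)"
  define a where "a = 2 * p / ?n"
  have a: "a > 0"
    using assms by (simp add: a_def)
  define F where "F = {S :: (real^'n) set. finite S \<and> S \<noteq> {}}"
  define g where "g = (\<lambda>S :: (real^'n) set. real (card S) powr a * quant_err p S)"
  obtain c where c: "c > 0" "\<And>S :: (real^'n) set. finite S \<Longrightarrow> S \<noteq> {} \<Longrightarrow> c * real (card S) powr (- a) \<le> quant_err p S"
    using quant_err_lower_bound[OF assms, where 'n='n] unfolding a_def by metis
  have card0: "real (card S) > 0" if "S \<in> F" for S
    using that by (simp add: F_def card_gt_0_iff)
  have cg: "c \<le> g S" if "S \<in> F" for S
    using c(2)[of S] card0[OF that] that unfolding F_def g_def by (simp add: powr_minus field_simps)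
  have Fne: "F \<noteq> {}"
    unfolding F_def by blast
  define \<delta> where "\<delta> = Inf (g ` F)"
  have bdd: "bdd_below (g ` F)"
    using cg by (intro bdd_belowI2) blast
  have \<delta>le: "\<delta> \<le> g S" if "S \<in> F" for S
    unfolding \<delta>_def using that bdd by (intro cInf_lower) auto
  have "c \<le> \<delta>"
    unfolding \<delta>_def using Fne cg by (intro cInf_greatest) auto
  with c(1) have \<delta>0: "\<delta> > 0" by simp
  have low: "\<delta> * real (card S) powr (- a) \<le> quant_err p S" if "finite S" "S \<noteq> {}" for S :: "(real^'n) set"
      using \<delta>le[of S] card0[of S] that unfolding F_def g_def by (simp add: powr_minus field_simps)
  have upp: "\<forall>\<^sub>F M in sequentially. \<exists>S :: (real^'n) set. finite S \<and> S \<noteq> {} \<and> S \<subseteq> ucube \<and> card S \<le> M \<and>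
       quant_err p S \<le> (\<delta> + \<epsilon>) * real M powr (- a)" if \<epsilon>: "\<epsilon> > 0" for \<epsilon> :: real
  proof -
    have "\<exists>y\<in>g ` F. y < \<delta> + \<epsilon>"
      using cInf_lessD[of "g ` F" "\<delta> + \<epsilon>"] Fne \<epsilon> by (simp add: \<delta>_def)
    then obtain S0 where S0: "S0 \<in> F" "g S0 < \<delta> + \<epsilon>" by blast
    define m where "m = card S0"
    have m: "m > 0"
      using card0[OF S0(1)] by (simp add: m_def)
    have "(\<lambda>k. (real k + 1) / real k) \<longlonglongrightarrow> 1"
      by real_asymp
    then have "((\<lambda>k. ((real k + 1) / real k) powr (2 * p) * g S0) \<longlongrightarrow> 1 powr (2 * p) * g S0) sequentially"
      by (intro tendsto_mult tendsto_powr tendsto_const) auto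
    then have "\<forall>\<^sub>F k in sequentially. ((real k + 1) / real k) powr (2 * p) * g S0 < \<delta> + \<epsilon>"
      using S0(2) by (intro order_tendstoD) auto
    then obtain K where K: "\<And>k. k \<ge> K \<Longrightarrow> ((real k + 1) / real k) powr (2 * p) * g S0 < \<delta> + \<epsilon>"
      unfolding eventually_sequentially by blast
    \<comment> \<open>\<open>max K 1\<close> in place of \<open>K\<close> ensures that the number of
      subdivisions is positive.\<close>
    define N where "N = (max K 1) ^ CARD('n) * m"
    show "\<forall>\<^sub>F M in sequentially. \<exists>S :: (real^'n) set. finite S \<and> S \<noteq> {} \<and> S \<subseteq> ucube \<and> card S \<le> M \<and>
       quant_err p S \<le> (\<delta> + \<epsilon>) * real M powr (- a)"
      unfolding eventually_sequentially
    proof (rule exI[of _ N], intro allI impI)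
      fix M assume "M \<ge> N"
      define k where "k = Max {k. k ^ CARD('n) * m \<le> M}"
      have fin: "finite {k. k ^ CARD('n) * m \<le> M}"
      proof (rule finite_subset[of _ "{..M}"])
        show "{k. k ^ CARD('n) * m \<le> M} \<subseteq> {..M}"
        proof clarify
          fix k assume k: "k ^ CARD('n) * m \<le> M"
          have "k \<le> k ^ CARD('n)"
            by (cases "k = 0") (auto intro: self_le_power)
          also have "\<dots> \<le> k ^ CARD('n) * m"
            using m by simp
          finally show "k \<le> M" using k by simp
        qed
      qed simp
      have maxK: "max K 1 \<in> {k. k ^ CARD('n) * m \<le> M}"
        using \<open>M \<ge> N\<close> by (simp add: N_def)
      have kM: "k ^ CARD('n) * m \<le> M"
        using Max_in[OF fin] maxK unfolding k_def by blast
      have "max K 1 \<le> k"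
        unfolding k_def by (rule Max_ge[OF fin maxK])
      then have kK: "k \<ge> K" "k \<ge> 1" by auto
      have "\<not> Suc k ^ CARD('n) * m \<le> M"
      proof
        assume "Suc k ^ CARD('n) * m \<le> M"
        then have "Suc k \<le> k"
          using Max_ge[OF fin, of "Suc k"] unfolding k_def by simp
        then show False by simp
      qed
      then have "real M < real (Suc k ^ CARD('n) * m)"
        by linarith
      then have Mle: "real M \<le> (real k + 1) ^ CARD('n) * real m"
        by (simp add: add.commute)
      have M0: "real M > 0"
        using kM kK m by (metis mult_pos_pos less_le_trans of_nat_0_less_iff zero_less_one zero_less_power)
      obtain S1 :: "(real^'n) set" where S1: "finite S1" "S1 \<noteq> {}" "card S1 \<le> k ^ CARD('n) * card S0"
        "quant_err p S1 \<le> real k powr (- 2 * p) * quant_err p S0"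
        using quant_err_subdivide[of S0 k p] S0 kK assms unfolding F_def by auto
      obtain S2 :: "(real^'n) set" where S2: "finite S2" "S2 \<noteq> {}" "S2 \<subseteq> ucube" "card S2 \<le> card S1" "quant_err p S2 \<le> quant_err p S1"
        using quant_err_project[OF S1(1,2) assms] by blast
      have "real M powr a \<le> ((real k + 1) ^ CARD('n) * real m) powr a"
        using Mle a M0 by (intro powr_mono2) auto
      also have "\<dots> = (real k + 1) powr (2 * p) * real m powr a"
        by (simp add: powr_mult powr_powr a_def flip: powr_realpow)
      finally have "real M powr a * quant_err p S2
          \<le> ((real k + 1) powr (2 * p) * real m powr a) * (real k powr (- 2 * p) * quant_err p S0)"
        using S1 S2 quant_err_nonneg[OF assms] by (intro mult_mono) auto
      also have "\<dots> = ((real k + 1) / real k) powr (2 * p) * g S0"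
        using kK by (simp add: g_def m_def powr_divide powr_minus_divide)
      also have "\<dots> < \<delta> + \<epsilon>"
        by (rule K[OF kK(1)])
      finally have "quant_err p S2 \<le> (\<delta> + \<epsilon>) * real M powr (- a)"
        using M0 by (simp add: powr_minus field_simps)
      then show "\<exists>S :: (real^'n) set. finite S \<and> S \<noteq> {} \<and> S \<subseteq> ucube \<and> card S \<le> M \<and>
         quant_err p S \<le> (\<delta> + \<epsilon>) * real M powr (- a)"
        using S2 S1(3) kM unfolding m_def by (intro exI[of _ S2]) auto
    qed
  qed
  show thesis
    by (rule that[OF \<delta>0 low[unfolded a_def] upp[unfolded a_def]])
qed

section \<open>Covering by cells of prescribed shape\<close>

text \<open>A parallelepiped with centre \<open>c\<close> whose edges are the columns of
  \<open>L\<close> scaled by \<open>h\<close>. Scale and shape are kept apart because the Hessian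
  prescribes \<open>L\<close>, whereas the covering chooses \<open>c\<close> and
  \<open>h\<close>.\<close>

definition cell :: "real^'n^'n \<Rightarrow> real^'n \<Rightarrow> real \<Rightarrow> (real^'n) set" where
  "cell L c h = (\<lambda>y. c + (h *\<^sub>R L) *v y) ` ucube"

definition open_cell :: "real^'n^'n \<Rightarrow> real^'n \<Rightarrow> real \<Rightarrow> (real^'n) set" where
  "open_cell L c h = (\<lambda>y. c + (h *\<^sub>R L) *v y) ` open_ucube"

lemma open_cell_subset: "open_cell L c h \<subseteq> cell L c h"
  unfolding cell_def open_cell_def using open_ucube_subset by blast

lemma compact_cell: "compact (cell L c h)"
  unfolding cell_def
  by (intro compact_continuous_image continuous_intros matrix_vector_mult_linear_continuous_on compact_ucube)

lemma convex_cell: "convex (cell L c h)"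
proof -
  have "cell L c h = (+) c ` (*v) (h *\<^sub>R L) ` ucube"
    by (simp add: cell_def image_image)
  then show ?thesis
    by (simp only: convex_translation_eq) (intro convex_linear_image matrix_vector_mul_linear convex_ucube)
qed

lemma lmeasurable_cell: "cell L c h \<in> lmeasurable"
  by (simp add: lmeasurable_compact compact_cell)

lemma measure_cell:
  fixes L :: "real^'n^'n"
  assumes "h > 0"
  shows "measure lebesgue (cell L c h) = h ^ CARD('n) * \<bar>det L\<bar>"
  unfolding cell_def using assms
  by (subst measure_affine_image)
     (auto simp: lmeasurable_compact compact_ucube measure_ucube det_scaleR_matrix abs_mult)

lemma negligible_cell_diff:
  fixes L :: "real^'n^'n"
  shows "negligible (cell L c h - open_cell L c h)"
proof (rule negligible_subset)
  show "negligible ((+) c ` (*v) (h *\<^sub>R L) ` (ucube - open_ucube))"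
    using negligible_ucube_diff[where 'n='n]
    by (intro negligible_translation) (simp add: negligible_iff_measure lmeasurable_matrix_image measure_matrix_image)
  show "cell L c h - open_cell L c h \<subseteq> (+) c ` (*v) (h *\<^sub>R L) ` (ucube - open_ucube)"
    unfolding cell_def open_cell_def by (auto simp: image_image)
qed

lemma inj_cell_map:
  fixes L :: "real^'n^'n"
  assumes "h \<noteq> 0" "det L \<noteq> 0"
  shows "inj (\<lambda>y. c + (h *\<^sub>R L) *v y)"
proof -
  have "det (h *\<^sub>R L) \<noteq> 0"
    using assms by (simp add: det_scaleR_matrix)
  then have "inj ((*v) (h *\<^sub>R L))"
    by (metis det_nz_iff_inj matrix_of_matrix_vector_mul matrix_vector_mul_linear)
  then show ?thesis
    by (simp add: inj_on_def)
qed

lemma open_open_cell: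
  fixes L :: "real^'n^'n"
  assumes "h \<noteq> 0" "det L \<noteq> 0"
  shows "open (open_cell L c h)"
proof -
  have "det (h *\<^sub>R L) \<noteq> 0"
    using assms by (simp add: det_scaleR_matrix)
  then have "inj ((*v) (h *\<^sub>R L))"
    by (metis det_nz_iff_inj matrix_of_matrix_vector_mul matrix_vector_mul_linear)
  then have "surj ((*v) (h *\<^sub>R L))"
    by (intro linear_injective_imp_surjective) auto
  then have "open ((*v) (h *\<^sub>R L) ` open_ucube)"
    by (intro open_surjective_linear_image) (auto simp: open_ucube_def)
  then have "open ((+) c ` (*v) (h *\<^sub>R L) ` open_ucube)"
    by (rule open_translation)
  then show ?thesis
    by (simp add: open_cell_def image_image)
qed

section \<open>Cubes as cells, and finite coverings\<close>

lemma cell_mat_1: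
  fixes c :: "real^'n"
  assumes "h > 0"
  shows "cell (mat 1) c h = {x. \<forall>i. \<bar>x $ i - c $ i\<bar> \<le> h / 2}"
    and "open_cell (mat 1) c h = {x. \<forall>i. \<bar>x $ i - c $ i\<bar> < h / 2}"
proof -
  have eq: "x \<in> (\<lambda>y. c + (h *\<^sub>R mat 1) *v y) ` S \<longleftrightarrow> (1 / h) *\<^sub>R (x - c) \<in> S" for x and S :: "(real^'n) set"
  proof
    assume "(1 / h) *\<^sub>R (x - c) \<in> S"
    moreover have "x = c + (h *\<^sub>R mat 1) *v ((1 / h) *\<^sub>R (x - c))"
      using assms by (simp add: scaleR_mat_mult_vec)
    ultimately show "x \<in> (\<lambda>y. c + (h *\<^sub>R mat 1) *v y) ` S" by blast
  qed (use assms in \<open>auto simp: scaleR_mat_mult_vec\<close>)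
  have "\<bar>(1 / h) * t\<bar> \<le> 1 / 2 \<longleftrightarrow> \<bar>t\<bar> \<le> h / 2" "\<bar>(1 / h) * t\<bar> < 1 / 2 \<longleftrightarrow> \<bar>t\<bar> < h / 2" for t
    using assms by (auto simp: abs_mult field_simps)
  then show "cell (mat 1) c h = {x. \<forall>i. \<bar>x $ i - c $ i\<bar> \<le> h / 2}"
    "open_cell (mat 1) c h = {x. \<forall>i. \<bar>x $ i - c $ i\<bar> < h / 2}"
    unfolding cell_def open_cell_def set_eq_iff mem_Collect_eq eq mem_ucube mem_open_ucube
    by simp_all
qed

lemma cube_eq_cell:
  fixes u v :: "real^'n"
  assumes "\<And>i. v $ i - u $ i = h" "h > 0"
  shows "cbox u v = cell (mat 1) ((1/2) *\<^sub>R (u + v)) h" "box u v = open_cell (mat 1) ((1/2) *\<^sub>R (u + v)) h"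
proof -
  have vi: "v $ i = u $ i + h" for i
    using assms(1)[of i] by simp
  have "(u $ i \<le> t \<and> t \<le> v $ i) = (\<bar>t - (u $ i + v $ i) / 2\<bar> \<le> h / 2)"
    "(u $ i < t \<and> t < v $ i) = (\<bar>t - (u $ i + v $ i) / 2\<bar> < h / 2)" for i t
    unfolding vi by (auto simp: abs_le_iff abs_less_iff field_simps)
  then show "cbox u v = cell (mat 1) ((1/2) *\<^sub>R (u + v)) h" "box u v = open_cell (mat 1) ((1/2) *\<^sub>R (u + v)) h"
    using assms(2) by (auto simp: cell_mat_1 mem_box_cart)
qed

text \<open>Subordinating a dyadic covering to a gauge with values inside \<open>U\<close> yields
  countably many cubes with union \<open>U\<close>, and finitely many of them exhaust the measure up
  to \<open>\<eta>\<close>. In a triple \<open>(x, c, h)\<close> the tag \<open>x\<close> is the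
  point of the cube at which the gauge was taken; it differs from the centre \<open>c\<close> in
  general.\<close>

lemma cube_cover:
  fixes U :: "(real^'n) set"
  assumes U: "open U" "bounded U" and r: "\<And>x. x \<in> U \<Longrightarrow> r x > 0" and \<eta>: "\<eta> > 0"
  obtains C :: "((real^'n) \<times> (real^'n) \<times> real) set" where "finite C"
    "\<And>x c h. (x, c, h) \<in> C \<Longrightarrow> x \<in> U \<and> h > 0 \<and> cell (mat 1) c h \<subseteq> ball x (r x) \<inter> U"
    "\<And>x c h x' c' h'. (x, c, h) \<in> C \<Longrightarrow> (x', c', h') \<in> C \<Longrightarrow> (x, c, h) \<noteq> (x', c', h') \<Longrightarrow>
       open_cell (mat 1) c h \<inter> open_cell (mat 1) c' h' = {}"
    "measure lebesgue (U - (\<Union>(x, c, h)\<in>C. cell (mat 1) c h)) < \<eta>"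
proof -
  obtain B where B: "B > 0" "\<And>x. x \<in> U \<Longrightarrow> norm x \<le> B"
    using U(2) bounded_pos by blast
  \<comment> \<open>The outer box has equal sides, so all its dyadic pieces are cubes.\<close>
  define a b :: "real^'n" where "a = (\<chi> i. - B)" and "b = (\<chi> i. B)"
  \<comment> \<open>The unit ball is a default off \<open>U\<close>: a gauge is defined everywhere,
    while the tags obtained below lie in \<open>U\<close>.\<close>
  define g where "g = (\<lambda>x. if x \<in> U then ball x (r x) \<inter> U else ball x 1)"
  have Uab: "U \<subseteq> cbox a b"
  proof
    fix x assume "x \<in> U"
    then have "\<bar>x $ i\<bar> \<le> B" for i
      using B(2) component_le_norm_cart order_trans by blast
    then show "x \<in> cbox a b"
      by (auto simp: a_def b_def mem_box_cart abs_le_iff minus_le_iff)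
  qed
  have ab: "box a b \<noteq> {}"
    using B(1) by (auto simp: a_def b_def interval_ne_empty_cart)
  have g: "gauge g"
    using U r by (auto simp: gauge_def g_def)
  obtain \<D> where "countable \<D>" "\<Union>\<D> \<subseteq> cbox a b" and D:
    "\<And>K. K \<in> \<D> \<Longrightarrow> interior K \<noteq> {} \<and> (\<exists>c d. K = cbox c d)"
    "pairwise (\<lambda>A B. interior A \<inter> interior B = {}) \<D>"
    "\<And>K. K \<in> \<D> \<Longrightarrow> \<exists>x \<in> U \<inter> K. K \<subseteq> g x"
    "\<And>u v. cbox u v \<in> \<D> \<Longrightarrow> \<exists>n. \<forall>i \<in> Basis. v \<bullet> i - u \<bullet> i = (b \<bullet> i - a \<bullet> i) / 2^n"
    "U \<subseteq> \<Union>\<D>"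
    by (rule covering_lemma[OF Uab ab g]) blast
  have "\<exists>t. case t of (x, c, h) \<Rightarrow> x \<in> U \<and> h > 0 \<and> K = cell (mat 1) c h \<and> interior K = open_cell (mat 1) c h
      \<and> K \<subseteq> ball x (r x) \<inter> U" if K: "K \<in> \<D>" for K
  proof -
    obtain u v where uv: "K = cbox u v"
      using D(1)[OF K] by blast
    obtain n where n: "\<forall>i \<in> Basis. v \<bullet> i - u \<bullet> i = (b \<bullet> i - a \<bullet> i) / 2^n"
      using D(4) K uv by blast
    have "v $ i - u $ i = 2 * B / 2 ^ n" for i
      using n[rule_format, of "axis i 1"] by (simp add: axis_in_Basis_iff inner_axis a_def b_def)
    note eq = cube_eq_cell[OF this]
    have "K = cell (mat 1) ((1/2) *\<^sub>R (u + v)) (2 * B / 2 ^ n)"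
      unfolding uv by (rule eq) (use B(1) in simp)
    moreover have "interior K = open_cell (mat 1) ((1/2) *\<^sub>R (u + v)) (2 * B / 2 ^ n)"
      unfolding uv interior_cbox by (rule eq) (use B(1) in simp)
    moreover obtain x where "x \<in> U \<inter> K" "K \<subseteq> g x"
      using D(3)[OF K] by blast
    ultimately show ?thesis
      using B(1) by (intro exI[of _ "(x, (1/2) *\<^sub>R (u + v), 2 * B / 2 ^ n)"]) (auto simp: g_def)
  qed
  then have "\<forall>K\<in>\<D>. \<exists>t. case t of (x, c, h) \<Rightarrow> x \<in> U \<and> h > 0 \<and> K = cell (mat 1) c h \<and>
      interior K = open_cell (mat 1) c h \<and> K \<subseteq> ball x (r x) \<inter> U" ..
  from bchoice[OF this] obtain t where "\<forall>K\<in>\<D>. case t K of (x, c, h) \<Rightarrow> x \<in> U \<and> h > 0 \<and> K = cell (mat 1) c h \<and>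
      interior K = open_cell (mat 1) c h \<and> K \<subseteq> ball x (r x) \<inter> U" ..
  then have t: "case t K of (x, c, h) \<Rightarrow> x \<in> U \<and> h > 0 \<and> K = cell (mat 1) c h \<and>
      interior K = open_cell (mat 1) c h \<and> K \<subseteq> ball x (r x) \<inter> U" if "K \<in> \<D>" for K
    using that ..
  have UD: "U = \<Union>\<D>"
    using D(5) t by (fastforce split: prod.splits)
  have Km: "K \<in> lmeasurable" if "K \<in> \<D>" for K
    using t[OF that] lmeasurable_cell by (auto split: prod.splits)
  have Um: "U \<in> lmeasurable"
    using U by (simp add: lmeasurable_open)
  obtain D' where D': "D' \<subseteq> \<D>" "finite D'" "measure lebesgue (\<Union>\<D>) - \<eta> < measure lebesgue (\<Union>D')"
  proof (rule measure_countable_Union_approachable[OF \<open>countable \<D>\<close> \<eta>])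
    show "measure lebesgue (\<Union>E) \<le> measure lebesgue U" if "E \<subseteq> \<D>" "finite E" for E
      using that Km Um by (intro measure_mono_fmeasurable) (auto simp: UD)
  qed (use Km in auto)
  have UD'm: "\<Union>D' \<in> lmeasurable"
    using D' Km by (intro fmeasurable.finite_Union) auto
  have "measure lebesgue (U - \<Union>D') = measure lebesgue U - measure lebesgue (\<Union>D')"
    using Um UD'm D'(1) by (intro measurable_measure_Diff) (auto simp: UD)
  then have mU: "measure lebesgue (U - \<Union>D') < \<eta>"
    using D'(3) by (simp add: UD)
  have un: "(\<Union>(x, c, h)\<in>t ` D'. cell (mat 1) c h) = \<Union>D'"
  proof -
    have "(case t K of (x, c, h) \<Rightarrow> cell (mat 1) c h) = K" if "K \<in> D'" for K
      using t[of K] that D'(1) by (auto split: prod.splits)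
    then show ?thesis by auto
  qed
  show thesis
  proof (rule that[of "t ` D'"])
    show "finite (t ` D')"
      using D' by simp
    show "x \<in> U \<and> h > 0 \<and> cell (mat 1) c h \<subseteq> ball x (r x) \<inter> U" if xch: "(x, c, h) \<in> t ` D'" for x c h
    proof -
      obtain K where K: "K \<in> \<D>" "t K = (x, c, h)"
        using xch D'(1) by (metis (no_types) imageE subsetD)
      show ?thesis
        using t[OF K(1)] unfolding K(2) prod.case by blast
    qed
    show "open_cell (mat 1) c h \<inter> open_cell (mat 1) c' h' = {}"
      if xch: "(x, c, h) \<in> t ` D'" "(x', c', h') \<in> t ` D'" "(x, c, h) \<noteq> (x', c', h')" for x c h x' c' h'
    proof -
      obtain K where K: "K \<in> \<D>" "t K = (x, c, h)"
        using xch(1) D'(1) by (metis (no_types) imageE subsetD)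
      obtain K' where K': "K' \<in> \<D>" "t K' = (x', c', h')"
        using xch(2) D'(1) by (metis (no_types) imageE subsetD)
      have "K \<noteq> K'"
        using K(2) K'(2) xch(3) by metis
      then have "interior K \<inter> interior K' = {}"
        using D(2) K(1) K'(1) unfolding pairwise_def by blast
      then show ?thesis
        using t[OF K(1)] t[OF K'(1)] unfolding K(2) K'(2) prod.case by metis
    qed
    show "measure lebesgue (U - (\<Union>(x, c, h)\<in>t ` D'. cell (mat 1) c h)) < \<eta>"
      using mU by (simp only: un)
  qed
qed

lemma matrix_image_cell_mat_1:
  fixes L :: "real^'n^'n"
  shows "(*v) L ` cell (mat 1) c h = cell L (L *v c) h"
    and "(*v) L ` open_cell (mat 1) c h = open_cell L (L *v c) h"
  unfolding cell_def open_cell_def image_image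
  by (simp_all add: scaleR_mat_mult_vec matrix_vector_right_distrib matrix_vector_mult_scaleR scaleR_matrix_vector_assoc)

text \<open>Cells of prescribed shape: first use cubes so small that one shape can be fixed in each of them,
  then fill every cube with cells of that shape.\<close>

lemma cell_cover:
  fixes U :: "(real^'n) set" and L :: "real^'n \<Rightarrow> real^'n^'n"
  assumes U: "open U" "bounded U" and r: "\<And>x. x \<in> U \<Longrightarrow> r x > 0" and L: "\<And>x. x \<in> U \<Longrightarrow> det (L x) \<noteq> 0" and \<eta>: "\<eta> > 0"
  obtains C :: "((real^'n) \<times> (real^'n) \<times> real) set" where "finite C"
    "\<And>x c h. (x, c, h) \<in> C \<Longrightarrow> x \<in> U \<and> h > 0 \<and> cell (L x) c h \<subseteq> ball x (r x) \<inter> U"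
    "\<And>x c h x' c' h'. (x, c, h) \<in> C \<Longrightarrow> (x', c', h') \<in> C \<Longrightarrow> (x, c, h) \<noteq> (x', c', h') \<Longrightarrow>
       open_cell (L x) c h \<inter> open_cell (L x') c' h' = {}"
    "measure lebesgue (U - (\<Union>(x, c, h)\<in>C. cell (L x) c h)) < \<eta>"
proof -
  obtain C where C: "finite C"
    "\<And>x c h. (x, c, h) \<in> C \<Longrightarrow> x \<in> U \<and> h > 0 \<and> cell (mat 1) c h \<subseteq> ball x (r x) \<inter> U"
    "\<And>x c h x' c' h'. (x, c, h) \<in> C \<Longrightarrow> (x', c', h') \<in> C \<Longrightarrow> (x, c, h) \<noteq> (x', c', h') \<Longrightarrow>
       open_cell (mat 1) c h \<inter> open_cell (mat 1) c' h' = {}"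
    "measure lebesgue (U - (\<Union>(x, c, h)\<in>C. cell (mat 1) c h)) < \<eta> / 2"
    using cube_cover[where r = r and \<eta> = "\<eta> / 2", OF U r] \<eta> by (metis half_gt_zero)
  define O1 where "O1 = (\<lambda>(x :: real^'n, c :: real^'n, h). open_cell (mat 1) c h)"
  \<comment> \<open>All cubes together may leave \<open>\<eta> / 2\<close> uncovered; the summand 1
    keeps the quotient positive for empty \<open>C\<close>.\<close>
  define \<kappa> where "\<kappa> = \<eta> / (2 * (real (card C) + 1))"
  have \<kappa>: "\<kappa> > 0"
    using \<eta> by (simp add: \<kappa>_def add_pos_nonneg)
  have "\<exists>E. finite E \<and> (\<forall>c h. (c, h) \<in> E \<longrightarrow> h > 0 \<and> cell (L (fst t)) c h \<subseteq> O1 t)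
      \<and> (\<forall>c h c' h'. (c, h) \<in> E \<longrightarrow> (c', h') \<in> E \<longrightarrow> (c, h) \<noteq> (c', h') \<longrightarrow> open_cell (L (fst t)) c h \<inter> open_cell (L (fst t)) c' h' = {})
      \<and> measure lebesgue (O1 t - (\<Union>(c, h)\<in>E. cell (L (fst t)) c h)) < \<kappa>" if t: "t \<in> C" for t
  proof -
    obtain x c h where xch: "t = (x, c, h)"
      by (cases t)
    have x: "x \<in> U" "h > 0"
      using C(2) t xch by auto
    have dL: "det (L x) \<noteq> 0"
      by (rule L[OF x(1)])
    obtain B where AB: "L x ** B = mat 1" "B ** L x = mat 1"
      using dL by (auto simp: invertible_det_nz[symmetric] invertible_def)
    have inv: "L x *v (B *v y) = y" "B *v (L x *v y) = y" for y
      by (simp_all add: matrix_vector_mul_assoc AB)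
    have O1: "open (O1 t)" "bounded (O1 t)"
      using open_open_cell[of h "mat 1"] x(2) compact_cell[of "mat 1" c h] open_cell_subset[of "mat 1" c h]
      by (auto simp: O1_def xch intro: bounded_subset[OF compact_imp_bounded])
    \<comment> \<open>In the coordinates given by the inverse of \<open>L x\<close> the desired
      cells are cubes, so \<open>cube_cover\<close> applies to the transformed open cube, with the
      tolerance divided by the determinant.\<close>
    define V where "V = (*v) B ` O1 t"
    have LV: "(*v) (L x) ` V = O1 t"
      by (simp add: V_def image_image inv)
    have "surj ((*v) B)"
      using inv(2) by (metis surjI)
    then have V: "open V" "bounded V"
      unfolding V_def using O1
      by (auto intro: open_surjective_linear_image bounded_linear_image matrix_vector_mul_bounded_linear)
    obtain E where E: "finite E"
      "\<And>y c h. (y, c, h) \<in> E \<Longrightarrow> y \<in> V \<and> h > 0 \<and> cell (mat 1) c h \<subseteq> ball y 1 \<inter> V"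
      "\<And>y c h y' c' h'. (y, c, h) \<in> E \<Longrightarrow> (y', c', h') \<in> E \<Longrightarrow> (y, c, h) \<noteq> (y', c', h') \<Longrightarrow>
         open_cell (mat 1) c h \<inter> open_cell (mat 1) c' h' = {}"
      "measure lebesgue (V - (\<Union>(y, c, h)\<in>E. cell (mat 1) c h)) < \<kappa> / \<bar>det (L x)\<bar>"
      using cube_cover[where r = "\<lambda>_. 1" and \<eta> = "\<kappa> / \<bar>det (L x)\<bar>", OF V] \<kappa> dL
      by (metis divide_pos_pos zero_less_abs_iff zero_less_one)
    define E' where "E' = (\<lambda>(y, c, h). (L x *v c, h)) ` E"
    have injL: "inj ((*v) (L x))"
      using inv(2) by (metis injI)
    have "finite E'"
      using E(1) by (simp add: E'_def)
    moreover have "h > 0 \<and> cell (L x) c h \<subseteq> O1 t" if ch: "(c, h) \<in> E'" for c h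
    proof -
      obtain y c' where y: "(y, c', h) \<in> E" "c = L x *v c'"
        using ch by (auto simp: E'_def)
      have "(*v) (L x) ` cell (mat 1) c' h \<subseteq> (*v) (L x) ` V"
        using E(2)[OF y(1)] by blast
      then show ?thesis
        using E(2)[OF y(1)] by (simp add: LV matrix_image_cell_mat_1 y(2))
    qed
    moreover have "open_cell (L x) c h \<inter> open_cell (L x) c' h' = {}"
      if ch: "(c, h) \<in> E'" "(c', h') \<in> E'" "(c, h) \<noteq> (c', h')" for c h c' h'
    proof -
      obtain y d where y: "(y, d, h) \<in> E" "c = L x *v d"
        using ch by (auto simp: E'_def)
      obtain y' d' where y': "(y', d', h') \<in> E" "c' = L x *v d'"
        using ch by (auto simp: E'_def)
      have "open_cell (mat 1) d h \<inter> open_cell (mat 1) d' h' = {}"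
        using E(3)[OF y(1) y'(1)] ch(3) y(2) y'(2) by auto
      then have "(*v) (L x) ` (open_cell (mat 1) d h) \<inter> (*v) (L x) ` (open_cell (mat 1) d' h') = {}"
        by (simp add: image_Int[OF injL, symmetric])
      then show ?thesis
        by (simp add: matrix_image_cell_mat_1 y(2) y'(2))
    qed
    moreover have "measure lebesgue (O1 t - (\<Union>(c, h)\<in>E'. cell (L x) c h)) < \<kappa>"
    proof -
      have "(\<Union>(c, h)\<in>E'. cell (L x) c h) = (*v) (L x) ` (\<Union>(y, c, h)\<in>E. cell (mat 1) c h)"
        unfolding E'_def by (simp add: image_UN case_prod_unfold matrix_image_cell_mat_1)
      then have eq: "O1 t - (\<Union>(c, h)\<in>E'. cell (L x) c h) = (*v) (L x) ` (V - (\<Union>(y, c, h)\<in>E. cell (mat 1) c h))"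
        by (simp add: image_set_diff[OF injL] LV)
      have "V - (\<Union>(y, c, h)\<in>E. cell (mat 1) c h) \<in> lmeasurable"
        using E(1) by (intro fmeasurable.Diff lmeasurable_open[OF V(2,1)] fmeasurableD fmeasurable.finite_UN)
          (auto simp: lmeasurable_cell split: prod.splits)
      then show ?thesis
        using E(4) dL by (simp add: eq measure_matrix_image field_simps)
    qed
    ultimately show ?thesis
      unfolding xch fst_conv by blast
  qed
  then obtain E where E: "\<And>t. t \<in> C \<Longrightarrow> finite (E t)"
    "\<And>t c h. t \<in> C \<Longrightarrow> (c, h) \<in> E t \<Longrightarrow> h > 0 \<and> cell (L (fst t)) c h \<subseteq> O1 t"
    "\<And>t c h c' h'. t \<in> C \<Longrightarrow> (c, h) \<in> E t \<Longrightarrow> (c', h') \<in> E t \<Longrightarrow> (c, h) \<noteq> (c', h') \<Longrightarrow>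
       open_cell (L (fst t)) c h \<inter> open_cell (L (fst t)) c' h' = {}"
    "\<And>t. t \<in> C \<Longrightarrow> measure lebesgue (O1 t - (\<Union>(c, h)\<in>E t. cell (L (fst t)) c h)) < \<kappa>"
    by metis
  \<comment> \<open>A cell inherits the tag of the cube that contains it. The tag fixes the shape,
    and it need not lie in the cell.\<close>
  define A where "A = (\<Union>t\<in>C. (\<lambda>(c, h). (fst t, c, h)) ` E t)"
  have A: "\<exists>t\<in>C. x = fst t \<and> (c, h) \<in> E t" if "(x, c, h) \<in> A" for x c h
    using that by (auto simp: A_def)
  show thesis
  proof (rule that[of A])
    show "finite A"
      using C(1) E(1) by (auto simp: A_def)
    show "x \<in> U \<and> h > 0 \<and> cell (L x) c h \<subseteq> ball x (r x) \<inter> U" if xch: "(x, c, h) \<in> A" for x c h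
    proof -
      obtain t where t: "t \<in> C" "x = fst t" "(c, h) \<in> E t"
        using A[OF xch] by blast
      obtain c1 h1 where t': "t = (x, c1, h1)"
        using t(2) by (cases t) auto
      have "O1 t \<subseteq> ball x (r x) \<inter> U"
        using C(2)[of x c1 h1] t(1) t' open_cell_subset by (fastforce simp: O1_def)
      moreover have "h > 0" "cell (L x) c h \<subseteq> O1 t"
        using E(2)[OF t(1,3)] by (auto simp: t(2)[symmetric])
      moreover have "x \<in> U"
        using C(2)[of x c1 h1] t(1) unfolding t' by blast
      ultimately show ?thesis
        by blast
    qed
    show "open_cell (L x) c h \<inter> open_cell (L x') c' h' = {}"
      if xch: "(x, c, h) \<in> A" "(x', c', h') \<in> A" "(x, c, h) \<noteq> (x', c', h')" for x c h x' c' h'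
    proof -
      obtain t where t: "t \<in> C" "x = fst t" "(c, h) \<in> E t"
        using A[OF xch(1)] by blast
      obtain t' where t': "t' \<in> C" "x' = fst t'" "(c', h') \<in> E t'"
        using A[OF xch(2)] by blast
      show ?thesis
      proof (cases "t = t'")
        case True
        then show ?thesis
          using E(3)[OF t(1,3), of c' h'] t'(2,3) t(2) xch(3) by metis
      next
        case False
        then have "O1 t \<inter> O1 t' = {}"
          using C(3) t(1) t'(1) by (cases t; cases t') (auto simp: O1_def)
        then show ?thesis
          using E(2)[OF t(1,3)] E(2)[OF t'(1,3)] unfolding t(2)[symmetric] t'(2)[symmetric] using
            open_cell_subset[of "L x" c h] open_cell_subset[of "L x'" c' h'] by blast
      qed
    qed
    let ?R = "U - (\<Union>(x, c, h)\<in>C. cell (mat 1) c h)"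
    let ?N = "\<Union>(x, c, h)\<in>C. cell (mat 1) c h - open_cell (mat 1) c h"
    let ?E = "\<lambda>t. O1 t - (\<Union>(c, h)\<in>E t. cell (L (fst t)) c h)"
    have N: "negligible ?N"
      using C(1) negligible_cell_diff by (intro negligible_Union) (auto split: prod.splits)
    have Rm: "?R \<in> lmeasurable"
      using C(1) by (intro fmeasurable.Diff lmeasurable_open[OF U(2,1)] fmeasurableD fmeasurable.finite_UN)
        (auto simp: lmeasurable_cell split: prod.splits)
    have Em: "?E t \<in> lmeasurable" if "t \<in> C" for t
    proof -
      obtain x c h where xch: "t = (x, c, h)"
        by (cases t)
      have "h > 0"
        using C(2) that xch by blast
      then have "open (O1 t)"
        by (simp add: O1_def xch open_open_cell)
      moreover have "bounded (O1 t)"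
        using bounded_subset[OF compact_imp_bounded[OF compact_cell] open_cell_subset] by (simp add: O1_def xch)
      ultimately have "O1 t \<in> lmeasurable"
        by (simp add: lmeasurable_open)
      then show ?thesis
        using E(1)[OF that] by (intro fmeasurable.Diff fmeasurableD fmeasurable.finite_UN)
          (auto simp: lmeasurable_cell split: prod.splits)
    qed
    have EUm: "(\<Union>t\<in>C. ?E t) \<in> lmeasurable"
      using C(1) Em by (intro fmeasurable.finite_UN) auto
    \<comment> \<open>A point that is missed lies outside all cubes, or in an open cube but outside
      its cells, or on the boundary of a cube; the last set is null.\<close>
    have sub: "U - (\<Union>(x, c, h)\<in>A. cell (L x) c h) \<subseteq> (?R \<union> (\<Union>t\<in>C. ?E t)) \<union> ?N"
    proof
      fix z assume z: "z \<in> U - (\<Union>(x, c, h)\<in>A. cell (L x) c h)"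
      show "z \<in> (?R \<union> (\<Union>t\<in>C. ?E t)) \<union> ?N"
      proof (rule ccontr)
        assume nz: "z \<notin> (?R \<union> (\<Union>t\<in>C. ?E t)) \<union> ?N"
        then obtain x c h where t: "(x, c, h) \<in> C" "z \<in> cell (mat 1) c h"
          using z by auto
        then have "z \<in> O1 (x, c, h)"
          using nz by (auto simp: O1_def)
        then have "z \<in> (\<Union>(c', h')\<in>E (x, c, h). cell (L x) c' h')"
          using nz t(1) by fastforce
        then show False
          using z t(1) by (fastforce simp: A_def)
      qed
    qed
    have "measure lebesgue (U - (\<Union>(x, c, h)\<in>A. cell (L x) c h)) \<le> measure lebesgue ((?R \<union> (\<Union>t\<in>C. ?E t)) \<union> ?N)"
    proof (rule measure_mono_fmeasurable[OF sub])
      show "U - (\<Union>(x, c, h)\<in>A. cell (L x) c h) \<in> sets lebesgue"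
        using \<open>finite A\<close> by (intro sets.Diff fmeasurableD fmeasurable.finite_UN fmeasurableD[OF lmeasurable_open[OF U(2,1)]])
          (auto simp: lmeasurable_cell split: prod.splits)
      show "(?R \<union> (\<Union>t\<in>C. ?E t)) \<union> ?N \<in> lmeasurable"
        by (intro fmeasurable.Un Rm EUm negligible_imp_measurable[OF N])
    qed
    also have "\<dots> \<le> measure lebesgue (?R \<union> (\<Union>t\<in>C. ?E t)) + measure lebesgue ?N"
      by (intro measure_Un_le fmeasurableD fmeasurable.Un Rm EUm negligible_imp_measurable[OF N])
    also have "measure lebesgue ?N = 0"
      using N by (rule negligible_imp_measure0)
    also have "measure lebesgue (?R \<union> (\<Union>t\<in>C. ?E t)) \<le> measure lebesgue ?R + measure lebesgue (\<Union>t\<in>C. ?E t)"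
      by (intro measure_Un_le fmeasurableD Rm EUm)
    also have "measure lebesgue (\<Union>t\<in>C. ?E t) \<le> (\<Sum>t\<in>C. measure lebesgue (?E t))"
      by (intro measure_UNION_le C(1) fmeasurableD Em)
    also have "\<dots> \<le> (\<Sum>t\<in>C. \<kappa>)"
      using E(4) by (intro sum_mono) (auto intro: less_imp_le)
    also have "\<dots> \<le> \<eta> / 2"
      using \<eta> by (simp add: \<kappa>_def field_simps)
    finally show "measure lebesgue (U - (\<Union>(x, c, h)\<in>A. cell (L x) c h)) < \<eta>"
      using C(4) by simp
  qed
qed

section \<open>Convex functions of class C2\<close>

text \<open>Gram-Schmidt for the inner product given by \<open>A\<close>: a vector outside the span
  of the previous ones is made orthogonal to them, and positive definiteness allows it to be
  normalized.\<close>

lemma symmetric_posdef_orthonormal_family: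
  fixes A :: "real^'n^'n"
  assumes sym: "\<And>v w. v \<bullet> (A *v w) = w \<bullet> (A *v v)" and pos: "\<And>v. v \<noteq> 0 \<Longrightarrow> 0 < v \<bullet> (A *v v)"
    and "finite F"
  shows "\<exists>f :: 'n \<Rightarrow> real^'n. \<forall>i\<in>F. \<forall>j\<in>F. f i \<bullet> (A *v f j) = (if i = j then 1 else 0)"
  using \<open>finite F\<close>
proof induction
  case (insert k F)
  then obtain f :: "'n \<Rightarrow> real^'n" where f: "\<And>i j. i \<in> F \<Longrightarrow> j \<in> F \<Longrightarrow> f i \<bullet> (A *v f j) = (if i = j then 1 else 0)"
    by blast
  have "card F < CARD('n)"
    using insert by (metis UNIV_I finite psubset_card_mono psubsetI subset_UNIV)
  have "dim (f ` F) \<le> card (f ` F)"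
    using insert by (intro dim_le_card') auto
  also have "\<dots> < DIM(real^'n)"
    using card_image_le[OF insert(1), of f] \<open>card F < CARD('n)\<close> by simp
  finally have "span (f ` F) \<noteq> UNIV"
    by (metis dim_UNIV dim_span less_irrefl)
  then obtain z where z: "z \<notin> span (f ` F)"
    by blast
  define z' where "z' = z - (\<Sum>j\<in>F. (z \<bullet> (A *v f j)) *\<^sub>R f j)"
  have "(\<Sum>j\<in>F. (z \<bullet> (A *v f j)) *\<^sub>R f j) \<in> span (f ` F)"
    by (intro span_sum span_scale span_base) auto
  then have "z' \<noteq> 0"
    using z unfolding z'_def by auto
  then have q: "z' \<bullet> (A *v z') > 0"
    by (rule pos)
  have orth: "z' \<bullet> (A *v f i) = 0" if "i \<in> F" for i
  proof -
    have "(\<Sum>j\<in>F. (z \<bullet> (A *v f j)) *\<^sub>R f j) \<bullet> (A *v f i) = (\<Sum>j\<in>F. if j = i then z \<bullet> (A *v f j) else 0)"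
      unfolding inner_sum_left using that by (intro sum.cong) (auto simp: f)
    then show ?thesis
      using that insert(1) by (simp add: z'_def inner_diff_left)
  qed
  define s where "s = sqrt (z' \<bullet> (A *v z'))"
  have s: "s > 0" "s * s = z' \<bullet> (A *v z')"
    using q by (auto simp: s_def)
  define g where "g = f(k := (1 / s) *\<^sub>R z')"
  have "g i \<bullet> (A *v g j) = (if i = j then 1 else 0)" if ij: "i \<in> insert k F" "j \<in> insert k F" for i j
  proof -
    consider "i = k" "j = k" | "i = k" "j \<in> F" "j \<noteq> k" | "j = k" "i \<in> F" "i \<noteq> k" | "i \<in> F" "j \<in> F" "i \<noteq> k" "j \<noteq> k"
      using ij by blast
    then show ?thesis
    proof cases
      case 1
      then show ?thesis
        using s by (simp add: g_def matrix_vector_mult_scaleR) (metis divide_divide_eq_left divide_self_if mult_eq_0_iff less_irrefl)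
    next
      case 2
      then show ?thesis
        by (simp add: g_def orth)
    next
      case 3
      then show ?thesis
        by (subst sym) (simp add: g_def orth)
    next
      case 4
      then show ?thesis
        by (simp add: g_def f)
    qed
  qed
  then show ?case by blast
qed simp

text \<open>The columns of \<open>L\<close> form an orthonormal basis for the inner product of
  \<open>A\<close>, that is, transpose(L) A L = 1. Both conclusions are read off from this
  identity.\<close>

lemma symmetric_posdef_diagonalize:
  fixes A :: "real^'n^'n"
  assumes sym: "\<And>v w. v \<bullet> (A *v w) = w \<bullet> (A *v v)" and pos: "\<And>v. v \<noteq> 0 \<Longrightarrow> 0 < v \<bullet> (A *v v)"
  obtains L :: "real^'n^'n" where "det A * (det L)\<^sup>2 = 1" "\<And>y. (L *v y) \<bullet> (A *v (L *v y)) = y \<bullet> y"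
proof -
  obtain f :: "'n \<Rightarrow> real^'n" where f: "\<And>i j. f i \<bullet> (A *v f j) = (if i = j then 1 else 0)"
    using symmetric_posdef_orthonormal_family[OF sym pos, of UNIV] by auto
  define L :: "real^'n^'n" where "L = (\<chi> k j. f j $ k)"
  have "(transpose L ** (A ** L)) $ i $ j = f i \<bullet> (A *v f j)" for i j
    by (simp add: matrix_matrix_mult_def transpose_def L_def inner_vec_def matrix_vector_mult_def)
  then have LAL: "transpose L ** (A ** L) = mat 1"
    by (simp add: vec_eq_iff f mat_def)
  have "det (transpose L ** (A ** L)) = 1"
    by (simp add: LAL)
  then have "det A * (det L)\<^sup>2 = 1"
    by (simp add: det_mul power2_eq_square mult_ac)
  moreover have "(L *v y) \<bullet> (A *v (L *v y)) = y \<bullet> y" for y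
  proof -
    have "y \<bullet> (transpose L *v z) = (L *v y) \<bullet> z" for z
      by (metis dot_lmul_matrix inner_commute transpose_matrix_vector)
    then have "(L *v y) \<bullet> (A *v (L *v y)) = y \<bullet> ((transpose L ** (A ** L)) *v y)"
      by (simp add: matrix_vector_mul_assoc[symmetric])
    then show ?thesis
      by (simp add: LAL)
  qed
  ultimately show thesis
    by (rule that)
qed

text \<open>Serves domains with empty interior, where no tangents come from a gradient and the class
  of minorants must still be shown nonempty. The epigraph is supported at \<open>(x0, u x0)\<close>
  with \<open>x0\<close> in the relative interior of \<open>D\<close>, which excludes a vertical
  hyperplane.\<close>

lemma affine_minorant_exists:
  fixes D :: "(real^'n) set"
  assumes "convex D" "convex_on D u"
  obtains a b where "\<And>x. x \<in> D \<Longrightarrow> a \<bullet> x + b \<le> u x"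
proof (cases "D = {}")
  case False
  define E where "E = {(x, t). x \<in> D \<and> u x \<le> t}"
  have convE: "convex E"
    using convex_epigraph[of D u] assms by (simp add: E_def epigraph_def case_prod_unfold)
  obtain x0 where x0: "x0 \<in> rel_interior D"
    using False assms(1) rel_interior_eq_empty by blast
  then have x0D: "x0 \<in> D"
    using rel_interior_subset by blast
  have in_E: "(x0, u x0) \<in> E"
    by (simp add: E_def x0D)
  have notin: "(x0, u x0) \<notin> rel_interior E"
  proof
    \<comment> \<open>Otherwise the segment from \<open>(x0, u x0 + 1)\<close> to
      \<open>(x0, u x0)\<close> could be prolonged inside the epigraph, to a point below the
      graph.\<close>
    assume "(x0, u x0) \<in> rel_interior E"
    moreover have "(x0, u x0 + 1) \<in> affine hull E"
      by (rule hull_inc) (simp add: E_def x0D)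
    ultimately obtain e where e: "e > 1" "(1 - e) *\<^sub>R (x0, u x0 + 1) + e *\<^sub>R (x0, u x0) \<in> E"
      using convex_rel_interior_if2[OF convE, of "(x0, u x0)"] by blast
    have "(1 - e) *\<^sub>R x0 + e *\<^sub>R x0 = x0"
      by (simp add: algebra_simps)
    then have "u x0 \<le> (1 - e) * (u x0 + 1) + e * u x0"
      using e(2) by (simp add: E_def)
    then show False
      using e(1) by (simp add: algebra_simps)
  qed
  obtain w where "w \<noteq> 0" and w: "\<And>y. y \<in> E \<Longrightarrow> w \<bullet> (x0, u x0) \<le> w \<bullet> y"
    "\<And>y. y \<in> rel_interior E \<Longrightarrow> w \<bullet> (x0, u x0) < w \<bullet> y"
    by (rule supporting_hyperplane_rel_boundary[OF convE in_E notin]) blast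
  obtain \<alpha> \<beta> where ab: "w = (\<alpha>, \<beta>)"
    by (cases w)
  have wE: "\<alpha> \<bullet> x0 + \<beta> * u x0 \<le> \<alpha> \<bullet> x + \<beta> * t" if "x \<in> D" "u x \<le> t" for x t
    using w(1)[of "(x, t)"] that by (simp add: ab E_def)
  have "\<beta> \<ge> 0"
    using wE[of x0 "u x0 + 1"] x0D by (simp add: algebra_simps)
  moreover have "\<beta> \<noteq> 0"
  proof
    \<comment> \<open>A vertical hyperplane would make \<open>\<alpha>\<close> minimal over
      \<open>D\<close> at \<open>x0\<close> and larger at some \<open>y\<close>; prolonging the
      segment from \<open>y\<close> beyond \<open>x0\<close> inside \<open>D\<close> goes below the
      minimum.\<close>
    assume b0: "\<beta> = 0"
    obtain y t where yt: "(y, t) \<in> rel_interior E"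
      using rel_interior_eq_empty[OF convE] in_E by (metis empty_iff ex_in_conv surj_pair)
    then have "y \<in> D"
      using rel_interior_subset by (fastforce simp: E_def)
    have lt: "\<alpha> \<bullet> x0 < \<alpha> \<bullet> y"
      using w(2)[OF yt] by (simp add: ab b0)
    obtain e where e: "e > 1" "(1 - e) *\<^sub>R y + e *\<^sub>R x0 \<in> D"
      using convex_rel_interior_if2[OF assms(1) x0] hull_inc[OF \<open>y \<in> D\<close>] by blast
    have "\<alpha> \<bullet> x0 \<le> \<alpha> \<bullet> ((1 - e) *\<^sub>R y + e *\<^sub>R x0)"
      using wE[OF e(2) order_refl] by (simp add: b0)
    then have "0 \<le> (1 - e) * (\<alpha> \<bullet> y - \<alpha> \<bullet> x0)"
      by (simp add: inner_add_right algebra_simps)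
    then show False
      using e(1) lt by (simp add: zero_le_mult_iff)
  qed
  ultimately have b: "\<beta> > 0" by simp
  show thesis
  proof (rule that)
    fix x assume "x \<in> D"
    then have "(\<alpha> \<bullet> x0 + \<beta> * u x0 - \<alpha> \<bullet> x) / \<beta> \<le> u x"
      using wE[of x "u x"] b by (simp add: divide_le_eq algebra_simps)
    then show "(- (1 / \<beta>) *\<^sub>R \<alpha>) \<bullet> x + (\<alpha> \<bullet> x0 + \<beta> * u x0) / \<beta> \<le> u x"
      by (simp add: diff_divide_distrib)
  qed
qed (use that in blast)

text \<open>The value infinity off the effective domain is encoded by restricting all conditions to
  \<open>D\<close> or its interior. Symmetry of the matrices \<open>H x\<close> is a consequence,
  shown in \<open>H_symmetric\<close>.\<close>

locale C2_convex =
  fixes D :: "(real^'n) set" and u :: "real^'n \<Rightarrow> real" and G :: "real^'n \<Rightarrow> real^'n"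
    and H :: "real^'n \<Rightarrow> real^'n^'n" and K :: real
  assumes convex_D: "convex D" and compact_D: "compact D" and convex_u: "convex_on D u"
    and lipschitz: "K-lipschitz_on (interior D) u"
    and gradient: "x \<in> interior D \<Longrightarrow> (u has_derivative (\<lambda>h. G x \<bullet> h)) (at x)"
    and hessian: "x \<in> interior D \<Longrightarrow> (G has_derivative (\<lambda>h. H x *v h)) (at x)"
    and continuous_H: "continuous_on (interior D) H"
    and H_pos: "x \<in> interior D \<Longrightarrow> v \<noteq> 0 \<Longrightarrow> 0 < v \<bullet> (H x *v v)"
begin

section \<open>Tangents, Taylor expansion and symmetry of the Hessian\<close>

abbreviation U where "U \<equiv> interior D"

lemma convex_U: "convex U"
  by (rule convex_interior[OF convex_D])

lemma bounded_U: "bounded U"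
  using compact_D compact_imp_bounded bounded_subset interior_subset by blast

lemma segment_in_U: "a \<in> U \<Longrightarrow> x \<in> U \<Longrightarrow> 0 \<le> t \<Longrightarrow> t \<le> 1 \<Longrightarrow> a + t *\<^sub>R (x - a) \<in> U"
  using convexD_alt[OF convex_U, of a x t] by (simp add: algebra_simps)

lemma deriv_u_line:
  assumes "a + t *\<^sub>R v \<in> U"
  shows "((\<lambda>t. u (a + t *\<^sub>R v)) has_real_derivative (G (a + t *\<^sub>R v) \<bullet> v)) (at t)"
proof -
  have "((\<lambda>t. a + t *\<^sub>R v) has_derivative (\<lambda>h. h *\<^sub>R v)) (at t)"
    by (auto intro!: derivative_eq_intros)
  from has_derivative_compose[OF this gradient[OF assms]]
  have "((\<lambda>t. u (a + t *\<^sub>R v)) has_derivative (\<lambda>h. G (a + t *\<^sub>R v) \<bullet> (h *\<^sub>R v))) (at t)" .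
  then show ?thesis
    by (simp add: has_field_derivative_def mult_commute_abs)
qed

lemma deriv_G_line:
  assumes "a + t *\<^sub>R v \<in> U"
  shows "((\<lambda>t. G (a + t *\<^sub>R v) \<bullet> w) has_real_derivative (w \<bullet> (H (a + t *\<^sub>R v) *v v))) (at t)"
proof -
  have "((\<lambda>t. a + t *\<^sub>R v) has_derivative (\<lambda>h. h *\<^sub>R v)) (at t)"
    by (auto intro!: derivative_eq_intros)
  from has_derivative_compose[OF this hessian[OF assms]]
  have "((\<lambda>t. G (a + t *\<^sub>R v)) has_derivative (\<lambda>h. H (a + t *\<^sub>R v) *v (h *\<^sub>R v))) (at t)" .
  then have "((\<lambda>t. G (a + t *\<^sub>R v) \<bullet> w) has_derivative (\<lambda>h. (H (a + t *\<^sub>R v) *v (h *\<^sub>R v)) \<bullet> w)) (at t)"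
    by (rule has_derivative_inner_left)
  moreover have "(\<lambda>h. (H (a + t *\<^sub>R v) *v (h *\<^sub>R v)) \<bullet> w) = (*) (w \<bullet> (H (a + t *\<^sub>R v) *v v))"
    by (auto simp: matrix_vector_mult_scaleR inner_commute)
  ultimately show ?thesis
    by (simp add: has_field_derivative_def)
qed

text \<open>Convexity bounds the difference quotients on the segment by \<open>u x - u a\<close>;
  their right limit at 0 is the derivative. Only differentiability at \<open>a\<close> enters, so
  \<open>x\<close> may lie on the boundary of \<open>D\<close>.\<close>

lemma tangent_le:
  assumes a: "a \<in> U" and x: "x \<in> D"
  shows "u a + G a \<bullet> (x - a) \<le> u x"
proof -
  have "((\<lambda>t. u (a + t *\<^sub>R (x - a))) has_real_derivative (G a \<bullet> (x - a))) (at 0)"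
    using deriv_u_line[of a 0 "x - a"] a by simp
  then have "((\<lambda>h. (u (a + h *\<^sub>R (x - a)) - u a) / h) \<longlongrightarrow> G a \<bullet> (x - a)) (at 0)"
    by (simp add: DERIV_def)
  then have lim: "((\<lambda>h. (u (a + h *\<^sub>R (x - a)) - u a) / h) \<longlongrightarrow> G a \<bullet> (x - a)) (at_right 0)"
    by (rule filterlim_mono) (auto simp: at_le)
  have "\<forall>\<^sub>F h in at_right 0. (u (a + h *\<^sub>R (x - a)) - u a) / h \<le> u x - u a"
  proof (rule eventually_at_rightI[of 0 1])
    fix h :: real assume h: "h \<in> {0<..<1}"
    have "a \<in> D"
      using a interior_subset by blast
    then have "u ((1 - h) *\<^sub>R a + h *\<^sub>R x) \<le> (1 - h) * u a + h * u x"
      using convex_onD[OF convex_u, of h a x] x h by auto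
    then show "(u (a + h *\<^sub>R (x - a)) - u a) / h \<le> u x - u a"
      using h by (simp add: field_simps algebra_simps)
  qed simp
  from tendsto_upperbound[OF lim this] show ?thesis by simp
qed

text \<open>Along a step \<open>t *\<^sub>R G x\<close> the function grows by at least t |G x|^2 by
  the tangent inequality, and by at most K t |G x| by the Lipschitz condition.\<close>

lemma norm_G_le:
  assumes x: "x \<in> U"
  shows "norm (G x) \<le> K"
proof (cases "G x = 0")
  case True
  then show ?thesis
    using lipschitz lipschitz_on_nonneg by auto
next
  case False
  obtain e where e: "e > 0" "ball x e \<subseteq> U"
    using x open_contains_ball by blast
  define t where "t = e / (2 * norm (G x))"
  have t: "t > 0"
    using e False by (simp add: t_def)
  have y: "x + t *\<^sub>R G x \<in> U"
    using e False by (intro subsetD[OF e(2)]) (auto simp: dist_norm t_def)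
  have "u x + G x \<bullet> (t *\<^sub>R G x) \<le> u (x + t *\<^sub>R G x)"
    using tangent_le[OF x, of "x + t *\<^sub>R G x"] y interior_subset by auto
  moreover have "dist (u (x + t *\<^sub>R G x)) (u x) \<le> K * dist (x + t *\<^sub>R G x) x"
    by (rule lipschitz_onD[OF lipschitz y x])
  moreover have "G x \<bullet> (t *\<^sub>R G x) = t * (norm (G x) * norm (G x))"
    by (simp add: dot_square_norm power2_eq_square)
  moreover have "dist (x + t *\<^sub>R G x) x = t * norm (G x)"
    using t by (simp add: dist_norm)
  ultimately have "t * (norm (G x) * norm (G x)) \<le> K * (t * norm (G x))"
    unfolding dist_real_def by (smt (verit))
  then show ?thesis
    using t False by (simp add: mult.left_commute)
qed

lemma taylor:
  assumes "a \<in> U" "x \<in> U"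
  obtains t where "0 < t" "t < 1"
    "u x = u a + G a \<bullet> (x - a) + (1/2) * ((x - a) \<bullet> (H (a + t *\<^sub>R (x - a)) *v (x - a)))"
proof -
  define \<phi> where "\<phi> = (\<lambda>k::nat. if k = 0 then (\<lambda>t. u (a + t *\<^sub>R (x - a))) else if k = 1 then (\<lambda>t. G (a + t *\<^sub>R (x - a)) \<bullet> (x - a))
     else (\<lambda>t. (x - a) \<bullet> (H (a + t *\<^sub>R (x - a)) *v (x - a))))"
  have "\<exists>t>0. t < 1 \<and> u (a + 1 *\<^sub>R (x - a)) = (\<Sum>m<2. \<phi> m 0 / fact m * 1 ^ m) + \<phi> 2 t / fact 2 * 1 ^ 2"
  proof (rule Maclaurin)
    show "\<forall>m t. m < 2 \<and> 0 \<le> t \<and> t \<le> 1 \<longrightarrow> (\<phi> m has_real_derivative \<phi> (Suc m) t) (at t)"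
    proof (intro allI impI)
      fix m :: nat and t :: real assume m: "m < 2 \<and> 0 \<le> t \<and> t \<le> 1"
      then have "a + t *\<^sub>R (x - a) \<in> U"
        using assms by (intro segment_in_U) auto
      note deriv_u_line[OF this] deriv_G_line[OF this, of "x - a"]
      moreover have "m = 0 \<or> m = 1"
        using m by linarith
      ultimately show "(\<phi> m has_real_derivative \<phi> (Suc m) t) (at t)"
        by (auto simp: \<phi>_def)
    qed
  qed (auto simp: \<phi>_def)
  then show thesis
    by (auto simp: \<phi>_def numeral_2_eq_2 intro!: that)
qed

text \<open>If \<open>G x = G y\<close>, the strictly positive Taylor remainder at \<open>y\<close>
  puts \<open>u x\<close> above the tangent at \<open>y\<close>, while the tangent at
  \<open>x\<close>, which has the same slope, forces the opposite inequality.\<close>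

lemma inj_on_G: "inj_on G U"
proof (rule inj_onI, rule ccontr)
  fix x y assume x: "x \<in> U" and y: "y \<in> U" and eq: "G x = G y" and ne: "x \<noteq> y"
  obtain t where t: "0 < t" "t < 1"
    "u x = u y + G y \<bullet> (x - y) + (1/2) * ((x - y) \<bullet> (H (y + t *\<^sub>R (x - y)) *v (x - y)))"
    using taylor[OF y x] by blast
  have "0 < (x - y) \<bullet> (H (y + t *\<^sub>R (x - y)) *v (x - y))"
    using t ne x y by (intro H_pos segment_in_U) auto
  moreover have "u x + G x \<bullet> (y - x) \<le> u y"
    using x y interior_subset by (intro tangent_le) auto
  ultimately show False
    using t(3) by (simp add: eq inner_diff_right)
qed

text \<open>The mean value theorem in direction \<open>v\<close> turns the second difference into a
  difference of two gradients, and both are expanded at the single point \<open>x\<close> by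
  differentiability of \<open>G\<close>. It prepares the symmetry of the Hessian.\<close>

lemma second_difference:
  assumes x: "x \<in> U" and "\<epsilon> > 0"
  shows "\<forall>\<^sub>F h in at_right 0. \<bar>(u (x + h *\<^sub>R v + h *\<^sub>R w) - u (x + h *\<^sub>R w)) - (u (x + h *\<^sub>R v) - u x) - h\<^sup>2 * (v \<bullet> (H x *v w))\<bar>
     \<le> h\<^sup>2 * (\<epsilon> * (2 * norm v + norm w) * norm v)"
proof -
  obtain d1 where d1: "d1 > 0" "\<And>y. norm (y - x) < d1 \<Longrightarrow> norm (G y - G x - H x *v (y - x)) \<le> \<epsilon> * norm (y - x)"
    using hessian[OF x] \<open>\<epsilon> > 0\<close> unfolding has_derivative_at_alt by blast
  obtain d2 where d2: "d2 > 0" "ball x d2 \<subseteq> U"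
    using x open_contains_ball by blast
  define B where "B = norm v + norm w + 1"
  have B: "B > 0"
    by (simp add: B_def add_nonneg_pos)
  define d where "d = min d1 d2 / B"
  have d: "d > 0"
    using d1 d2 B by (simp add: d_def)
  show ?thesis
  proof (rule eventually_at_rightI[of 0 d])
    fix h assume h: "h \<in> {0<..<d}"
    have hB: "h * B < d1" "h * B < d2"
      using h B unfolding d_def by (auto simp: field_simps)
    have small: "norm (s *\<^sub>R v + r *\<^sub>R w) \<le> h * (norm v + norm w)" "norm (s *\<^sub>R v + r *\<^sub>R w) < d1" "norm (s *\<^sub>R v + r *\<^sub>R w) < d2"
      if "0 \<le> s" "s \<le> h" "0 \<le> r" "r \<le> h" for s r
    proof -
      have "norm (s *\<^sub>R v + r *\<^sub>R w) \<le> s * norm v + r * norm w"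
        using norm_triangle_ineq[of "s *\<^sub>R v" "r *\<^sub>R w"] that by simp
      also have "\<dots> \<le> h * norm v + h * norm w"
        using that by (intro add_mono mult_right_mono) auto
      finally show 1: "norm (s *\<^sub>R v + r *\<^sub>R w) \<le> h * (norm v + norm w)"
        by (simp add: algebra_simps)
      have "h * (norm v + norm w) \<le> h * B"
        using h by (simp add: B_def)
      then show "norm (s *\<^sub>R v + r *\<^sub>R w) < d1" "norm (s *\<^sub>R v + r *\<^sub>R w) < d2"
        using 1 hB by linarith+
    qed
    have inU: "x + s *\<^sub>R v + r *\<^sub>R w \<in> U" if "0 \<le> s" "s \<le> h" "0 \<le> r" "r \<le> h" for s r
    proof -
      have "dist x (x + s *\<^sub>R v + r *\<^sub>R w) = norm (s *\<^sub>R v + r *\<^sub>R w)"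
        by (metis add.assoc add_diff_cancel_left' dist_commute dist_norm)
      then show ?thesis
        using small(3)[OF that] d2(2) by auto
    qed
    define \<psi> where "\<psi> = (\<lambda>s. u (x + h *\<^sub>R w + s *\<^sub>R v) - u (x + s *\<^sub>R v))"
    have "\<exists>\<xi>. 0 < \<xi> \<and> \<xi> < h \<and> \<psi> h - \<psi> 0 = (h - 0) * (G (x + h *\<^sub>R w + \<xi> *\<^sub>R v) \<bullet> v - G (x + \<xi> *\<^sub>R v) \<bullet> v)"
    proof (rule MVT2)
      fix s assume s: "0 \<le> s" "s \<le> h"
      show "(\<psi> has_real_derivative (G (x + h *\<^sub>R w + s *\<^sub>R v) \<bullet> v - G (x + s *\<^sub>R v) \<bullet> v)) (at s)"
        unfolding \<psi>_def using s h inU[of s h] inU[of s 0]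
        by (intro DERIV_diff deriv_u_line) (auto simp: algebra_simps)
    qed (use h in auto)
    then obtain \<xi> where \<xi>: "0 < \<xi>" "\<xi> < h" "\<psi> h - \<psi> 0 = h * ((G (x + h *\<^sub>R w + \<xi> *\<^sub>R v) - G (x + \<xi> *\<^sub>R v)) \<bullet> v)"
      by (auto simp: inner_diff_left)
    define e1 where "e1 = G (x + h *\<^sub>R w + \<xi> *\<^sub>R v) - G x - H x *v (h *\<^sub>R w + \<xi> *\<^sub>R v)"
    define e2 where "e2 = G (x + \<xi> *\<^sub>R v) - G x - H x *v (\<xi> *\<^sub>R v)"
    have "norm e1 \<le> \<epsilon> * norm (h *\<^sub>R w + \<xi> *\<^sub>R v)"
      using d1(2)[of "x + h *\<^sub>R w + \<xi> *\<^sub>R v"] small(2)[of \<xi> h] \<xi> h by (simp add: e1_def add.commute add.left_commute)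
    also have "\<dots> \<le> \<epsilon> * (h * (norm v + norm w))"
      using small(1)[of \<xi> h] \<xi> h \<open>\<epsilon> > 0\<close> by (intro mult_left_mono) (auto simp: add.commute)
    finally have e1: "norm e1 \<le> \<epsilon> * (h * (norm v + norm w))" .
    have "norm e2 \<le> \<epsilon> * norm (\<xi> *\<^sub>R v)"
      using d1(2)[of "x + \<xi> *\<^sub>R v"] small(2)[of \<xi> 0] \<xi> h by (simp add: e2_def)
    also have "\<dots> \<le> \<epsilon> * (h * norm v)"
      using \<xi> \<open>\<epsilon> > 0\<close> by (intro mult_left_mono) (auto intro: mult_right_mono)
    finally have e2: "norm e2 \<le> \<epsilon> * (h * norm v)" .
    have eq: "G (x + h *\<^sub>R w + \<xi> *\<^sub>R v) - G (x + \<xi> *\<^sub>R v) = e1 - e2 + h *\<^sub>R (H x *v w)"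
      by (simp add: e1_def e2_def matrix_vector_right_distrib matrix_vector_mult_scaleR)
    have "\<psi> h - \<psi> 0 - h\<^sup>2 * (v \<bullet> (H x *v w)) = h * ((e1 - e2) \<bullet> v)"
      unfolding \<xi>(3) eq by (simp add: inner_add_left inner_commute power2_eq_square algebra_simps)
    also have "\<bar>\<dots>\<bar> \<le> h * (norm (e1 - e2) * norm v)"
      using h Cauchy_Schwarz_ineq2[of "e1 - e2" v] by (simp add: abs_mult)
    also have "\<dots> \<le> h * ((\<epsilon> * (h * (norm v + norm w)) + \<epsilon> * (h * norm v)) * norm v)"
      using h e1 e2 norm_triangle_ineq4[of e1 e2] by (intro mult_left_mono mult_right_mono) auto
    also have "\<dots> = h\<^sup>2 * (\<epsilon> * (2 * norm v + norm w) * norm v)"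
      by (simp add: power2_eq_square algebra_simps)
    finally show "\<bar>(u (x + h *\<^sub>R v + h *\<^sub>R w) - u (x + h *\<^sub>R w)) - (u (x + h *\<^sub>R v) - u x) - h\<^sup>2 * (v \<bullet> (H x *v w))\<bar>
       \<le> h\<^sup>2 * (\<epsilon> * (2 * norm v + norm w) * norm v)"
      by (simp add: \<psi>_def add.commute add.left_commute algebra_simps)
  qed (use d in simp)
qed

text \<open>The second difference is unchanged when \<open>v\<close> and \<open>w\<close> are
  exchanged, and divided by h^2 it approximates both sides.\<close>

lemma H_symmetric:
  assumes x: "x \<in> U"
  shows "v \<bullet> (H x *v w) = w \<bullet> (H x *v v)"
proof (rule ccontr)
  assume ne: "v \<bullet> (H x *v w) \<noteq> w \<bullet> (H x *v v)"
  define c where "c = (2 * norm v + norm w) * norm v + (2 * norm w + norm v) * norm w + 1"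
  have c: "c > 0"
    unfolding c_def by (intro add_nonneg_pos add_nonneg_nonneg mult_nonneg_nonneg) auto
  \<comment> \<open>Here \<open>\<epsilon> * c\<close> is half the supposed gap, while the two error
    terms together are at most \<open>h\<^sup>2 * (\<epsilon> * c)\<close>.\<close>
  define \<epsilon> where "\<epsilon> = \<bar>v \<bullet> (H x *v w) - w \<bullet> (H x *v v)\<bar> / (2 * c)"
  have \<epsilon>: "\<epsilon> > 0"
    using ne c by (simp add: \<epsilon>_def)
  have "\<forall>\<^sub>F h in at_right (0::real). h > 0"
    by (simp add: eventually_at_right_less)
  with second_difference[OF x \<epsilon>, of v w] second_difference[OF x \<epsilon>, of w v]
  have "\<forall>\<^sub>F h in at_right (0::real). \<bar>v \<bullet> (H x *v w) - w \<bullet> (H x *v v)\<bar> \<le> \<epsilon> * c"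
  proof eventually_elim
    case (elim h)
    define a where "a = (u (x + h *\<^sub>R v + h *\<^sub>R w) - u (x + h *\<^sub>R w)) - (u (x + h *\<^sub>R v) - u x)"
    have 1: "\<bar>a - h\<^sup>2 * (v \<bullet> (H x *v w))\<bar> \<le> h\<^sup>2 * (\<epsilon> * (2 * norm v + norm w) * norm v)"
      using elim(1) by (simp add: a_def)
    have 2: "\<bar>a - h\<^sup>2 * (w \<bullet> (H x *v v))\<bar> \<le> h\<^sup>2 * (\<epsilon> * (2 * norm w + norm v) * norm w)"
      using elim(2) by (simp add: a_def add.commute add.left_commute algebra_simps)
    have "h\<^sup>2 * \<bar>v \<bullet> (H x *v w) - w \<bullet> (H x *v v)\<bar> = \<bar>h\<^sup>2 * (v \<bullet> (H x *v w)) - h\<^sup>2 * (w \<bullet> (H x *v v))\<bar>"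
      by (simp add: abs_mult flip: right_diff_distrib)
    also have "\<dots> \<le> h\<^sup>2 * (\<epsilon> * (2 * norm v + norm w) * norm v) + h\<^sup>2 * (\<epsilon> * (2 * norm w + norm v) * norm w)"
      using 1 2 by linarith
    also have "\<dots> \<le> h\<^sup>2 * (\<epsilon> * c)"
      using \<epsilon> by (simp add: c_def algebra_simps)
    finally show ?case
      using elim(3) by simp
  qed
  then have "\<bar>v \<bullet> (H x *v w) - w \<bullet> (H x *v v)\<bar> \<le> \<epsilon> * c"
    by simp
  then show False
    using c ne by (simp add: \<epsilon>_def)
qed

end

text \<open>Expands |a - b|^2 >= 0. With \<open>a\<close> a difference of gradients and
  \<open>b\<close> the difference of their base points, it bounds the error of a tangent by the
  distance of the values of x + G x.\<close>

lemma inner_le_norm_add: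
  fixes a b :: "'a::real_inner"
  shows "a \<bullet> b \<le> (1/4) * (norm (a + b))\<^sup>2"
proof -
  have "0 \<le> (a - b) \<bullet> (a - b)"
    by simp
  then show ?thesis
    by (simp add: power2_norm_eq_inner inner_add_left inner_add_right inner_diff_left inner_diff_right inner_commute)
qed

section \<open>Maxima of affine functions\<close>

lemma affmax_insert:
  assumes "finite S" "S \<noteq> {}"
  shows "affmax (insert (a, b) S) x = max (a \<bullet> x + b) (affmax S x)"
  using assms by (simp add: affmax_def)

lemma continuous_on_affmax:
  assumes "finite S" "S \<noteq> {}"
  shows "continuous_on X (affmax S)"
  using assms
proof (induction S rule: finite_ne_induct)
  case (singleton s)
  have "affmax {s} = (\<lambda>x. fst s \<bullet> x + snd s)"
    by (auto simp: affmax_def case_prod_unfold)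
  then show ?case
    by (auto intro!: continuous_intros)
next
  case (insert s S)
  have "affmax (insert s S) = (\<lambda>x. max (fst s \<bullet> x + snd s) (affmax S x))"
    using affmax_insert[OF insert(1,2), of "fst s" "snd s"] by auto
  then show ?case
    using insert by (auto intro!: continuous_intros)
qed

lemma affmax_ge:
  assumes "finite S" "(a, b) \<in> S"
  shows "a \<bullet> x + b \<le> affmax S x"
  unfolding affmax_def using assms by (intro Max_ge) force+

lemma affmax_attained:
  assumes "finite S" "S \<noteq> {}"
  obtains a b where "(a, b) \<in> S" "affmax S x = a \<bullet> x + b"
proof -
  have "affmax S x \<in> (\<lambda>(a, b). a \<bullet> x + b) ` S"
    unfolding affmax_def using assms by (intro Max_in) auto
  then show thesis
    using that by auto
qed

lemma integrable_continuous_bounded: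
  fixes f :: "'a::euclidean_space \<Rightarrow> real"
  assumes "S \<in> lmeasurable" "continuous_on S f" "\<And>x. x \<in> S \<Longrightarrow> \<bar>f x\<bar> \<le> B"
  shows "f integrable_on S"
proof (rule measurable_bounded_by_integrable_imp_integrable)
  show "f \<in> borel_measurable (lebesgue_on S)"
    using assms by (intro continuous_imp_measurable_on_sets_lebesgue) (auto intro: fmeasurableD)
  show "(\<lambda>_. B) integrable_on S"
    by (rule integrable_on_const[OF assms(1)])
qed (use assms in \<open>auto intro: fmeasurableD\<close>)

context C2_convex
begin

section \<open>Passage to the interior, and integrability of the errors\<close>

lemma U_lmeasurable: "U \<in> lmeasurable"
  by (simp add: lmeasurable_open bounded_U)

lemma negligible_D_minus_U: "negligible (D - U)"
proof (rule negligible_subset[OF negligible_convex_frontier[OF convex_D]])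
  show "D - U \<subseteq> frontier D"
    using closure_subset by (auto simp: frontier_def)
qed

lemma integral_D: "integral D f = integral U (f :: real^'n \<Rightarrow> real)"
proof (rule integral_spike_set)
  show "negligible {x \<in> D - U. f x \<noteq> 0}"
    by (rule negligible_subset[OF negligible_D_minus_U]) auto
  have "{x \<in> U - D. f x \<noteq> 0} = {}"
    using interior_subset[of D] by auto
  then show "negligible {x \<in> U - D. f x \<noteq> 0}"
    by (simp only: negligible_empty)
qed

lemma integrable_on_D: "f integrable_on D \<longleftrightarrow> (f :: real^'n \<Rightarrow> real) integrable_on U"
proof (rule integrable_spike_set_eq)
  have "(D - U) \<union> (U - D) = D - U"
    using interior_subset[of D] by auto
  then show "negligible ((D - U) \<union> (U - D))"
    using negligible_D_minus_U by simp
qed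

lemma continuous_on_u: "continuous_on U u"
  using lipschitz by (rule lipschitz_on_continuous_on)

lemma error_continuous:
  assumes "p > 0" "finite S" "S \<noteq> {}" "\<And>x. x \<in> U \<Longrightarrow> affmax S x \<le> u x"
  shows "continuous_on U (\<lambda>x. (u x - affmax S x) powr p)"
  using assms by (intro continuous_on_powr' continuous_intros continuous_on_u continuous_on_affmax) auto

lemma error_bounded:
  assumes "p > 0" "finite S" "S \<noteq> {}" "\<And>x. x \<in> U \<Longrightarrow> affmax S x \<le> u x"
  obtains B where "\<And>x. x \<in> U \<Longrightarrow> \<bar>(u x - affmax S x) powr p\<bar> \<le> B"
proof -
  obtain a b where ab: "(a, b) \<in> S"
    using assms(3) by auto
  obtain R where R: "\<And>x. x \<in> U \<Longrightarrow> norm x \<le> R"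
    using bounded_U bounded_iff by blast
  have "bounded (u ` U)"
    by (rule bounded_uniformly_continuous_image[OF _ bounded_U])
       (rule lipschitz_on_uniformly_continuous[OF lipschitz])
  then obtain M where M: "\<And>x. x \<in> U \<Longrightarrow> \<bar>u x\<bar> \<le> M"
    unfolding bounded_iff by (metis imageI real_norm_def)
  show thesis
  proof (rule that)
    fix x assume x: "x \<in> U"
    have "\<bar>a \<bullet> x\<bar> \<le> norm a * R"
      using Cauchy_Schwarz_ineq2[of a x] R[OF x] mult_left_mono[OF R[OF x] norm_ge_zero[of a]] by linarith
    then have "u x - affmax S x \<le> M + norm a * R + \<bar>b\<bar>"
      using M[OF x] affmax_ge[OF assms(2) ab, of x] by linarith
    then show "\<bar>(u x - affmax S x) powr p\<bar> \<le> (M + norm a * R + \<bar>b\<bar>) powr p"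
      using assms(1,4) x by (auto intro!: powr_mono2)
  qed
qed

lemma error_integrable:
  assumes "p > 0" "finite S" "S \<noteq> {}" "\<And>x. x \<in> U \<Longrightarrow> affmax S x \<le> u x" "X \<subseteq> U" "X \<in> lmeasurable"
  shows "(\<lambda>x. (u x - affmax S x) powr p) integrable_on X"
proof -
  obtain B where "\<And>x. x \<in> U \<Longrightarrow> \<bar>(u x - affmax S x) powr p\<bar> \<le> B"
    using error_bounded[OF assms(1-4)] by blast
  then show ?thesis
    using assms continuous_on_subset[OF error_continuous[OF assms(1-4)] assms(5)]
    by (intro integrable_continuous_bounded[of _ _ B]) auto
qed

text \<open>Coordinates in which the form of \<open>H x\<close> is the squared Euclidean norm. They
  are determined only up to an orthogonal map, so the choice need not be continuous in
  \<open>x\<close>; the covering therefore fixes one shape per cube.\<close>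

definition shape :: "real^'n \<Rightarrow> real^'n^'n" where
  "shape x = (SOME L. det (H x) * (det L)\<^sup>2 = 1 \<and> (\<forall>y. (L *v y) \<bullet> (H x *v (L *v y)) = y \<bullet> y))"

lemma shape:
  assumes "x \<in> U"
  shows "det (H x) * (det (shape x))\<^sup>2 = 1" "(shape x *v y) \<bullet> (H x *v (shape x *v y)) = y \<bullet> y"
proof -
  have "\<exists>L. det (H x) * (det L)\<^sup>2 = 1 \<and> (\<forall>y. (L *v y) \<bullet> (H x *v (L *v y)) = y \<bullet> y)"
    using symmetric_posdef_diagonalize[OF H_symmetric[OF assms] H_pos[OF assms]] by metis
  from someI_ex[OF this]
  show "det (H x) * (det (shape x))\<^sup>2 = 1" "(shape x *v y) \<bullet> (H x *v (shape x *v y)) = y \<bullet> y"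
    unfolding shape_def by auto
qed

lemma det_shape_nonzero: "x \<in> U \<Longrightarrow> det (shape x) \<noteq> 0"
  using shape(1) by fastforce

lemma det_H_pos: "x \<in> U \<Longrightarrow> det (H x) > 0"
  using shape(1)[of x] by (smt (verit) mult_nonpos_nonneg zero_le_power2)

lemma isCont_H: "x \<in> U \<Longrightarrow> isCont H x"
  using continuous_H continuous_on_eq_continuous_at open_interior by blast

lemma tendsto_det_H: "x \<in> U \<Longrightarrow> ((\<lambda>y. det (H y)) \<longlongrightarrow> det (H x)) (at x)"
  unfolding det_def using isCont_H[of x, unfolded isCont_def] by (intro tendsto_intros) auto

lemma continuous_on_det_H: "continuous_on U (\<lambda>y. det (H y) powr s)"
proof (intro continuous_on_powr continuous_on_const)
  show "continuous_on U (\<lambda>y. det (H y))"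
    using tendsto_det_H by (simp add: continuous_on_eq_continuous_at isCont_def)
qed (use det_H_pos in force)

text \<open>Continuity of \<open>H\<close> gives entrywise closeness, whereas the cells call for a
  bound relative to the form of \<open>H x\<close>. The two are linked by the bound
  \<open>vv\<close> of the Euclidean norm by that form.\<close>

lemma hessian_gauge:
  assumes x: "x \<in> U" and "\<epsilon> > 0"
  obtains r where "r > 0" "ball x r \<subseteq> U"
    "\<And>y v. y \<in> ball x r \<Longrightarrow> (1 - \<epsilon>) * (v \<bullet> (H x *v v)) \<le> v \<bullet> (H y *v v)"
    "\<And>y v. y \<in> ball x r \<Longrightarrow> v \<bullet> (H y *v v) \<le> (1 + \<epsilon>) * (v \<bullet> (H x *v v))"
    "\<And>y. y \<in> ball x r \<Longrightarrow> \<bar>det (H y) powr s - det (H x) powr s\<bar> \<le> \<epsilon>"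
proof -
  obtain B where B: "B > 0" "\<And>w. norm (shape x *v w) \<le> norm w * B"
    using bounded_linear.pos_bounded[OF matrix_vector_mul_bounded_linear[of "shape x"]] by blast
  have vv: "v \<bullet> v \<le> B\<^sup>2 * (v \<bullet> (H x *v v))" for v
  proof -
    have "inj ((*v) (shape x))"
      using det_shape_nonzero[OF x] by (metis det_nz_iff_inj matrix_of_matrix_vector_mul matrix_vector_mul_linear)
    then have "surj ((*v) (shape x))"
      by (intro linear_injective_imp_surjective) auto
    then obtain w where w: "v = shape x *v w"
      by (metis surjD)
    have "v \<bullet> v = (norm (shape x *v w))\<^sup>2"
      by (simp add: w dot_square_norm)
    also have "\<dots> \<le> (norm w * B)\<^sup>2"
      using B(2) by (intro power_mono) auto
    also have "\<dots> = B\<^sup>2 * (v \<bullet> (H x *v v))"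
      by (simp add: w shape(2)[OF x] dot_square_norm power_mult_distrib)
    finally show ?thesis .
  qed
  have "((\<lambda>y. \<Sum>i\<in>UNIV. \<Sum>j\<in>UNIV. \<bar>(H y - H x) $ i $ j\<bar>) \<longlongrightarrow> (\<Sum>i\<in>UNIV. \<Sum>j\<in>UNIV. \<bar>(H x - H x) $ i $ j\<bar>)) (at x)"
    using isCont_H[OF x, unfolded isCont_def] by (intro tendsto_intros) auto
  then have "((\<lambda>y. \<Sum>i\<in>UNIV. \<Sum>j\<in>UNIV. \<bar>(H y - H x) $ i $ j\<bar>) \<longlongrightarrow> 0) (at x)"
    by simp
  then have 1: "\<forall>\<^sub>F y in at x. (\<Sum>i\<in>UNIV. \<Sum>j\<in>UNIV. \<bar>(H y - H x) $ i $ j\<bar>) < \<epsilon> / B\<^sup>2"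
    using B(1) \<open>\<epsilon> > 0\<close> by (intro order_tendstoD) auto
  have "((\<lambda>y. det (H y) powr s) \<longlongrightarrow> det (H x) powr s) (at x)"
    using det_H_pos[OF x] by (intro tendsto_powr tendsto_det_H x tendsto_const) auto
  then have 2: "\<forall>\<^sub>F y in at x. dist (det (H y) powr s) (det (H x) powr s) < \<epsilon>"
    using \<open>\<epsilon> > 0\<close> by (rule tendstoD)
  obtain r1 where r1: "r1 > 0" "\<And>y. y \<noteq> x \<Longrightarrow> dist y x < r1 \<Longrightarrow>
      (\<Sum>i\<in>UNIV. \<Sum>j\<in>UNIV. \<bar>(H y - H x) $ i $ j\<bar>) < \<epsilon> / B\<^sup>2 \<and> dist (det (H y) powr s) (det (H x) powr s) < \<epsilon>"
    using eventually_conj[OF 1 2] unfolding eventually_at by auto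
  obtain r2 where r2: "r2 > 0" "ball x r2 \<subseteq> U"
    using x open_contains_ball by blast
  define r where "r = min r1 r2"
  have close: "(\<Sum>i\<in>UNIV. \<Sum>j\<in>UNIV. \<bar>(H y - H x) $ i $ j\<bar>) \<le> \<epsilon> / B\<^sup>2 \<and> \<bar>det (H y) powr s - det (H x) powr s\<bar> \<le> \<epsilon>"
    if "y \<in> ball x r" for y
    using r1(2)[of y] that \<open>\<epsilon> > 0\<close> B(1) by (cases "y = x") (auto simp: r_def dist_commute dist_real_def)
  have diff: "\<bar>v \<bullet> (H y *v v) - v \<bullet> (H x *v v)\<bar> \<le> \<epsilon> * (v \<bullet> (H x *v v))" if y: "y \<in> ball x r" for y v
  proof -
    have "v \<bullet> (H y *v v) - v \<bullet> (H x *v v) = v \<bullet> ((H y - H x) *v v)"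
      by (simp add: matrix_vector_mult_diff_rdistrib inner_diff_right)
    also have "\<bar>\<dots>\<bar> \<le> norm v * norm ((H y - H x) *v v)"
      by (rule Cauchy_Schwarz_ineq2)
    also have "\<dots> \<le> norm v * (onorm ((*v) (H y - H x)) * norm v)"
      by (intro mult_left_mono onorm matrix_vector_mul_bounded_linear) auto
    also have "\<dots> \<le> norm v * (\<epsilon> / B\<^sup>2 * norm v)"
      using order_trans[OF onorm_le_matrix_component_sum, of "H y - H x"] close[OF y]
      by (intro mult_left_mono mult_right_mono) auto
    also have "\<dots> = \<epsilon> / B\<^sup>2 * (v \<bullet> v)"
      by (simp add: dot_square_norm power2_eq_square)
    also have "\<dots> \<le> \<epsilon> / B\<^sup>2 * (B\<^sup>2 * (v \<bullet> (H x *v v)))"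
      using vv \<open>\<epsilon> > 0\<close> by (intro mult_left_mono) auto
    also have "\<dots> = \<epsilon> * (v \<bullet> (H x *v v))"
      using B(1) by simp
    finally show ?thesis .
  qed
  show thesis
  proof (rule that[of r])
    show "r > 0" "ball x r \<subseteq> U"
      using r1 r2 by (auto simp: r_def)
    show "(1 - \<epsilon>) * (v \<bullet> (H x *v v)) \<le> v \<bullet> (H y *v v)" "v \<bullet> (H y *v v) \<le> (1 + \<epsilon>) * (v \<bullet> (H x *v v))"
      if "y \<in> ball x r" for y v
      using diff[OF that, of v] by (auto simp: algebra_simps)
    show "\<bar>det (H y) powr s - det (H x) powr s\<bar> \<le> \<epsilon>" if "y \<in> ball x r" for y
      using close[OF that] by blast
  qed
qed

text \<open>One constant for all \<open>k\<close>, since the rate is used with \<open>k = m\<close>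
  for a bound of the right order and with a small fraction of \<open>m\<close> for the part outside
  the cells.\<close>

definition tangent_rate :: "real \<Rightarrow> bool" where
  "tangent_rate C \<longleftrightarrow> (\<forall>k::nat. k \<ge> 1 \<longrightarrow> (\<exists>X. finite X \<and> X \<noteq> {} \<and> X \<subseteq> U \<and> card X \<le> k \<and>
      (\<forall>y\<in>U. \<exists>x\<in>X. u y - (u x + G x \<bullet> (y - x)) \<le> C * real k powr (- (2 / CARD('n))))))"

text \<open>The graph of a monotone map is a Lipschitz graph over \<open>x + G x\<close>, so a net of the bounded set
  \<open>{x + G x | x \<in> U}\<close> controls points and gradients simultaneously.\<close>

lemma tangent_rate_exists:
  assumes "U \<noteq> {}"
  obtains C where "C > 0" "tangent_rate C"
proof -
  let ?n = "real CARD('n)"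
  define \<Phi> where "\<Phi> = (\<lambda>x. x + G x)"
  obtain R0 where R0: "\<And>x. x \<in> U \<Longrightarrow> norm x \<le> R0"
    using bounded_U bounded_iff by blast
  define R where "R = \<bar>R0\<bar> + \<bar>K\<bar> + 1"
  have R: "R > 0" by (simp add: R_def add_nonneg_pos)
  have \<Phi>R: "norm (\<Phi> x) \<le> R" if "x \<in> U" for x
    using norm_triangle_ineq[of x "G x"] R0[OF that] norm_G_le[OF that] by (simp add: \<Phi>_def R_def)
  define C where "C = 4 * R\<^sup>2 * ?n\<^sup>2"
  show thesis
  proof (rule that[of C])
    show "C > 0"
      using R by (simp add: C_def)
    show "tangent_rate C"
      unfolding tangent_rate_def
    proof (intro allI impI)
      fix k :: nat assume k: "k \<ge> 1"
      \<comment> \<open>A grid of N^n cells stays within \<open>k\<close> tangents. Rounding loses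
        at most the factor 2 in \<open>N\<close>, which is the 4 in \<open>C\<close>.\<close>
      define N where "N = nat \<lfloor>real k powr (1 / ?n)\<rfloor>"
      have k1: "real k powr (1 / ?n) \<ge> 1"
        using k by (simp add: ge_one_powr_ge_zero)
      then have N1: "N \<ge> 1"
        by (simp add: N_def le_nat_iff)
      have Nle: "real N \<le> real k powr (1 / ?n)"
        using k1 by (simp add: N_def)
      have Nge: "real k powr (1 / ?n) \<le> 2 * real N"
      proof -
        have "real k powr (1 / ?n) < real N + 1"
          using k1 unfolding N_def by linarith
        then show ?thesis using N1 by linarith
      qed
      have "real (N ^ CARD('n)) \<le> (real k powr (1 / ?n)) ^ CARD('n)"
        using Nle by (simp add: power_mono)
      also have "\<dots> = real k"
        using k by (simp add: powr_powr flip: powr_realpow)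
      finally have Nk: "N ^ CARD('n) \<le> k" by simp
      have "\<exists>v\<in>grid_index N. \<forall>i. \<bar>((1 / (2 * R)) *\<^sub>R \<Phi> x) $ i - grid_center N v $ i\<bar> \<le> 1 / (2 * real N)" if "x \<in> U" for x
      proof -
        have "\<bar>\<Phi> x $ i\<bar> \<le> R" for i
          using component_le_norm_cart[of "\<Phi> x" i] \<Phi>R[OF that] by linarith
        then have "(1 / (2 * R)) *\<^sub>R \<Phi> x \<in> ucube"
          using R by (simp add: mem_ucube abs_mult divide_le_eq)
        moreover have "N > 0"
          using N1 by simp
        ultimately show ?thesis
          by (rule ucube_grid) blast
      qed
      then have "\<forall>x\<in>U. \<exists>v. v \<in> grid_index N \<and> (\<forall>i. \<bar>((1 / (2 * R)) *\<^sub>R \<Phi> x) $ i - grid_center N v $ i\<bar> \<le> 1 / (2 * real N))"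
        by blast
      from bchoice[OF this] obtain idx where idx: "\<And>x. x \<in> U \<Longrightarrow> idx x \<in> grid_index N"
        "\<And>x i. x \<in> U \<Longrightarrow> \<bar>((1 / (2 * R)) *\<^sub>R \<Phi> x) $ i - grid_center N (idx x) $ i\<bar> \<le> 1 / (2 * real N)"
        by blast
      \<comment> \<open>A grid centre need not be of the form x + G x, so each occupied grid cell is
        represented by a point of \<open>U\<close> whose value falls into it; this doubles the
        distance.\<close>
      define rep where "rep = (\<lambda>v. SOME x. x \<in> U \<and> idx x = v)"
      have rep: "rep (idx x) \<in> U \<and> idx (rep (idx x)) = idx x" if "x \<in> U" for x
        unfolding rep_def using that by (intro someI_ex[of "\<lambda>y. y \<in> U \<and> idx y = idx x"]) blast
      define X where "X = rep ` idx ` U"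
      have fin: "finite (idx ` U)"
        by (rule finite_subset[OF image_subsetI finite_grid_index]) (rule idx(1))
      have "card X \<le> card (idx ` U)"
        unfolding X_def using fin by (rule card_image_le)
      also have "\<dots> \<le> card (grid_index N :: ('n \<Rightarrow> nat) set)"
        by (intro card_mono finite_grid_index image_subsetI idx(1))
      also have "\<dots> \<le> k"
        using Nk by (simp add: card_grid_index)
      finally have card: "card X \<le> k" .
      have approx: "\<exists>x\<in>X. u y - (u x + G x \<bullet> (y - x)) \<le> C * real k powr (- (2 / ?n))" if y: "y \<in> U" for y
      proof -
        define x where "x = rep (idx y)"
        have x: "x \<in> U" "idx x = idx y"
          using rep[OF y] by (auto simp: x_def)
        have comp: "\<bar>(\<Phi> y - \<Phi> x) $ i\<bar> \<le> 2 * R / real N" for i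
        proof -
          have "\<bar>((1 / (2 * R)) *\<^sub>R \<Phi> y) $ i - ((1 / (2 * R)) *\<^sub>R \<Phi> x) $ i\<bar> \<le> 1 / (2 * real N) + 1 / (2 * real N)"
            using idx(2)[OF x(1), of i, unfolded x(2)] idx(2)[OF y, of i] by linarith
          then have "\<bar>(1 / (2 * R)) * ((\<Phi> y - \<Phi> x) $ i)\<bar> \<le> 1 / real N"
            by (simp add: right_diff_distrib diff_divide_distrib)
          then have "(1 / (2 * R)) * \<bar>(\<Phi> y - \<Phi> x) $ i\<bar> \<le> 1 / real N"
            using R by (simp add: abs_mult)
          then show ?thesis
            using R by (simp add: field_simps)
        qed
        have "norm (\<Phi> y - \<Phi> x) \<le> (\<Sum>i\<in>UNIV. \<bar>(\<Phi> y - \<Phi> x) $ i\<bar>)"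
          by (rule norm_le_l1_cart)
        also have "\<dots> \<le> (\<Sum>i\<in>(UNIV::'n set). 2 * R / real N)"
          using comp by (intro sum_mono) auto
        finally have nrm: "norm (\<Phi> y - \<Phi> x) \<le> ?n * (2 * R / real N)"
          by simp
        \<comment> \<open>The tangent at \<open>y\<close> is used to estimate the error at
          \<open>y\<close> of the tangent at \<open>x\<close>: it is at most the monotonicity term
          \<open>(G y - G x) \<bullet> (y - x)\<close>.\<close>
        have "u y + G y \<bullet> (x - y) \<le> u x"
          using x y interior_subset by (intro tangent_le) auto
        then have "u y - (u x + G x \<bullet> (y - x)) \<le> (G y - G x) \<bullet> (y - x)"
          by (simp add: inner_diff_left inner_diff_right)
        also have "\<dots> \<le> (1/4) * (norm (\<Phi> y - \<Phi> x))\<^sup>2"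
        proof -
          have eq: "\<Phi> y - \<Phi> x = (G y - G x) + (y - x)"
            by (simp add: \<Phi>_def)
          show ?thesis
            unfolding eq by (rule inner_le_norm_add)
        qed
        also have "\<dots> \<le> (1/4) * (?n * (2 * R / real N))\<^sup>2"
          using nrm by (intro mult_left_mono power_mono) auto
        also have "\<dots> = R\<^sup>2 * ?n\<^sup>2 / (real N)\<^sup>2"
          by (simp add: power_mult_distrib power_divide)
        also have "\<dots> \<le> R\<^sup>2 * ?n\<^sup>2 / ((real k powr (1 / ?n)) / 2)\<^sup>2"
        proof (rule frac_le)
          have "real k powr (1 / ?n) / 2 \<le> real N"
            using Nge by linarith
          then show "(real k powr (1 / ?n) / 2)\<^sup>2 \<le> (real N)\<^sup>2"
            by (intro power_mono) auto
          show "0 < (real k powr (1 / ?n) / 2)\<^sup>2"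
            using k by simp
        qed simp_all
        also have "\<dots> = C / (real k powr (1 / ?n))\<^sup>2"
          by (simp add: C_def power_divide)
        also have "(real k powr (1 / ?n))\<^sup>2 = real k powr (2 / ?n)"
          using k by (simp add: powr_powr flip: powr_realpow)
        also have "C / real k powr (2 / ?n) = C * real k powr (- (2 / ?n))"
          by (simp add: powr_minus_divide)
        finally show ?thesis
          using y by (intro bexI[of _ x]) (auto simp: x_def X_def)
      qed
      show "\<exists>X. finite X \<and> X \<noteq> {} \<and> X \<subseteq> U \<and> card X \<le> k \<and>
        (\<forall>y\<in>U. \<exists>x\<in>X. u y - (u x + G x \<bullet> (y - x)) \<le> C * real k powr (- (2 / ?n)))"
      proof (intro exI[of _ X] conjI)
        show "finite X"
          unfolding X_def using fin by simp
        show "X \<noteq> {}"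
          unfolding X_def using assms by simp
        show "X \<subseteq> U"
          unfolding X_def using rep by blast
        show "card X \<le> k"
          by (rule card)
      qed (use approx in blast)
    qed
  qed
qed

end

section \<open>Lower bound\<close>

text \<open>Jensen's inequality for the power \<open>1 + a\<close> at the points
  \<open>W t / k t\<close> with weights proportional to \<open>k t\<close>. The right-hand side
  models the total error with \<open>k t\<close> points in cell \<open>t\<close>, the left-hand side
  its value for shares proportional to \<open>W\<close>.\<close>

lemma sum_powr_Holder:
  fixes W k :: "'a \<Rightarrow> real"
  assumes "finite C" "a > 0" "\<And>t. t \<in> C \<Longrightarrow> W t > 0" "\<And>t. t \<in> C \<Longrightarrow> k t > 0"
  shows "(\<Sum>t\<in>C. W t) powr (1 + a) * (\<Sum>t\<in>C. k t) powr (- a) \<le> (\<Sum>t\<in>C. W t powr (1 + a) * k t powr (- a))"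
proof (cases "C = {}")
  case False
  define M where "M = (\<Sum>t\<in>C. k t)"
  have M: "M > 0"
    unfolding M_def using assms False by (intro sum_pos) auto
  have "(\<lambda>x. x powr (1 + a)) (\<Sum>t\<in>C. (k t / M) *\<^sub>R (W t / k t)) \<le> (\<Sum>t\<in>C. (k t / M) * (W t / k t) powr (1 + a))"
  proof (rule convex_on_sum[OF assms(1) False])
    show "convex_on {0<..} (\<lambda>x::real. x powr (1 + a))"
      using assms(2) by (intro powr_convex) auto
    show "(\<Sum>t\<in>C. k t / M) = 1"
      using M by (simp add: M_def flip: sum_divide_distrib)
  qed (use assms M in \<open>auto intro: less_imp_le\<close>)
  moreover have "(\<Sum>t\<in>C. (k t / M) *\<^sub>R (W t / k t)) = (\<Sum>t\<in>C. W t) / M"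
  proof -
    have "(\<Sum>t\<in>C. (k t / M) *\<^sub>R (W t / k t)) = (\<Sum>t\<in>C. W t / M)"
      using assms(4) by (intro sum.cong) (auto simp: less_imp_neq[symmetric])
    then show ?thesis by (simp add: sum_divide_distrib)
  qed
  moreover have "(\<Sum>t\<in>C. (k t / M) * (W t / k t) powr (1 + a)) = (\<Sum>t\<in>C. W t powr (1 + a) * k t powr (- a)) / M"
  proof -
    have "(k t / M) * (W t / k t) powr (1 + a) = W t powr (1 + a) * k t powr (- a) / M" if "t \<in> C" for t
    proof -
      have "k t powr (1 + a) = k t * k t powr a"
        using assms(4)[OF that] by (simp add: powr_add)
      then show ?thesis
        using assms(3)[OF that] assms(4)[OF that] by (simp add: powr_divide powr_minus_divide)
    qed
    then show ?thesis
      unfolding sum_divide_distrib by (rule sum.cong[OF refl])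
  qed
  ultimately have "((\<Sum>t\<in>C. W t) / M) powr (1 + a) \<le> (\<Sum>t\<in>C. W t powr (1 + a) * k t powr (- a)) / M"
    by simp
  moreover have "((\<Sum>t\<in>C. W t) / M) powr (1 + a) = (\<Sum>t\<in>C. W t) powr (1 + a) * M powr (- a) / M"
  proof -
    have "M powr (1 + a) = M * M powr a"
      using M by (simp add: powr_add)
    moreover have "(\<Sum>t\<in>C. W t) \<ge> 0"
      using assms(3) by (intro sum_nonneg) (auto intro: less_imp_le)
    ultimately show ?thesis
      using M by (simp add: powr_divide powr_minus_divide)
  qed
  ultimately show ?thesis
    using M by (simp add: M_def divide_le_cancel)
qed simp

lemma integral_ge_sum_disjoint:
  fixes f :: "'a::euclidean_space \<Rightarrow> real"
  assumes "finite I" "\<And>i. i \<in> I \<Longrightarrow> T i \<subseteq> S" "f integrable_on S" "\<And>i. i \<in> I \<Longrightarrow> f integrable_on T i"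
    and "\<And>i j. i \<in> I \<Longrightarrow> j \<in> I \<Longrightarrow> i \<noteq> j \<Longrightarrow> T i \<inter> T j = {}" "\<And>x. x \<in> S \<Longrightarrow> 0 \<le> f x"
  shows "(\<Sum>i\<in>I. integral (T i) f) \<le> integral S f"
proof -
  have UN: "(f has_integral (\<Sum>i\<in>I. integral (T i) f)) (\<Union>i\<in>I. T i)"
    using assms(1,4,5) by (intro has_integral_UN) (auto simp: pairwise_def integrable_integral)
  then have "(\<Sum>i\<in>I. integral (T i) f) = integral (\<Union>i\<in>I. T i) f"
    by (rule integral_unique[symmetric])
  also have "\<dots> \<le> integral S f"
    using assms UN by (intro integral_subset_le) (auto simp: has_integral_integrable)
  finally show ?thesis .
qed

text \<open>Makes the shrunk closed cells of a tiling pairwise disjoint, so that integrals over them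
  can be added.\<close>

lemma cell_shrink_subset:
  assumes "0 < \<theta>" "\<theta> < 1"
  shows "cell L c (\<theta> * h) \<subseteq> open_cell L c h"
proof
  fix x assume "x \<in> cell L c (\<theta> * h)"
  then obtain z where z: "z \<in> ucube" "x = c + ((\<theta> * h) *\<^sub>R L) *v z"
    by (auto simp: cell_def)
  have "\<bar>\<theta> * z $ i\<bar> < 1/2" for i
  proof -
    have "\<bar>z $ i\<bar> \<le> 1/2"
      using z(1) by (simp add: mem_ucube)
    then have "\<theta> * \<bar>z $ i\<bar> \<le> \<theta> * (1/2)"
      using assms by (intro mult_left_mono) auto
    also have "\<dots> < 1/2"
      using assms by simp
    finally show ?thesis
      using assms by (simp add: abs_mult)
  qed
  then have "\<theta> *\<^sub>R z \<in> open_ucube"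
    by (simp add: mem_open_ucube)
  moreover have "x = c + (h *\<^sub>R L) *v (\<theta> *\<^sub>R z)"
    by (simp add: z(2) matrix_vector_mult_scaleR scaleR_matrix_vector_assoc[symmetric])
  ultimately show "x \<in> open_cell L c h"
    by (auto simp: open_cell_def)
qed

lemma finite_net_ucube:
  assumes "d > 0"
  obtains N :: "(real^'n) set" where "finite N" "N \<noteq> {}" "\<And>y. y \<in> ucube \<Longrightarrow> infdist y N \<le> d"
proof -
  obtain N :: "(real^'n) set" where N: "finite N" "ucube \<subseteq> (\<Union>x\<in>N. ball x d)"
    using compact_ucube[where 'n='n] assms unfolding compact_eq_totally_bounded by blast
  show thesis
  proof (rule that[OF N(1)])
    show "N \<noteq> {}"
      using N(2) zero_in_ucube by blast
    fix y :: "real^'n" assume "y \<in> ucube"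
    then obtain x where "x \<in> N" "y \<in> ball x d"
      using N(2) by blast
    then show "infdist y N \<le> d"
      by (intro infdist_le2[of x]) (auto simp: dist_commute)
  qed
qed

context C2_convex
begin

section \<open>Tilings adapted to the Hessian, and the error on one cell\<close>

definition near_quadratic :: "real \<Rightarrow> real^'n \<Rightarrow> (real^'n) set \<Rightarrow> bool" where
  "near_quadratic \<epsilon> x T \<longleftrightarrow> (\<forall>y\<in>T. \<forall>v. (1 - \<epsilon>) * (v \<bullet> (H x *v v)) \<le> v \<bullet> (H y *v v) \<and>
     v \<bullet> (H y *v v) \<le> (1 + \<epsilon>) * (v \<bullet> (H x *v v)))"

text \<open>One parameter controls the relative deviation of the Hessian, the oscillation of the
  integrand and the measure left uncovered. Closed cells may touch along their boundaries.\<close>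

definition tiling :: "real \<Rightarrow> real \<Rightarrow> ((real^'n) \<times> (real^'n) \<times> real) set \<Rightarrow> bool" where
  "tiling s \<epsilon> C \<longleftrightarrow> finite C \<and>
     (\<forall>x c h. (x, c, h) \<in> C \<longrightarrow> x \<in> U \<and> h > 0 \<and> cell (shape x) c h \<subseteq> U \<and> near_quadratic \<epsilon> x (cell (shape x) c h) \<and>
        (\<forall>y\<in>cell (shape x) c h. \<bar>det (H y) powr s - det (H x) powr s\<bar> \<le> \<epsilon>)) \<and>
     (\<forall>x c h x' c' h'. (x, c, h) \<in> C \<longrightarrow> (x', c', h') \<in> C \<longrightarrow> (x, c, h) \<noteq> (x', c', h') \<longrightarrow>
        open_cell (shape x) c h \<inter> open_cell (shape x') c' h' = {}) \<and>
     measure lebesgue (U - (\<Union>(x, c, h)\<in>C. cell (shape x) c h)) < \<epsilon>"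

text \<open>Plays two roles: the sum over a tiling approximates the integral of the power of the
  determinant, and by \<open>weight_powr\<close> its power \<open>1 + 2 * p / n\<close> is the
  factor by which the quantization error of the unit cube scales to the cell.\<close>

definition weight :: "real \<Rightarrow> (real^'n) \<times> (real^'n) \<times> real \<Rightarrow> real" where
  "weight s = (\<lambda>(x, c, h). measure lebesgue (cell (shape x) c h) * det (H x) powr s)"

lemma tiling_exists:
  assumes "\<epsilon> > 0"
  obtains C where "tiling s \<epsilon> C"
proof -
  have "\<forall>x\<in>U. \<exists>r. r > 0 \<and> near_quadratic \<epsilon> x (ball x r) \<and> (\<forall>y\<in>ball x r. \<bar>det (H y) powr s - det (H x) powr s\<bar> \<le> \<epsilon>)"
  proof
    fix x assume x: "x \<in> U"
    show "\<exists>r. r > 0 \<and> near_quadratic \<epsilon> x (ball x r) \<and> (\<forall>y\<in>ball x r. \<bar>det (H y) powr s - det (H x) powr s\<bar> \<le> \<epsilon>)"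
      by (rule hessian_gauge[OF x assms, of s]) (auto simp: near_quadratic_def)
  qed
  from bchoice[OF this] obtain r where r: "\<And>x. x \<in> U \<Longrightarrow> r x > 0" "\<And>x. x \<in> U \<Longrightarrow> near_quadratic \<epsilon> x (ball x (r x))"
    "\<And>x y. x \<in> U \<Longrightarrow> y \<in> ball x (r x) \<Longrightarrow> \<bar>det (H y) powr s - det (H x) powr s\<bar> \<le> \<epsilon>"
    by blast
  obtain C where C: "finite C"
    "\<And>x c h. (x, c, h) \<in> C \<Longrightarrow> x \<in> U \<and> h > 0 \<and> cell (shape x) c h \<subseteq> ball x (r x) \<inter> U"
    "\<And>x c h x' c' h'. (x, c, h) \<in> C \<Longrightarrow> (x', c', h') \<in> C \<Longrightarrow> (x, c, h) \<noteq> (x', c', h') \<Longrightarrow>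
       open_cell (shape x) c h \<inter> open_cell (shape x') c' h' = {}"
    "measure lebesgue (U - (\<Union>(x, c, h)\<in>C. cell (shape x) c h)) < \<epsilon>"
  proof -
    show ?thesis
      by (rule cell_cover[where U = U and r = r and L = shape and \<eta> = \<epsilon>])
         (use bounded_U r(1) det_shape_nonzero assms that in auto)
  qed
  show thesis
  proof (rule that[of C], unfold tiling_def, intro conjI allI impI ballI)
    fix x c h assume xch: "(x, c, h) \<in> C"
    show "x \<in> U" "h > 0" "cell (shape x) c h \<subseteq> U"
      using C(2)[OF xch] by auto
    show "near_quadratic \<epsilon> x (cell (shape x) c h)"
      using C(2)[OF xch] r(2)[of x] by (auto simp: near_quadratic_def)
    show "\<bar>det (H y) powr s - det (H x) powr s\<bar> \<le> \<epsilon>" if "y \<in> cell (shape x) c h" for y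
      using C(2)[OF xch] that by (intro r(3)) auto
  next
    fix x c h x' c' h' assume "(x, c, h) \<in> C" "(x', c', h') \<in> C" "(x, c, h) \<noteq> (x', c', h')"
    then show "open_cell (shape x) c h \<inter> open_cell (shape x') c' h' = {}"
      by (rule C(3))
  qed (use C in auto)
qed

lemma weight_pos:
  assumes "x \<in> U" "h > 0"
  shows "weight s (x, c, h) > 0"
  using assms det_H_pos[OF assms(1)] det_shape_nonzero[OF assms(1)]
  by (auto simp: weight_def measure_cell intro!: mult_pos_pos)

text \<open>The determinant of \<open>H x\<close> is |det L|^(-2) for the shape \<open>L\<close>,
  and the exponent \<open>s\<close> solves (1 - 2s)(1 + 2p/n) = 1, so exactly one factor |det L|
  survives.\<close>

lemma weight_powr:
  fixes p :: real
  assumes x: "x \<in> U" and h: "h > 0" and p: "p > 0"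
  shows "weight (p / (CARD('n) + 2 * p)) (x, c, h) powr (1 + 2 * p / CARD('n))
       = h ^ CARD('n) * \<bar>det (shape x)\<bar> * h powr (2 * p)"
proof -
  let ?n = "real CARD('n)"
  define d where "d = \<bar>det (shape x)\<bar>"
  define s where "s = p / (?n + 2 * p)"
  have d: "d > 0"
    using det_shape_nonzero[OF x] by (simp add: d_def)
  have "det (H x) * d\<^sup>2 = 1"
    using shape(1)[OF x] by (simp add: d_def)
  then have "det (H x) = 1 / d\<^sup>2"
    using d by (simp add: field_simps)
  also have "\<dots> = d powr (- 2)"
    using d by (simp add: powr_minus_divide powr_numeral)
  finally have detH: "det (H x) = d powr (- 2)" .
  have "weight s (x, c, h) = h powr ?n * d * d powr (- 2 * s)"
    using h d by (simp add: weight_def measure_cell detH powr_powr powr_realpow d_def[symmetric])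
  also have "\<dots> = h powr ?n * d powr (1 - 2 * s)"
    using d by (simp add: powr_diff powr_minus_divide)
  finally have W: "weight s (x, c, h) = h powr ?n * d powr (1 - 2 * s)" .
  have n: "?n > 0" by simp
  have e1: "?n * (1 + 2 * p / ?n) = ?n + 2 * p"
    using n by (simp add: field_simps)
  have e2: "(1 - 2 * s) * (1 + 2 * p / ?n) = 1"
  proof -
    have np: "?n + 2 * p > 0"
      using n p by linarith
    have "1 - 2 * s = ?n / (?n + 2 * p)"
      using np by (simp add: s_def field_simps)
    moreover have "1 + 2 * p / ?n = (?n + 2 * p) / ?n"
      using n by (simp add: field_simps)
    ultimately show ?thesis
      using n np by simp
  qed
  have "weight s (x, c, h) powr (1 + 2 * p / ?n) = h powr (?n * (1 + 2 * p / ?n)) * d powr ((1 - 2 * s) * (1 + 2 * p / ?n))"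
    using h d by (simp only: W powr_mult powr_powr powr_ge_zero)
  also have "\<dots> = h powr (?n + 2 * p) * d"
    using d by (simp only: e1 e2) simp
  also have "\<dots> = h ^ CARD('n) * d * h powr (2 * p)"
    using h by (simp add: powr_add powr_realpow)
  finally show ?thesis
    by (simp add: s_def d_def)
qed

lemma taylor_bounds:
  assumes x: "x \<in> U" and T: "T \<subseteq> U" "convex T" "near_quadratic \<epsilon> x T" and a: "a \<in> T" and z: "z \<in> T"
  shows "u a + G a \<bullet> (z - a) + (1 - \<epsilon>) / 2 * ((z - a) \<bullet> (H x *v (z - a))) \<le> u z"
    and "u z \<le> u a + G a \<bullet> (z - a) + (1 + \<epsilon>) / 2 * ((z - a) \<bullet> (H x *v (z - a)))"
proof -
  obtain t where t: "0 < t" "t < 1"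
    "u z = u a + G a \<bullet> (z - a) + (1/2) * ((z - a) \<bullet> (H (a + t *\<^sub>R (z - a)) *v (z - a)))"
    using taylor[of a z] a z T(1) by blast
  have "a + t *\<^sub>R (z - a) \<in> T"
    using convexD_alt[OF T(2) a z, of t] t by (simp add: algebra_simps)
  then have "(1 - \<epsilon>) * ((z - a) \<bullet> (H x *v (z - a))) \<le> (z - a) \<bullet> (H (a + t *\<^sub>R (z - a)) *v (z - a))"
    "(z - a) \<bullet> (H (a + t *\<^sub>R (z - a)) *v (z - a)) \<le> (1 + \<epsilon>) * ((z - a) \<bullet> (H x *v (z - a)))"
    using T(3) unfolding near_quadratic_def by blast+
  then show "u a + G a \<bullet> (z - a) + (1 - \<epsilon>) / 2 * ((z - a) \<bullet> (H x *v (z - a))) \<le> u z"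
    "u z \<le> u a + G a \<bullet> (z - a) + (1 + \<epsilon>) / 2 * ((z - a) \<bullet> (H x *v (z - a)))"
    unfolding t(3) by (simp_all add: field_simps)
qed

lemma shape_quadratic_form:
  assumes "x \<in> U"
  shows "((c + (h *\<^sub>R shape x) *v y) - (c + (h *\<^sub>R shape x) *v z)) \<bullet>
     (H x *v ((c + (h *\<^sub>R shape x) *v y) - (c + (h *\<^sub>R shape x) *v z))) = h\<^sup>2 * (dist y z)\<^sup>2"
proof -
  have "(c + (h *\<^sub>R shape x) *v y) - (c + (h *\<^sub>R shape x) *v z) = h *\<^sub>R (shape x *v (y - z))"
    by (simp add: matrix_vector_mult_diff_distrib scaleR_matrix_vector_assoc[symmetric] scaleR_diff_right)
  then show ?thesis
    by (simp add: matrix_vector_mult_scaleR shape(2)[OF assms] dist_norm dot_square_norm power2_eq_square)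
qed

text \<open>First-order condition over a convex set: a negative slope towards \<open>z\<close> would
  decrease the function within \<open>T\<close>. The minimum may lie on the boundary of
  \<open>T\<close>, so equality of \<open>G a\<close> and \<open>w\<close> cannot be
  expected.\<close>

lemma gradient_at_minimum:
  assumes T: "T \<subseteq> U" "convex T" and a: "a \<in> T" and min: "\<And>z. z \<in> T \<Longrightarrow> u a - w \<bullet> a \<le> u z - w \<bullet> z"
    and z: "z \<in> T"
  shows "0 \<le> (G a - w) \<bullet> (z - a)"
proof (rule ccontr)
  assume "\<not> 0 \<le> (G a - w) \<bullet> (z - a)"
  then have neg: "(G a - w) \<bullet> (z - a) < 0" by simp
  let ?\<phi> = "\<lambda>t. u (a + t *\<^sub>R (z - a)) - w \<bullet> (a + t *\<^sub>R (z - a))"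
  have "a + 0 *\<^sub>R (z - a) \<in> U"
    using a T by auto
  note deriv_u_line[OF this]
  moreover have "((\<lambda>t. w \<bullet> (a + t *\<^sub>R (z - a))) has_real_derivative (w \<bullet> (z - a))) (at 0)"
    by (auto simp: inner_add_right intro!: derivative_eq_intros)
  ultimately have "(?\<phi> has_real_derivative ((G a - w) \<bullet> (z - a))) (at 0)"
    using DERIV_diff by (fastforce simp: inner_diff_left)
  from DERIV_neg_dec_right[OF this neg] obtain d where d: "d > 0" "\<And>t. 0 < t \<Longrightarrow> t < d \<Longrightarrow> ?\<phi> t < ?\<phi> 0"
    by auto
  define t where "t = min (d / 2) 1"
  have t: "0 < t" "t < d" "t \<le> 1"
    using d(1) by (auto simp: t_def)
  have "a + t *\<^sub>R (z - a) \<in> T"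
    using convexD_alt[OF T(2) a z, of t] t by (simp add: algebra_simps)
  then show False
    using min[of "a + t *\<^sub>R (z - a)"] d(2)[OF t(1,2)] by simp
qed

text \<open>On a cell, \<open>u\<close> minus an affine minorant is at least the quadratic form centred at its minimum
  point over the cell. An interior minimum point is determined by the slope, so it belongs to one cell
  only; a minimum point on the boundary is worse on the shrunk cell than the fixed net \<open>N\<close>.\<close>

lemma cell_error_ge:
  assumes x: "x \<in> U" and h: "h > 0" and T: "cell (shape x) c h \<subseteq> U" "near_quadratic \<epsilon> x (cell (shape x) c h)"
    and \<epsilon>: "0 < \<epsilon>" "\<epsilon> < 1" and \<theta>: "0 < \<theta>" "\<theta> < 1"
    and S: "finite S" "S \<noteq> {}" "\<And>x. x \<in> U \<Longrightarrow> affmax S x \<le> u x"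
    and N: "N \<noteq> {}" "\<And>y. y \<in> ucube \<Longrightarrow> infdist y N \<le> (1 - \<theta>) / 2"
    and P: "P = {y \<in> open_ucube. G (c + (h *\<^sub>R shape x) *v y) \<in> fst ` S}"
    and y: "y = \<theta> *\<^sub>R y0" "y0 \<in> ucube"
  shows "(1 - \<epsilon>) / 2 * (h * infdist y (P \<union> N))\<^sup>2 \<le> u (c + (h *\<^sub>R shape x) *v y) - affmax S (c + (h *\<^sub>R shape x) *v y)"
proof -
  define g where "g = (\<lambda>y. c + (h *\<^sub>R shape x) *v y)"
  define T where "T = cell (shape x) c h"
  have Tg: "T = g ` ucube"
    by (simp add: T_def g_def cell_def)
  have TU: "T \<subseteq> U" and nq: "near_quadratic \<epsilon> x T"
    using T by (auto simp: T_def)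
  have convT: "convex T"
    by (simp add: T_def convex_cell)
  have yi: "\<bar>y $ i\<bar> \<le> \<theta> / 2" for i
  proof -
    have "\<bar>y0 $ i\<bar> \<le> 1/2"
      using y(2) by (simp add: mem_ucube)
    then have "\<theta> * \<bar>y0 $ i\<bar> \<le> \<theta> * (1/2)"
      using \<theta> by (intro mult_left_mono) auto
    then show ?thesis
      using \<theta> by (simp add: y(1) abs_mult)
  qed
  have yu: "y \<in> ucube"
    unfolding mem_ucube using yi \<theta> by (smt (verit) divide_right_mono)
  have gy: "g y \<in> T"
    using yu by (simp add: Tg)
  obtain w b where wb: "(w, b) \<in> S" "affmax S (g y) = w \<bullet> g y + b"
    using affmax_attained[OF S(1,2)] by blast
  have below: "w \<bullet> z + b \<le> u z" if "z \<in> U" for z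
    using affmax_ge[OF S(1) wb(1), of z] S(3)[OF that] by linarith
  have "continuous_on T (\<lambda>z. u z - w \<bullet> z)"
    by (intro continuous_intros continuous_on_subset[OF continuous_on_u TU])
  then obtain a where a: "a \<in> T" "\<And>z. z \<in> T \<Longrightarrow> u a - w \<bullet> a \<le> u z - w \<bullet> z"
    using continuous_attains_inf[of T "\<lambda>z. u z - w \<bullet> z"] gy compact_cell by (metis T_def empty_iff)
  then obtain ya where ya: "ya \<in> ucube" "a = g ya"
    by (auto simp: Tg)
  \<comment> \<open>By this sign, replacing the slope \<open>G a\<close> by \<open>w\<close> in the
    Taylor bound only lowers it, and \<open>u a\<close> is at least
    \<open>w \<bullet> a + b\<close>; what is left of the difference is the quadratic term.\<close>
  have "(G a - w) \<bullet> (g y - a) \<ge> 0"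
    using gradient_at_minimum[OF TU convT a gy] .
  moreover have "u a + G a \<bullet> (g y - a) + (1 - \<epsilon>) / 2 * ((g y - a) \<bullet> (H x *v (g y - a))) \<le> u (g y)"
    by (rule taylor_bounds(1)[OF x TU convT nq a(1) gy])
  moreover have "(g y - a) \<bullet> (H x *v (g y - a)) = h\<^sup>2 * (dist y ya)\<^sup>2"
    unfolding ya(2) g_def by (rule shape_quadratic_form[OF x])
  moreover have "w \<bullet> a + b \<le> u a"
    using below a(1) TU by blast
  ultimately have ge: "(1 - \<epsilon>) / 2 * (h\<^sup>2 * (dist y ya)\<^sup>2) \<le> u (g y) - affmax S (g y)"
    by (simp add: wb(2) inner_diff_left inner_diff_right)
  have "infdist y (P \<union> N) \<le> dist y ya"
  proof (cases "ya \<in> open_ucube")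
    case True
    have op: "open (open_cell (shape x) c h)"
      using h det_shape_nonzero[OF x] by (intro open_open_cell) auto
    have ao: "a \<in> open_cell (shape x) c h"
      using True by (auto simp: ya(2) g_def open_cell_def)
    have "((\<lambda>z. u z - w \<bullet> z) has_derivative (\<lambda>k. G a \<bullet> k - w \<bullet> k)) (at a)"
      using a(1) TU by (intro has_derivative_diff gradient) (auto intro!: derivative_eq_intros)
    moreover have "\<forall>z\<in>open_cell (shape x) c h. u a - w \<bullet> a \<le> u z - w \<bullet> z"
      using a(2) open_cell_subset[of "shape x" c h] by (auto simp: T_def)
    ultimately have "(\<lambda>k. G a \<bullet> k - w \<bullet> k) = (\<lambda>k. 0)"
      using differential_zero_maxmin[OF ao op] by blast
    then have "(G a - w) \<bullet> (G a - w) = 0"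
      by (metis inner_diff_left)
    then have "G a = w"
      by simp
    then have "ya \<in> P"
      using True wb(1) by (force simp: P ya(2) g_def)
    then show ?thesis
      by (intro infdist_le) auto
  next
    case False
    \<comment> \<open>The point \<open>y\<close> lies in the cube shrunk by \<open>\<theta>\<close>,
      so its distance to a boundary point is at least \<open>(1 - \<theta>) / 2\<close>, which is
      the mesh of \<open>N\<close>.\<close>
    then obtain i where i: "\<bar>ya $ i\<bar> \<ge> 1/2"
      by (auto simp: mem_open_ucube not_less)
    have "(1 - \<theta>) / 2 \<le> \<bar>(y - ya) $ i\<bar>"
      using i yi[of i] abs_triangle_ineq2[of "ya $ i" "y $ i"] by (simp add: abs_minus_commute[of "y $ i"])
    also have "\<dots> \<le> dist y ya"
      unfolding dist_norm by (rule component_le_norm_cart)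
    finally show ?thesis
      using infdist_mono[of N "P \<union> N" y] N yu by force
  qed
  then have "(h * infdist y (P \<union> N))\<^sup>2 \<le> h\<^sup>2 * (dist y ya)\<^sup>2"
    using h by (simp add: power_mult_distrib power_mono infdist_nonneg)
  then have "(1 - \<epsilon>) / 2 * (h * infdist y (P \<union> N))\<^sup>2 \<le> (1 - \<epsilon>) / 2 * (h\<^sup>2 * (dist y ya)\<^sup>2)"
    using \<epsilon> by (intro mult_left_mono) auto
  with ge show ?thesis
    unfolding g_def by linarith
qed

end

lemma power2_powr: "0 \<le> x \<Longrightarrow> (x\<^sup>2) powr p = x powr (2 * p)" for x :: real
  by (cases "x = 0") (auto simp: powr_powr simp flip: powr_numeral)

context C2_convex
begin

text \<open>Dividing the points of \<open>P\<close> and \<open>N\<close> by \<open>\<theta>\<close>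
  turns the shrunk cube into the unit cube, where the lower bound with \<open>\<delta>\<close> holds
  for the resulting set \<open>Q\<close>. The rescaling costs the powers of
  \<open>\<theta>\<close>.\<close>

lemma cell_integral_ge:
  fixes N P :: "(real^'n) set" and p :: real
  assumes x: "x \<in> U" and h: "h > 0" and T: "cell (shape x) c h \<subseteq> U" "near_quadratic \<epsilon> x (cell (shape x) c h)"
    and \<epsilon>: "0 < \<epsilon>" "\<epsilon> < 1" and \<theta>: "0 < \<theta>" "\<theta> < 1"
    and S: "finite S" "S \<noteq> {}" "\<And>x. x \<in> U \<Longrightarrow> affmax S x \<le> u x"
    and N: "finite N" "N \<noteq> {}" "\<And>y. y \<in> ucube \<Longrightarrow> infdist y N \<le> (1 - \<theta>) / 2"
    and P: "P = {y \<in> open_ucube. G (c + (h *\<^sub>R shape x) *v y) \<in> fst ` S}" "finite P"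
    and p: "p > 0" and \<delta>: "\<delta> > 0"
      "\<And>S :: (real^'n) set. finite S \<Longrightarrow> S \<noteq> {} \<Longrightarrow> \<delta> * real (card S) powr (- (2 * p / CARD('n))) \<le> quant_err p S"
  shows "((1 - \<epsilon>) / 2) powr p * \<theta> ^ CARD('n) * \<theta> powr (2 * p) * \<delta> *
      (weight (p / (CARD('n) + 2 * p)) (x, c, h) powr (1 + 2 * p / CARD('n)) * (real (card P) + real (card N)) powr (- (2 * p / CARD('n))))
    \<le> integral (cell (shape x) c (\<theta> * h)) (\<lambda>z. (u z - affmax S z) powr p)"
proof -
  let ?n = "real CARD('n)"
  define F where "F = (\<lambda>z. (u z - affmax S z) powr p)"
  define A where "A = (\<theta> * h) *\<^sub>R shape x"
  define Q where "Q = (\<lambda>z. (1 / \<theta>) *\<^sub>R z) ` (P \<union> N)"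
  have Q: "finite Q" "Q \<noteq> {}"
    using P(2) N by (auto simp: Q_def)
  have PN: "P \<union> N = (\<lambda>z. 0 + \<theta> *\<^sub>R z) ` Q"
    using \<theta> by (simp add: Q_def image_image)
  have inf: "infdist (\<theta> *\<^sub>R y) (P \<union> N) = \<theta> * infdist y Q" for y
    using infdist_image_homothety[OF Q \<theta>(1), of 0 y] unfolding PN[symmetric] by simp
  have sub: "cell (shape x) c (\<theta> * h) \<subseteq> U"
    using cell_shrink_subset[OF \<theta>] open_cell_subset T(1) by blast
  have cF: "continuous_on (cell (shape x) c (\<theta> * h)) F"
    unfolding F_def by (rule continuous_on_subset[OF error_continuous[OF p S] sub])
  have detA: "\<bar>det A\<bar> = \<theta> ^ CARD('n) * (h ^ CARD('n) * \<bar>det (shape x)\<bar>)" "det A \<noteq> 0"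
    using \<theta> h det_shape_nonzero[OF x] by (auto simp: A_def det_scaleR_matrix abs_mult power_mult_distrib)
  define \<kappa> where "\<kappa> = ((1 - \<epsilon>) / 2) powr p * (h powr (2 * p) * \<theta> powr (2 * p))"
  have \<kappa>: "\<kappa> \<ge> 0"
    by (simp add: \<kappa>_def)
  have pt: "\<kappa> * infdist y Q powr (2 * p) \<le> F (c + A *v y)" if y: "y \<in> ucube" for y
  proof -
    have eq: "c + (h *\<^sub>R shape x) *v (\<theta> *\<^sub>R y) = c + A *v y"
      by (simp add: A_def matrix_vector_mult_scaleR scaleR_matrix_vector_assoc[symmetric] mult.commute)
    have "(1 - \<epsilon>) / 2 * (h * (\<theta> * infdist y Q))\<^sup>2 \<le> u (c + A *v y) - affmax S (c + A *v y)"
      using cell_error_ge[OF x h T \<epsilon> \<theta> S N(2,3) P(1) refl y] by (simp only: eq inf)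
    then have "((1 - \<epsilon>) / 2 * (h * (\<theta> * infdist y Q))\<^sup>2) powr p \<le> F (c + A *v y)"
      unfolding F_def using \<epsilon> p by (intro powr_mono2) auto
    also have "((1 - \<epsilon>) / 2 * (h * (\<theta> * infdist y Q))\<^sup>2) powr p = \<kappa> * infdist y Q powr (2 * p)"
    proof -
      have nn: "0 \<le> h * (\<theta> * infdist y Q)"
        using h \<theta> by (simp add: infdist_nonneg)
      have "((1 - \<epsilon>) / 2 * (h * (\<theta> * infdist y Q))\<^sup>2) powr p = ((1 - \<epsilon>) / 2) powr p * ((h * (\<theta> * infdist y Q))\<^sup>2) powr p"
        by (rule powr_mult)
      also have "((h * (\<theta> * infdist y Q))\<^sup>2) powr p = h powr (2 * p) * (\<theta> powr (2 * p) * infdist y Q powr (2 * p))"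
        using h \<theta> by (simp add: power2_powr[OF nn] powr_mult infdist_nonneg)
      finally show ?thesis
        by (simp add: \<kappa>_def mult_ac)
    qed
    finally show ?thesis .
  qed
  have "\<kappa> * (\<delta> * (real (card P) + real (card N)) powr (- (2 * p / ?n))) \<le> \<kappa> * (\<delta> * real (card Q) powr (- (2 * p / ?n)))"
  proof (intro mult_left_mono \<kappa> powr_mono2')
    show "0 < real (card Q)"
      using Q by (simp add: card_gt_0_iff)
    have "card Q \<le> card (P \<union> N)"
      unfolding Q_def using P(2) N by (intro card_image_le) auto
    also have "\<dots> \<le> card P + card N"
      by (rule card_Un_le)
    finally show "real (card Q) \<le> real (card P) + real (card N)"
      by linarith
  qed (use p \<delta> in auto)
  also have "\<dots> \<le> \<kappa> * quant_err p Q"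
    by (intro mult_left_mono \<kappa> \<delta>(2) Q)
  also have "\<dots> = integral ucube (\<lambda>y. \<kappa> * infdist y Q powr (2 * p))"
    by (simp add: quant_err_def)
  also have "\<dots> \<le> integral ucube (\<lambda>y. F (c + A *v y))"
  proof (rule integral_le)
    show "(\<lambda>y. \<kappa> * infdist y Q powr (2 * p)) integrable_on ucube"
      using integrable_infdist_powr[OF p compact_ucube, of Q] by (rule integrable_on_mult_right)
    have "continuous_on ucube (\<lambda>y. F (c + A *v y))"
      by (rule continuous_on_compose2[OF cF])
         (auto simp: A_def cell_def intro!: continuous_intros matrix_vector_mult_linear_continuous_on)
    then show "(\<lambda>y. F (c + A *v y)) integrable_on ucube"
      using integrable_continuous unfolding ucube_def by blast
  qed (rule pt)
  finally have "\<bar>det A\<bar> * (\<kappa> * (\<delta> * (real (card P) + real (card N)) powr (- (2 * p / ?n)))) \<le> \<bar>det A\<bar> * integral ucube (\<lambda>y. F (c + A *v y))"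
    by (intro mult_left_mono) auto
  also have "\<dots> = integral (cell (shape x) c (\<theta> * h)) F"
    using integral_affine_image[OF detA(2) compact_ucube, of c F] cF by (simp add: cell_def A_def)
  finally show ?thesis
    unfolding F_def weight_powr[OF x h p] detA \<kappa>_def by (simp add: mult_ac)
qed

text \<open>As \<open>G\<close> is injective on \<open>U\<close>, disjoint open cells have disjoint
  gradient images, and a slope has at most one preimage in a cell. Open cells matter, since closed
  ones may share boundary points.\<close>

lemma card_slopes_le:
  assumes "tiling s \<epsilon> C" and S: "finite S"
    and P: "P = (\<lambda>(x, c, h). {y \<in> open_ucube. G (c + (h *\<^sub>R shape x) *v y) \<in> fst ` S})"
  shows "\<And>t. t \<in> C \<Longrightarrow> finite (P t)" "(\<Sum>t\<in>C. card (P t)) \<le> card S"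
proof -
  have C: "finite C" "\<And>x c h. (x, c, h) \<in> C \<Longrightarrow> x \<in> U \<and> h > 0 \<and> cell (shape x) c h \<subseteq> U"
    and disj: "\<And>x c h x' c' h'. (x, c, h) \<in> C \<Longrightarrow> (x', c', h') \<in> C \<Longrightarrow> (x, c, h) \<noteq> (x', c', h') \<Longrightarrow>
        open_cell (shape x) c h \<inter> open_cell (shape x') c' h' = {}"
    using assms(1) unfolding tiling_def by blast+
  define Q where "Q = (\<lambda>(x, c, h). G ` open_cell (shape x) c h \<inter> fst ` S)"
  have PQ: "finite (P t) \<and> card (P t) \<le> card (Q t)" if t: "t \<in> C" for t
  proof -
    obtain x c h where xch: "t = (x, c, h)"
      by (cases t)
    have x: "x \<in> U" "h > 0" "cell (shape x) c h \<subseteq> U"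
      using C(2) t xch by auto
    let ?g = "\<lambda>y. G (c + (h *\<^sub>R shape x) *v y)"
    have inU: "c + (h *\<^sub>R shape x) *v y \<in> U" if "y \<in> open_ucube" for y
      using that x(3) open_cell_subset[of "shape x" c h] by (auto simp: open_cell_def)
    have inj: "inj_on ?g (P t)"
    proof (rule inj_onI)
      fix y z assume yz: "y \<in> P t" "z \<in> P t" "?g y = ?g z"
      then have "y \<in> open_ucube" "z \<in> open_ucube"
        by (simp_all add: P xch)
      then have "c + (h *\<^sub>R shape x) *v y = c + (h *\<^sub>R shape x) *v z"
        by (intro inj_onD[OF inj_on_G yz(3)] inU)
      then show "y = z"
      proof (rule injD[rotated])
        show "inj (\<lambda>y. c + (h *\<^sub>R shape x) *v y)"
          by (rule inj_cell_map) (use x(2) det_shape_nonzero[OF x(1)] in auto)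
      qed
    qed
    have im: "?g ` P t \<subseteq> Q t"
      by (auto simp: P Q_def xch open_cell_def)
    have finQ: "finite (Q t)"
      using S by (auto simp: Q_def xch)
    show ?thesis
      using inj_on_finite[OF inj im finQ] card_inj_on_le[OF inj im finQ] by blast
  qed
  then show "\<And>t. t \<in> C \<Longrightarrow> finite (P t)"
    by blast
  have "(\<Sum>t\<in>C. card (P t)) \<le> (\<Sum>t\<in>C. card (Q t))"
    using PQ by (intro sum_mono) blast
  also have "\<dots> = card (\<Union>t\<in>C. Q t)"
  proof (rule card_UN_disjoint[symmetric, OF C(1)])
    show "\<forall>t\<in>C. finite (Q t)"
      using S by (auto simp: Q_def)
    show "\<forall>t\<in>C. \<forall>t'\<in>C. t \<noteq> t' \<longrightarrow> Q t \<inter> Q t' = {}"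
    proof (intro ballI impI)
      fix t t' assume t: "t \<in> C" "t' \<in> C" "t \<noteq> t'"
      obtain x c h where xch: "t = (x, c, h)"
        by (cases t)
      obtain x' c' h' where xch': "t' = (x', c', h')"
        by (cases t')
      have "open_cell (shape x) c h \<inter> open_cell (shape x') c' h' = {}"
        using disj t xch xch' by blast
      moreover have "open_cell (shape x) c h \<subseteq> U" "open_cell (shape x') c' h' \<subseteq> U"
        using C(2) t xch xch' open_cell_subset by blast+
      ultimately have "G ` open_cell (shape x) c h \<inter> G ` open_cell (shape x') c' h' = {}"
        using inj_on_image_Int[OF inj_on_G] by (metis image_empty)
      then show "Q t \<inter> Q t' = {}"
        by (auto simp: Q_def xch xch')
    qed
  qed
  also have "\<dots> \<le> card (fst ` S)"
    using S by (intro card_mono) (auto simp: Q_def)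
  also have "\<dots> \<le> card S"
    using S by (rule card_image_le)
  finally show "(\<Sum>t\<in>C. card (P t)) \<le> card S" .
qed

section \<open>Tangents as competitors, and the lower bound for a tiling\<close>

definition tangents :: "(real^'n) set \<Rightarrow> ((real^'n) \<times> real) set" where
  "tangents X = (\<lambda>x. (G x, u x - G x \<bullet> x)) ` X"

lemma tangents_le:
  assumes "finite X" "X \<noteq> {}" "X \<subseteq> U" "y \<in> D"
  shows "affmax (tangents X) y \<le> u y"
proof -
  have "finite (tangents X)" "tangents X \<noteq> {}"
    using assms by (auto simp: tangents_def)
  then obtain a b where ab: "(a, b) \<in> tangents X" "affmax (tangents X) y = a \<bullet> y + b"
    using affmax_attained by blast
  then obtain x where x: "x \<in> X" "a = G x" "b = u x - G x \<bullet> x"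
    by (auto simp: tangents_def)
  then show ?thesis
    using tangent_le[of x y] assms ab(2) by (auto simp: inner_diff_right)
qed

lemma tangents_error_le:
  assumes "finite X" "x \<in> X"
  shows "u y - affmax (tangents X) y \<le> u y - (u x + G x \<bullet> (y - x))"
proof -
  have "(G x, u x - G x \<bullet> x) \<in> tangents X" "finite (tangents X)"
    using assms by (auto simp: tangents_def)
  then have "G x \<bullet> y + (u x - G x \<bullet> x) \<le> affmax (tangents X) y"
    by (intro affmax_ge)
  then show ?thesis
    by (simp add: inner_diff_right)
qed

lemma tangents_in_Pc:
  assumes "finite X" "X \<noteq> {}" "X \<subseteq> U" "card X \<le> m"
  shows "affmax (tangents X) \<in> Pc m D u"
proof -
  have "card (tangents X) \<le> m"
    using card_image_le[OF assms(1)] assms(4) unfolding tangents_def by (rule order_trans)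
  then show ?thesis
    using assms tangents_le[OF assms(1-3)] unfolding Pc_def
    by (intro CollectI exI[of _ "tangents X"]) (auto simp: tangents_def)
qed

text \<open>Without integrability the integral has the default value 0, so the infimum in
  \<open>tri_p\<close> is over a set bounded below in any case.\<close>

lemma error_integral_nonneg:
  assumes "l \<in> Pc m D u"
  shows "0 \<le> integral D (\<lambda>x. (u x - l x) powr p)"
  by (cases "(\<lambda>x. (u x - l x) powr p) integrable_on D") (auto intro: integral_nonneg simp: not_integrable_integral)

lemma tri_p_le:
  assumes "finite X" "X \<noteq> {}" "X \<subseteq> U" "card X \<le> m"
  shows "tri_p p D u m \<le> integral U (\<lambda>y. (u y - affmax (tangents X) y) powr p)"
proof -
  have "bdd_below ((\<lambda>l. integral D (\<lambda>x. (u x - l x) powr p)) ` Pc m D u)"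
    using error_integral_nonneg by (intro bdd_belowI2[of _ 0]) blast
  then show ?thesis
    unfolding tri_p_def integral_D[symmetric] by (intro cInf_lower imageI tangents_in_Pc assms)
qed

text \<open>The number \<open>N\<close> counts the net points that are granted to all cells on top
  of the slopes of the competitor. It depends on the tiling and on \<open>\<epsilon>\<close> but not
  on \<open>m\<close>, so it disappears in the limit.\<close>

lemma tri_p_lower:
  fixes p :: real
  assumes C: "tiling (p / (CARD('n) + 2 * p)) \<epsilon> C" and \<epsilon>: "0 < \<epsilon>" "\<epsilon> < 1" and U: "U \<noteq> {}"
    and p: "p > 0" and \<delta>: "\<delta> > 0"
      "\<And>S :: (real^'n) set. finite S \<Longrightarrow> S \<noteq> {} \<Longrightarrow> \<delta> * real (card S) powr (- (2 * p / CARD('n))) \<le> quant_err p S"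
  obtains N where "N \<ge> 0" "\<And>m. m \<ge> 1 \<Longrightarrow> ((1 - \<epsilon>) / 2) powr p * (1 - \<epsilon>) ^ CARD('n) * (1 - \<epsilon>) powr (2 * p) * \<delta> *
      ((\<Sum>t\<in>C. weight (p / (CARD('n) + 2 * p)) t) powr (1 + 2 * p / CARD('n)) * (real m + N) powr (- (2 * p / CARD('n))))
    \<le> tri_p p D u m"
proof -
  let ?n = "real CARD('n)"
  define a where "a = 2 * p / ?n"
  define s where "s = p / (?n + 2 * p)"
  \<comment> \<open>The shrinking factor is tied to \<open>\<epsilon>\<close>, so that a single
    limit removes all losses.\<close>
  define \<theta> where "\<theta> = 1 - \<epsilon>"
  have \<theta>: "0 < \<theta>" "\<theta> < 1"
    using \<epsilon> by (auto simp: \<theta>_def)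
  have a: "a > 0"
    using p by (simp add: a_def)
  have finC: "finite C"
    using C by (simp add: tiling_def)
  have Cc: "x \<in> U" "h > 0" "cell (shape x) c h \<subseteq> U" "near_quadratic \<epsilon> x (cell (shape x) c h)" if "(x, c, h) \<in> C" for x c h
    using C that unfolding tiling_def by blast+
  have disj: "open_cell (shape x) c h \<inter> open_cell (shape x') c' h' = {}"
    if "(x, c, h) \<in> C" "(x', c', h') \<in> C" "(x, c, h) \<noteq> (x', c', h')" for x c h x' c' h'
    using C that unfolding tiling_def by blast
  obtain N :: "(real^'n) set" where N: "finite N" "N \<noteq> {}" "\<And>y. y \<in> ucube \<Longrightarrow> infdist y N \<le> (1 - \<theta>) / 2"
    using finite_net_ucube[of "(1 - \<theta>) / 2"] \<theta> by (metis diff_gt_0_iff_gt half_gt_zero)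
  define k0 where "k0 = ((1 - \<epsilon>) / 2) powr p * \<theta> ^ CARD('n) * \<theta> powr (2 * p) * \<delta>"
  have k0: "k0 \<ge> 0"
    using \<theta> \<delta> by (simp add: k0_def)
  define N0 where "N0 = real (card C) * real (card N)"
  have main: "k0 * ((\<Sum>t\<in>C. weight s t) powr (1 + a) * (real m + N0) powr (- a)) \<le> integral D (\<lambda>z. (u z - l z) powr p)"
    if m: "m \<ge> 1" and l: "l \<in> Pc m D u" for m l
  proof (cases "C = {}")
    case True
    then show ?thesis
      using error_integral_nonneg[OF l] by simp
  next
    case Cne: False
    obtain S where S: "l = affmax S" "finite S" "S \<noteq> {}" "card S \<le> m" "\<forall>x\<in>D. affmax S x \<le> u x"
      using l unfolding Pc_def by blast
    have Su: "affmax S x \<le> u x" if "x \<in> U" for x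
      using S(5) that interior_subset[of D] by blast
    define F where "F = (\<lambda>z. (u z - affmax S z) powr p)"
    define P where "P = (\<lambda>(x, c, h). {y \<in> open_ucube. G (c + (h *\<^sub>R shape x) *v y) \<in> fst ` S})"
    \<comment> \<open>The net keeps \<open>k t\<close> positive even for a cell that meets none of
      the slopes, as the negative powers in Hoelder's inequality demand.\<close>
    define k where "k = (\<lambda>t. real (card (P t)) + real (card N))"
    define T' where "T' = (\<lambda>(x, c, h). cell (shape x) c (\<theta> * h))"
    note slopes = card_slopes_le[OF C S(2) P_def]
    have T': "T' t \<subseteq> U" "F integrable_on T' t" if t: "t \<in> C" for t
    proof -
      obtain x c h where xch: "t = (x, c, h)"
        by (cases t)
      show sub: "T' t \<subseteq> U"
        using cell_shrink_subset[OF \<theta>, of "shape x" c h] open_cell_subset[of "shape x" c h] Cc(3)[of x c h] t xch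
        by (auto simp: T'_def)
      show "F integrable_on T' t"
        unfolding F_def
        by (rule error_integrable) (use p S(2,3) Su sub in \<open>auto simp: T'_def xch lmeasurable_cell\<close>)
    qed
    have cell_ge: "k0 * (weight s t powr (1 + a) * k t powr (- a)) \<le> integral (T' t) F" if t: "t \<in> C" for t
    proof -
      obtain x c h where xch: "t = (x, c, h)"
        by (cases t)
      have tC: "(x, c, h) \<in> C"
        using t xch by simp
      have Peq: "P t = {y \<in> open_ucube. G (c + (h *\<^sub>R shape x) *v y) \<in> fst ` S}"
        by (simp add: P_def xch)
      show ?thesis
        using cell_integral_ge[OF Cc[OF tC] \<epsilon> \<theta> S(2,3) Su N Peq slopes(1)[OF t] p \<delta>]
        unfolding k0_def k_def F_def T'_def xch prod.case s_def a_def .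
    qed
    have cardN: "card N > 0"
      using N by (simp add: card_gt_0_iff)
    have kpos: "k t > 0" for t
      using cardN by (simp add: k_def add_nonneg_pos)
    have ksum: "(\<Sum>t\<in>C. k t) \<le> real m + N0"
    proof -
      have "(\<Sum>t\<in>C. k t) = real (\<Sum>t\<in>C. card (P t)) + N0"
        by (simp add: k_def sum.distrib N0_def)
      then show ?thesis
        using slopes(2) S(4) by linarith
    qed
    have wpos: "weight s t > 0" if "t \<in> C" for t
      using that weight_pos Cc by (cases t) blast
    have "(\<Sum>t\<in>C. weight s t) powr (1 + a) * (real m + N0) powr (- a) \<le> (\<Sum>t\<in>C. weight s t) powr (1 + a) * (\<Sum>t\<in>C. k t) powr (- a)"
      using ksum a kpos Cne finC by (intro mult_left_mono powr_mono2' sum_pos) auto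
    also have "\<dots> \<le> (\<Sum>t\<in>C. weight s t powr (1 + a) * k t powr (- a))"
      using wpos kpos by (intro sum_powr_Holder finC a)
    finally have "k0 * ((\<Sum>t\<in>C. weight s t) powr (1 + a) * (real m + N0) powr (- a))
        \<le> k0 * (\<Sum>t\<in>C. weight s t powr (1 + a) * k t powr (- a))"
      using k0 by (intro mult_left_mono)
    also have "\<dots> = (\<Sum>t\<in>C. k0 * (weight s t powr (1 + a) * k t powr (- a)))"
      by (rule sum_distrib_left)
    also have "\<dots> \<le> (\<Sum>t\<in>C. integral (T' t) F)"
      by (intro sum_mono cell_ge)
    also have "\<dots> \<le> integral U F"
    proof (rule integral_ge_sum_disjoint[OF finC T'(1) _ T'(2)])
      show "F integrable_on U"
        unfolding F_def by (rule error_integrable) (use p S(2,3) Su U_lmeasurable in auto)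
      show "T' i \<inter> T' j = {}" if ij: "i \<in> C" "j \<in> C" "i \<noteq> j" for i j
      proof -
        obtain x c h where i: "i = (x, c, h)"
          by (cases i)
        obtain x' c' h' where j: "j = (x', c', h')"
          by (cases j)
        show ?thesis
          using disj[of x c h x' c' h'] ij cell_shrink_subset[OF \<theta>, of "shape x" c h] cell_shrink_subset[OF \<theta>, of "shape x'" c' h']
          unfolding i j T'_def prod.case by blast
      qed
    qed (auto simp: F_def)
    finally show ?thesis
      by (simp add: F_def S(1) integral_D)
  qed
  obtain x0 where x0: "x0 \<in> U"
    using U by blast
  show thesis
  proof (rule that[of N0])
    show "N0 \<ge> 0"
      by (simp add: N0_def)
    fix m :: nat assume m: "m \<ge> 1"
    \<comment> \<open>A single tangent shows that the infimum is taken over a nonempty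
      class.\<close>
    have "affmax (tangents {x0}) \<in> Pc m D u"
      using x0 m by (intro tangents_in_Pc) auto
    then have "k0 * ((\<Sum>t\<in>C. weight s t) powr (1 + a) * (real m + N0) powr (- a)) \<le> tri_p p D u m"
      unfolding tri_p_def using main[OF m] by (intro cInf_greatest) auto
    then show "((1 - \<epsilon>) / 2) powr p * (1 - \<epsilon>) ^ CARD('n) * (1 - \<epsilon>) powr (2 * p) * \<delta> *
      ((\<Sum>t\<in>C. weight (p / (CARD('n) + 2 * p)) t) powr (1 + 2 * p / CARD('n)) * (real m + N0) powr (- (2 * p / CARD('n))))
      \<le> tri_p p D u m"
      by (simp add: k0_def \<theta>_def s_def a_def)
  qed
qed

end

section \<open>Integrability of the determinant\<close>

lemma integrable_on_compact_continuous:
  fixes f :: "'a::euclidean_space \<Rightarrow> real"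
  assumes "compact K" "continuous_on K f"
  shows "f integrable_on K"
  using borel_integrable_compact[OF assms, folded set_integrable_def] set_borel_integral_eq_integral(1) by blast

lemma integral_const_lmeasurable:
  assumes "T \<in> lmeasurable"
  shows "integral T (\<lambda>_. c :: real) = c * measure lebesgue T"
  using lmeasure_integral[OF assms] integral_mult_right[of T c "\<lambda>_. 1::real"] by simp

lemma integral_le_split:
  fixes f :: "'a::euclidean_space \<Rightarrow> real"
  assumes "S \<subseteq> A \<union> B" "f integrable_on S" "f integrable_on A" "f integrable_on B"
    and "\<And>x. x \<in> A \<union> B \<Longrightarrow> 0 \<le> f x"
  shows "integral S f \<le> integral A f + integral B f"
proof -
  have "integral S f \<le> (\<Sum>i\<in>{True, False}. integral (if i then A else B) f)"
    using assms by (intro integral_le_sum_cover) (auto split: if_splits)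
  then show ?thesis by simp
qed

context C2_convex
begin

section \<open>Weights of a tiling against integrals\<close>

definition tile :: "(real^'n) \<times> (real^'n) \<times> real \<Rightarrow> (real^'n) set" where
  "tile = (\<lambda>(x, c, h). cell (shape x) c h)"

lemma tile_lmeasurable: "tile t \<in> lmeasurable"
  by (cases t) (simp add: tile_def lmeasurable_cell)

lemma compact_tile: "compact (tile t)"
  by (cases t) (simp add: tile_def compact_cell)

lemma tiling_finite: "tiling s \<epsilon> C \<Longrightarrow> finite C"
  by (simp add: tiling_def)

lemma tiling_subset: "tiling s \<epsilon> C \<Longrightarrow> t \<in> C \<Longrightarrow> tile t \<subseteq> U"
  unfolding tiling_def by (cases t) (auto simp: tile_def)

lemma tiling_rest: "tiling s \<epsilon> C \<Longrightarrow> measure lebesgue (U - (\<Union>t\<in>C. tile t)) < \<epsilon>"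
  by (simp add: tiling_def tile_def)

lemma tiling_weight_pos: "tiling s \<epsilon> C \<Longrightarrow> t \<in> C \<Longrightarrow> weight s t > 0"
  unfolding tiling_def by (cases t) (auto intro: weight_pos)

lemma tiling_mono:
  assumes "tiling s \<epsilon> C" "\<epsilon> \<le> \<epsilon>'"
  shows "tiling s \<epsilon>' C"
proof -
  have "near_quadratic \<epsilon>' x T" if nq: "near_quadratic \<epsilon> x T" and x: "x \<in> U" for x T
    unfolding near_quadratic_def
  proof (intro ballI allI)
    fix y v assume y: "y \<in> T"
    have q: "0 \<le> v \<bullet> (H x *v v)"
      using H_pos[OF x, of v] by (cases "v = 0") auto
    have "(1 - \<epsilon>') * (v \<bullet> (H x *v v)) \<le> (1 - \<epsilon>) * (v \<bullet> (H x *v v))"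
      "(1 + \<epsilon>) * (v \<bullet> (H x *v v)) \<le> (1 + \<epsilon>') * (v \<bullet> (H x *v v))"
      using assms(2) q by (auto intro: mult_right_mono)
    moreover have "(1 - \<epsilon>) * (v \<bullet> (H x *v v)) \<le> v \<bullet> (H y *v v)" "v \<bullet> (H y *v v) \<le> (1 + \<epsilon>) * (v \<bullet> (H x *v v))"
      using nq y unfolding near_quadratic_def by blast+
    ultimately show "(1 - \<epsilon>') * (v \<bullet> (H x *v v)) \<le> v \<bullet> (H y *v v) \<and> v \<bullet> (H y *v v) \<le> (1 + \<epsilon>') * (v \<bullet> (H x *v v))"
      by linarith
  qed
  then show ?thesis
    using assms unfolding tiling_def by (meson order_trans less_le_trans)
qed

lemma tiling_overlap:
  assumes C: "tiling s \<epsilon> C" and t: "t \<in> C" "t' \<in> C" "t \<noteq> t'"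
  shows "negligible (tile t \<inter> tile t')"
proof -
  obtain x c h where x: "t = (x, c, h)"
    by (cases t)
  obtain x' c' h' where x': "t' = (x', c', h')"
    by (cases t')
  have "open_cell (shape x) c h \<inter> open_cell (shape x') c' h' = {}"
    using C t unfolding tiling_def x x' by blast
  then have "tile t \<inter> tile t' \<subseteq> (cell (shape x) c h - open_cell (shape x) c h) \<union> (cell (shape x') c' h' - open_cell (shape x') c' h')"
    by (auto simp: tile_def x x')
  then show ?thesis
    by (rule negligible_subset[OF negligible_Un[OF negligible_cell_diff negligible_cell_diff]])
qed

lemma tiling_Union_lmeasurable: "tiling s \<epsilon> C \<Longrightarrow> (\<Union>t\<in>C. tile t) \<in> lmeasurable"
  by (intro fmeasurable.finite_UN tile_lmeasurable) (simp add: tiling_finite)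

lemma tiling_measure_sum:
  assumes "tiling s \<epsilon> C"
  shows "(\<Sum>t\<in>C. measure lebesgue (tile t)) \<le> measure lebesgue U"
proof -
  have "(\<Sum>t\<in>C. measure lebesgue (tile t)) = measure lebesgue (\<Union>t\<in>C. tile t)"
    using tiling_overlap[OF assms] tile_lmeasurable
    by (intro measure_negligible_finite_Union_image[symmetric] tiling_finite[OF assms]) (auto simp: pairwise_def)
  also have "\<dots> \<le> measure lebesgue U"
    using tiling_subset[OF assms] tiling_Union_lmeasurable[OF assms] U_lmeasurable
    by (intro measure_mono_fmeasurable) (auto intro: fmeasurableD)
  finally show ?thesis .
qed

lemma tiling_sum_near_integral:
  assumes C: "tiling s \<epsilon> C" and "\<epsilon> > 0"
  shows "(\<lambda>y. det (H y) powr s) integrable_on (\<Union>t\<in>C. tile t)"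
    and "\<bar>integral (\<Union>t\<in>C. tile t) (\<lambda>y. det (H y) powr s) - (\<Sum>t\<in>C. weight s t)\<bar> \<le> \<epsilon> * measure lebesgue U"
proof -
  let ?f = "\<lambda>y. det (H y) powr s"
  have int: "?f integrable_on tile t" if "t \<in> C" for t
    using continuous_on_subset[OF continuous_on_det_H tiling_subset[OF C that]] compact_tile
    by (intro integrable_on_compact_continuous) auto
  have hi: "(?f has_integral (\<Sum>t\<in>C. integral (tile t) ?f)) (\<Union>t\<in>C. tile t)"
    using tiling_overlap[OF C] int
    by (intro has_integral_UN tiling_finite[OF C]) (auto simp: pairwise_def integrable_integral)
  then show "?f integrable_on (\<Union>t\<in>C. tile t)"
    by (rule has_integral_integrable)
  have each: "\<bar>integral (tile t) ?f - weight s t\<bar> \<le> \<epsilon> * measure lebesgue (tile t)" if t: "t \<in> C" for t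
  proof -
    obtain x c h where x: "t = (x, c, h)"
      by (cases t)
    define d where "d = det (H x) powr s"
    have close: "\<bar>?f y - d\<bar> \<le> \<epsilon>" if "y \<in> tile t" for y
      using C t that unfolding tiling_def x tile_def d_def by blast
    have "integral (tile t) ?f \<le> integral (tile t) (\<lambda>_. d + \<epsilon>)"
      using close by (intro integral_le int t integrable_on_const tile_lmeasurable) (smt (verit))
    moreover have "integral (tile t) (\<lambda>_. d - \<epsilon>) \<le> integral (tile t) ?f"
      using close by (intro integral_le int t integrable_on_const tile_lmeasurable) (smt (verit))
    moreover have "weight s t = measure lebesgue (tile t) * d"
      by (simp add: weight_def tile_def x d_def)
    ultimately show ?thesis
      by (simp add: integral_const_lmeasurable tile_lmeasurable algebra_simps abs_le_iff)
  qed
  have "integral (\<Union>t\<in>C. tile t) ?f - (\<Sum>t\<in>C. weight s t) = (\<Sum>t\<in>C. integral (tile t) ?f - weight s t)"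
    using integral_unique[OF hi] by (simp add: sum_subtractf)
  also have "\<bar>\<dots>\<bar> \<le> (\<Sum>t\<in>C. \<epsilon> * measure lebesgue (tile t))"
    by (intro order_trans[OF sum_abs] sum_mono each)
  also have "\<dots> \<le> \<epsilon> * measure lebesgue U"
    using tiling_measure_sum[OF C] \<open>\<epsilon> > 0\<close> by (simp flip: sum_distrib_left)
  finally show "\<bar>integral (\<Union>t\<in>C. tile t) ?f - (\<Sum>t\<in>C. weight s t)\<bar> \<le> \<epsilon> * measure lebesgue U" .
qed

text \<open>As long as integrability over \<open>U\<close> is unknown, weights can be compared with
  integrals over compact sets: there the integrand is bounded by \<open>M\<close>, and the part
  missed by the tiles costs at most \<open>M * \<epsilon>\<close>.\<close>

lemma compact_integral_le_weights:
  assumes C: "tiling s \<epsilon> C" and "\<epsilon> > 0" and Y: "compact Y" "Y \<subseteq> U"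
    and M: "M \<ge> 0" "\<And>y. y \<in> Y \<Longrightarrow> det (H y) powr s \<le> M"
  shows "integral Y (\<lambda>y. det (H y) powr s) \<le> (\<Sum>t\<in>C. weight s t) + \<epsilon> * (measure lebesgue U + M)"
proof -
  let ?f = "\<lambda>y. det (H y) powr s"
  let ?V = "\<Union>t\<in>C. tile t"
  have Vm: "?V \<in> lmeasurable"
    by (rule tiling_Union_lmeasurable[OF C])
  have KV: "Y - ?V \<in> lmeasurable"
    using Y(1) Vm by (intro fmeasurable.Diff) (auto simp: lmeasurable_compact intro: fmeasurableD)
  have contK: "continuous_on Y ?f"
    by (rule continuous_on_subset[OF continuous_on_det_H Y(2)])
  have intKV: "?f integrable_on (Y - ?V)"
    using M(2) continuous_on_subset[OF contK, of "Y - ?V"]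
    by (intro integrable_continuous_bounded[OF KV, of _ M]) auto
  have "integral Y ?f \<le> integral ?V ?f + integral (Y - ?V) ?f"
    using tiling_sum_near_integral(1)[OF C \<open>\<epsilon> > 0\<close>] intKV
    by (intro integral_le_split integrable_on_compact_continuous[OF Y(1) contK]) auto
  also have "integral (Y - ?V) ?f \<le> integral (Y - ?V) (\<lambda>_. M)"
    using M(2) by (intro integral_le intKV integrable_on_const KV) auto
  also have "\<dots> = M * measure lebesgue (Y - ?V)"
    by (rule integral_const_lmeasurable[OF KV])
  also have "measure lebesgue (Y - ?V) \<le> measure lebesgue (U - ?V)"
    using Y KV Vm U_lmeasurable
    by (intro measure_mono_fmeasurable fmeasurable.Diff) (auto intro: fmeasurableD)
  also have "\<dots> \<le> \<epsilon>"
    using tiling_rest[OF C] by simp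
  finally have "integral Y ?f \<le> integral ?V ?f + M * \<epsilon>"
    using M(1) by (simp add: mult_left_mono)
  then show ?thesis
    using tiling_sum_near_integral(2)[OF C \<open>\<epsilon> > 0\<close>] by (simp add: algebra_simps abs_le_iff)
qed

lemma tangent_rateE:
  assumes "tangent_rate C" "k \<ge> 1"
  obtains X where "finite X" "X \<noteq> {}" "X \<subseteq> U" "card X \<le> k"
    "\<forall>y\<in>U. \<exists>x\<in>X. u y - (u x + G x \<bullet> (y - x)) \<le> C * real k powr (- (2 / CARD('n)))"
proof -
  have "\<exists>X. finite X \<and> X \<noteq> {} \<and> X \<subseteq> U \<and> card X \<le> k \<and>
      (\<forall>y\<in>U. \<exists>x\<in>X. u y - (u x + G x \<bullet> (y - x)) \<le> C * real k powr (- (2 / CARD('n))))"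
    using assms(1)[unfolded tangent_rate_def, rule_format, OF assms(2)] .
  then show thesis
    by (elim exE conjE) (rule that)
qed

text \<open>Gives the order in \<open>m\<close> that \<open>tri_p_lower\<close> gives from below;
  the comparison of the two bounds the weights.\<close>

lemma tri_p_crude_upper:
  fixes p :: real
  assumes p: "p > 0" and U: "U \<noteq> {}"
  obtains B where "\<And>m. m \<ge> 1 \<Longrightarrow> tri_p p D u m \<le> B * real m powr (- (2 * p / CARD('n)))"
proof -
  obtain C where C: "C > 0" "tangent_rate C"
    using tangent_rate_exists[OF U] by blast
  show thesis
  proof (rule that)
    fix m :: nat assume m: "m \<ge> 1"
    obtain X where X: "finite X" "X \<noteq> {}" "X \<subseteq> U" "card X \<le> m"
      "\<forall>y\<in>U. \<exists>x\<in>X. u y - (u x + G x \<bullet> (y - x)) \<le> C * real m powr (- (2 / CARD('n)))"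
      using C(2) m by (rule tangent_rateE)
    let ?F = "\<lambda>y. (u y - affmax (tangents X) y) powr p"
    have le: "affmax (tangents X) y \<le> u y" if "y \<in> U" for y
      using tangents_le[OF X(1-3)] that interior_subset[of D] by blast
    have fin: "finite (tangents X)" "tangents X \<noteq> {}"
      using X by (auto simp: tangents_def)
    have "tri_p p D u m \<le> integral U ?F"
      by (rule tri_p_le[OF X(1-4)])
    also have "\<dots> \<le> integral U (\<lambda>_. (C * real m powr (- (2 / CARD('n)))) powr p)"
    proof (rule integral_le)
      show "?F integrable_on U"
        by (rule error_integrable) (use p fin le U_lmeasurable in auto)
      show "(\<lambda>_. (C * real m powr (- (2 / CARD('n)))) powr p) integrable_on U"
        by (rule integrable_on_const[OF U_lmeasurable])
      fix y assume y: "y \<in> U"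
      obtain x where "x \<in> X" "u y - (u x + G x \<bullet> (y - x)) \<le> C * real m powr (- (2 / CARD('n)))"
        using X(5) y by blast
      then have "u y - affmax (tangents X) y \<le> C * real m powr (- (2 / CARD('n)))"
        using tangents_error_le[OF X(1), of x y] by linarith
      then show "?F y \<le> (C * real m powr (- (2 / CARD('n)))) powr p"
        using p le[OF y] by (intro powr_mono2) auto
    qed
    also have "\<dots> = C powr p * measure lebesgue U * real m powr (- (2 * p / CARD('n)))"
      by (simp add: integral_const_lmeasurable[OF U_lmeasurable] powr_mult powr_powr mult_ac)
    finally show "tri_p p D u m \<le> C powr p * measure lebesgue U * real m powr (- (2 * p / CARD('n)))" .
  qed
qed

text \<open>The upper and the lower bound for \<open>tri_p\<close> have the same order in
  \<open>m\<close>, so for one suitable \<open>m\<close> the powers of \<open>m\<close> cancel and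
  the sum of the weights is bounded by quantities that do not depend on the tiling.\<close>

lemma weights_bounded:
  fixes p :: real
  assumes p: "p > 0" and U: "U \<noteq> {}" and \<delta>: "\<delta> > 0"
      "\<And>S :: (real^'n) set. finite S \<Longrightarrow> S \<noteq> {} \<Longrightarrow> \<delta> * real (card S) powr (- (2 * p / CARD('n))) \<le> quant_err p S"
  obtains B where "\<And>C. tiling (p / (CARD('n) + 2 * p)) (1/2) C \<Longrightarrow> (\<Sum>t\<in>C. weight (p / (CARD('n) + 2 * p)) t) \<le> B"
proof -
  let ?n = "real CARD('n)"
  define a where "a = 2 * p / ?n"
  define s where "s = p / (?n + 2 * p)"
  have a: "a > 0"
    using p by (simp add: a_def)
  obtain B where B: "\<And>m. m \<ge> 1 \<Longrightarrow> tri_p p D u m \<le> B * real m powr (- a)"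
    using tri_p_crude_upper[OF p U] unfolding a_def by blast
  define k where "k = ((1 - 1/2) / 2) powr p * (1 - 1/2) ^ CARD('n) * (1 - 1/2) powr (2 * p) * \<delta>"
  have k: "k > 0"
    using \<delta> by (simp add: k_def)
  have bound: "(\<Sum>t\<in>C. weight s t) \<le> (B * 2 powr a / k) powr (1 / (1 + a))" if C: "tiling s (1/2) C" for C
  proof -
    let ?W = "\<Sum>t\<in>C. weight s t"
    have W: "?W \<ge> 0"
      using tiling_weight_pos[OF C] by (intro sum_nonneg) (auto intro: less_imp_le)
    obtain N where N: "N \<ge> 0" "\<And>m. m \<ge> 1 \<Longrightarrow> k * (?W powr (1 + a) * (real m + N) powr (- a)) \<le> tri_p p D u m"
      using tri_p_lower[OF C[unfolded s_def] _ _ U p \<delta>] unfolding k_def s_def a_def by auto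
    \<comment> \<open>With \<open>m\<close> at least \<open>N\<close> the shift by the net points
      costs no more than a factor 2 inside the power.\<close>
    define m where "m = nat \<lceil>N\<rceil> + 1"
    have m: "m \<ge> 1" "N \<le> real m"
      using N(1) by (auto simp: m_def) linarith
    have "(2 * real m) powr (- a) \<le> (real m + N) powr (- a)"
      using m N(1) a by (intro powr_mono2') auto
    then have "k * (?W powr (1 + a) * (2 * real m) powr (- a)) \<le> k * (?W powr (1 + a) * (real m + N) powr (- a))"
      using k by (intro mult_left_mono) auto
    also have "\<dots> \<le> B * real m powr (- a)"
      using N(2)[OF m(1)] B[OF m(1)] by linarith
    finally have "k * ?W powr (1 + a) * 2 powr (- a) * real m powr (- a) \<le> B * real m powr (- a)"
      by (simp add: powr_mult mult_ac)
    then have "k * ?W powr (1 + a) * 2 powr (- a) \<le> B"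
      using m(1) by simp
    then have "?W powr (1 + a) \<le> B * 2 powr a / k"
      using k by (simp add: powr_minus_divide field_simps)
    then have "(?W powr (1 + a)) powr (1 / (1 + a)) \<le> (B * 2 powr a / k) powr (1 / (1 + a))"
      using a by (intro powr_mono2) auto
    then show ?thesis
      using a W by (simp add: powr_powr)
  qed
  show thesis
    by (rule that[OF bound[unfolded s_def]])
qed

text \<open>On a compact set the integrand has a bound \<open>M\<close>; a tiling chosen fine enough
  for \<open>M\<close> brings the integral within 1 of a sum of weights, and these sums are bounded
  for all tilings of accuracy 1/2. Monotone convergence along a compact exhaustion then gives both
  claims.\<close>

lemma det_H_integrable:
  fixes p :: real
  assumes p: "p > 0" and U: "U \<noteq> {}" and \<delta>: "\<delta> > 0"
      "\<And>S :: (real^'n) set. finite S \<Longrightarrow> S \<noteq> {} \<Longrightarrow> \<delta> * real (card S) powr (- (2 * p / CARD('n))) \<le> quant_err p S"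
    and s: "s = p / (CARD('n) + 2 * p)"
  shows "(\<lambda>y. det (H y) powr s) integrable_on U"
    and "\<eta> > 0 \<Longrightarrow> \<exists>K. compact K \<and> K \<subseteq> U \<and> integral U (\<lambda>y. det (H y) powr s) - \<eta> < integral K (\<lambda>y. det (H y) powr s)"
proof -
  let ?f = "\<lambda>y. det (H y) powr s"
  obtain B where B: "\<And>C. tiling s (1/2) C \<Longrightarrow> (\<Sum>t\<in>C. weight s t) \<le> B"
    using weights_bounded[OF p U \<delta>] unfolding s by blast
  have bound: "integral K ?f \<le> B + 1" if K: "compact K" "K \<subseteq> U" for K
  proof -
    have "bounded (?f ` K)"
      by (intro compact_imp_bounded compact_continuous_image continuous_on_subset[OF continuous_on_det_H] K)
    then obtain M where M: "M > 0" "\<And>y. y \<in> K \<Longrightarrow> \<bar>?f y\<bar> \<le> M"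
      unfolding bounded_pos by auto
    define \<epsilon> where "\<epsilon> = min (1/2) (1 / (measure lebesgue U + M))"
    have UM: "measure lebesgue U + M > 0"
      using M(1) by (intro add_nonneg_pos) auto
    have \<epsilon>: "\<epsilon> > 0" "\<epsilon> \<le> 1/2"
      using UM by (auto simp: \<epsilon>_def)
    obtain C where C: "tiling s \<epsilon> C"
      using tiling_exists[OF \<epsilon>(1)] by blast
    have "integral K ?f \<le> (\<Sum>t\<in>C. weight s t) + \<epsilon> * (measure lebesgue U + M)"
      using M by (intro compact_integral_le_weights[OF C \<epsilon>(1) K]) auto
    also have "\<epsilon> * (measure lebesgue U + M) \<le> 1 / (measure lebesgue U + M) * (measure lebesgue U + M)"
      using UM by (intro mult_right_mono) (auto simp: \<epsilon>_def)
    also have "\<dots> = 1"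
      using UM by simp
    finally show ?thesis
      using B[OF tiling_mono[OF C \<epsilon>(2)]] by linarith
  qed
  obtain K where K: "\<And>n. compact (K n)" "\<And>n. K n \<subseteq> U" "\<And>n. K n \<subseteq> interior (K (Suc n))" "\<Union>(range K) = U"
    using open_Union_compact_subsets[OF open_interior[of D]] by metis
  define g where "g = (\<lambda>n x. if x \<in> K n then ?f x else 0)"
  have KSuc: "K n \<subseteq> K (Suc n)" for n
    using K(3)[of n] interior_subset by blast
  have Kmono: "K n \<subseteq> K m" if "n \<le> m" for n m
    using lift_Suc_mono_le[of K, OF KSuc that] .
  have intK: "?f integrable_on K n" for n
    by (intro integrable_on_compact_continuous K continuous_on_subset[OF continuous_on_det_H])
  have KU: "K n \<inter> U = K n" for n
    using K(2) by blast
  have gint: "integral U (g n) = integral (K n) ?f" for n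
    unfolding g_def by (simp only: Henstock_Kurzweil_Integration.integral_restrict_Int KU)
  have mc: "?f integrable_on U \<and> (\<lambda>n. integral U (g n)) \<longlonglongrightarrow> integral U ?f"
  proof (rule monotone_convergence_increasing)
    show "g n integrable_on U" for n
      unfolding g_def using intK[of n] by (simp only: integrable_restrict_Int KU)
    show "g n x \<le> g (Suc n) x" for n x
      using KSuc[of n] by (auto simp: g_def)
    show "(\<lambda>n. g n x) \<longlonglongrightarrow> ?f x" if x: "x \<in> U" for x
    proof -
      obtain n0 where "x \<in> K n0"
        using x K(4) by blast
      then have "g n x = ?f x" if "n \<ge> n0" for n
        using Kmono[OF that] by (auto simp: g_def)
      then have "\<forall>\<^sub>F n in sequentially. g n x = ?f x"
        unfolding eventually_sequentially by blast
      then show ?thesis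
        by (rule tendsto_eventually)
    qed
    show "bounded (range (\<lambda>n. integral U (g n)))"
      unfolding bounded_iff
    proof (intro exI ballI)
      fix y assume "y \<in> range (\<lambda>n. integral U (g n))"
      then obtain n where "y = integral (K n) ?f"
        by (auto simp: gint)
      moreover have "0 \<le> integral (K n) ?f"
        by (intro integral_nonneg intK) auto
      ultimately show "norm y \<le> B + 1"
        using bound[OF K(1,2), of n] by simp
    qed
  qed
  then show "?f integrable_on U"
    by blast
  assume "\<eta> > 0"
  then have "\<forall>\<^sub>F n in sequentially. integral U ?f - \<eta> < integral U (g n)"
    using mc by (intro order_tendstoD(1)[of _ "integral U ?f"]) auto
  then obtain n where "integral U ?f - \<eta> < integral (K n) ?f"
    unfolding gint eventually_sequentially by blast
  then show "\<exists>K. compact K \<and> K \<subseteq> U \<and> integral U ?f - \<eta> < integral K ?f"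
    using K(1,2) by blast
qed

end

section \<open>Upper bound\<close>

lemma nat_floor_ratio_tendsto:
  assumes "\<rho> > 0"
  shows "(\<lambda>m. real (nat \<lfloor>\<rho> * real m\<rfloor>) / real m) \<longlonglongrightarrow> \<rho>"
    and "filterlim (\<lambda>m. nat \<lfloor>\<rho> * real m\<rfloor>) sequentially sequentially"
proof -
  show "(\<lambda>m. real (nat \<lfloor>\<rho> * real m\<rfloor>) / real m) \<longlonglongrightarrow> \<rho>"
  proof (rule real_tendsto_sandwich)
    have "\<rho> * real m - 1 \<le> real (nat \<lfloor>\<rho> * real m\<rfloor>)" "real (nat \<lfloor>\<rho> * real m\<rfloor>) \<le> \<rho> * real m" for m
      using assms by (auto simp: of_nat_nat)
    then have "(\<rho> * real m - 1) / real m \<le> real (nat \<lfloor>\<rho> * real m\<rfloor>) / real m" "real (nat \<lfloor>\<rho> * real m\<rfloor>) / real m \<le> \<rho> * real m / real m" for m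
      by (intro divide_right_mono; simp)+
    then show "\<forall>\<^sub>F m in sequentially. (\<rho> * real m - 1) / real m \<le> real (nat \<lfloor>\<rho> * real m\<rfloor>) / real m"
      "\<forall>\<^sub>F m in sequentially. real (nat \<lfloor>\<rho> * real m\<rfloor>) / real m \<le> \<rho> * real m / real m"
      by (auto intro: always_eventually)
    show "(\<lambda>m. (\<rho> * real m - 1) / real m) \<longlonglongrightarrow> \<rho>" "(\<lambda>m. \<rho> * real m / real m) \<longlonglongrightarrow> \<rho>"
      by real_asymp+
  qed
  have "filterlim (\<lambda>m. \<rho> * real m) at_top sequentially"
    using assms by real_asymp
  then have "filterlim (\<lambda>m. \<lfloor>\<rho> * real m\<rfloor>) at_top sequentially"
    by (rule filterlim_compose[OF filterlim_floor_sequentially])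
  then show "filterlim (\<lambda>m. nat \<lfloor>\<rho> * real m\<rfloor>) sequentially sequentially"
    by (rule filterlim_compose[OF filterlim_nat_sequentially])
qed

lemma nat_floor_ratio_powr_tendsto:
  assumes "\<rho> > 0"
  shows "(\<lambda>m. real m powr a * real (nat \<lfloor>\<rho> * real m\<rfloor>) powr (- a)) \<longlonglongrightarrow> \<rho> powr (- a)"
proof (rule Lim_transform_eventually)
  show "(\<lambda>m. (real (nat \<lfloor>\<rho> * real m\<rfloor>) / real m) powr (- a)) \<longlonglongrightarrow> \<rho> powr (- a)"
    using assms by (intro tendsto_powr nat_floor_ratio_tendsto tendsto_const) auto
  show "\<forall>\<^sub>F m in sequentially. (real (nat \<lfloor>\<rho> * real m\<rfloor>) / real m) powr (- a) = real m powr a * real (nat \<lfloor>\<rho> * real m\<rfloor>) powr (- a)"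
    using eventually_gt_at_top[of 0] by eventually_elim (simp add: powr_divide powr_minus_divide)
qed

context C2_convex
begin

text \<open>At each point the tangent at the nearest transported point of \<open>S\<close> suffices.
  Since \<open>S\<close> lies in the cube, the joining segment stays in the cell, where Taylor's
  formula is controlled by \<open>H x\<close>.\<close>

lemma cell_integral_le:
  fixes p :: real and S :: "(real^'n) set"
  assumes x: "x \<in> U" and h: "h > 0" and T: "cell (shape x) c h \<subseteq> U" "near_quadratic \<eta> x (cell (shape x) c h)"
    and \<eta>: "\<eta> > 0" and p: "p > 0"
    and X: "finite X" "X \<noteq> {}" "X \<subseteq> U"
    and S: "finite S" "S \<noteq> {}" "S \<subseteq> ucube" "(\<lambda>y. c + (h *\<^sub>R shape x) *v y) ` S \<subseteq> X"
  shows "integral (cell (shape x) c h) (\<lambda>z. (u z - affmax (tangents X) z) powr p)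
    \<le> ((1 + \<eta>) / 2) powr p * (weight (p / (CARD('n) + 2 * p)) (x, c, h) powr (1 + 2 * p / CARD('n)) * quant_err p S)"
proof -
  define F where "F = (\<lambda>z. (u z - affmax (tangents X) z) powr p)"
  define g where "g = (\<lambda>y. c + (h *\<^sub>R shape x) *v y)"
  define T where "T = cell (shape x) c h"
  have Tg: "T = g ` ucube"
    by (simp add: T_def g_def cell_def)
  have TU: "T \<subseteq> U" and nq: "near_quadratic \<eta> x T"
    using T by (auto simp: T_def)
  have convT: "convex T"
    by (simp add: T_def convex_cell)
  have fin: "finite (tangents X)" "tangents X \<noteq> {}"
    using X by (auto simp: tangents_def)
  have le: "affmax (tangents X) y \<le> u y" if "y \<in> U" for y
    using tangents_le[OF X] that interior_subset[of D] by blast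
  have "continuous_on U F"
    unfolding F_def by (rule error_continuous) (use p fin le in auto)
  then have cF: "continuous_on T F"
    using TU continuous_on_subset by blast
  have contg: "continuous_on ucube g"
    unfolding g_def by (intro continuous_intros matrix_vector_mult_linear_continuous_on)
  have det: "\<bar>det (h *\<^sub>R shape x)\<bar> = h ^ CARD('n) * \<bar>det (shape x)\<bar>" "det (h *\<^sub>R shape x) \<noteq> 0"
    using h det_shape_nonzero[OF x] by (auto simp: det_scaleR_matrix abs_mult)
  define \<kappa> where "\<kappa> = ((1 + \<eta>) / 2) powr p * h powr (2 * p)"
  have pt: "F (g y) \<le> \<kappa> * infdist y S powr (2 * p)" if y: "y \<in> ucube" for y
  proof -
    obtain b where b: "b \<in> S" "infdist y S = dist y b"
      using infdist_attains_inf[OF finite_imp_closed S(2)] S(1) by blast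
    have gT: "g y \<in> T" "g b \<in> T"
      using y b S(3) by (auto simp: Tg)
    have gX: "g b \<in> X"
      using b S(4) by (auto simp: g_def)
    have "u (g y) - affmax (tangents X) (g y) \<le> u (g y) - (u (g b) + G (g b) \<bullet> (g y - g b))"
      by (rule tangents_error_le[OF X(1) gX])
    also have "\<dots> \<le> (1 + \<eta>) / 2 * ((g y - g b) \<bullet> (H x *v (g y - g b)))"
      using taylor_bounds(2)[OF x TU convT nq gT(2,1)] by linarith
    also have "(g y - g b) \<bullet> (H x *v (g y - g b)) = h\<^sup>2 * (dist y b)\<^sup>2"
      unfolding g_def by (rule shape_quadratic_form[OF x])
    also have "h\<^sup>2 * (dist y b)\<^sup>2 = (h * infdist y S)\<^sup>2"
      by (simp add: b(2) power_mult_distrib)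
    finally have "F (g y) \<le> ((1 + \<eta>) / 2 * (h * infdist y S)\<^sup>2) powr p"
      unfolding F_def using p le[of "g y"] gT(1) TU by (intro powr_mono2) auto
    also have "\<dots> = ((1 + \<eta>) / 2) powr p * ((h * infdist y S)\<^sup>2) powr p"
      by (rule powr_mult)
    also have "((h * infdist y S)\<^sup>2) powr p = h powr (2 * p) * infdist y S powr (2 * p)"
      using h by (simp add: power2_powr infdist_nonneg powr_mult)
    finally show ?thesis
      by (simp add: \<kappa>_def mult_ac)
  qed
  have "integral T F = \<bar>det (h *\<^sub>R shape x)\<bar> * integral ucube (\<lambda>y. F (g y))"
    unfolding Tg g_def using cF[unfolded Tg g_def] by (intro integral_affine_image det compact_ucube)
  also have "\<dots> \<le> \<bar>det (h *\<^sub>R shape x)\<bar> * integral ucube (\<lambda>y. \<kappa> * infdist y S powr (2 * p))"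
  proof (intro mult_left_mono integral_le pt)
    show "(\<lambda>y. F (g y)) integrable_on ucube"
      by (intro integrable_on_compact_continuous compact_ucube continuous_on_compose2[OF cF contg]) (simp add: Tg)
    show "(\<lambda>y. \<kappa> * infdist y S powr (2 * p)) integrable_on ucube"
      using integrable_infdist_powr[OF p compact_ucube, of S] by (rule integrable_on_mult_right)
  qed auto
  also have "\<dots> = h ^ CARD('n) * \<bar>det (shape x)\<bar> * (\<kappa> * quant_err p S)"
    by (simp add: det quant_err_def)
  also have "\<dots> = ((1 + \<eta>) / 2) powr p * (weight (p / (CARD('n) + 2 * p)) (x, c, h) powr (1 + 2 * p / CARD('n)) * quant_err p S)"
    unfolding weight_powr[OF x h p] \<kappa>_def by (simp add: mult_ac)
  finally show ?thesis
    by (simp add: F_def T_def)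
qed

text \<open>On a tile its own tangents give the sharp error. On the rest, of measure below
  \<open>\<eta>\<close>, the \<open>kb\<close> extra tangents give a uniform error. Joining all
  tangents can only improve both.\<close>

lemma tri_p_upper_step:
  fixes p :: real and Q :: "_ \<Rightarrow> (real^'n) set"
  assumes C: "tiling (p / (CARD('n) + 2 * p)) \<eta> C" and \<eta>: "\<eta> > 0" and p: "p > 0"
    and rate: "B > 0" "tangent_rate B" and kb: "kb \<ge> 1"
    and Q: "\<And>t. t \<in> C \<Longrightarrow> finite (Q t) \<and> Q t \<noteq> {} \<and> Q t \<subseteq> ucube \<and> card (Q t) \<le> k t \<and> quant_err p (Q t) \<le> q t"
    and m: "(\<Sum>t\<in>C. k t) + kb \<le> m"
  shows "tri_p p D u m \<le> (\<Sum>t\<in>C. ((1 + \<eta>) / 2) powr p * (weight (p / (CARD('n) + 2 * p)) t powr (1 + 2 * p / CARD('n)) * q t))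
     + \<eta> * (B powr p * real kb powr (- (2 * p / CARD('n))))"
proof -
  let ?n = "real CARD('n)"
  define s where "s = p / (?n + 2 * p)"
  have Cs: "tiling s \<eta> C"
    using C by (simp add: s_def)
  obtain Xb where Xb: "finite Xb" "Xb \<noteq> {}" "Xb \<subseteq> U" "card Xb \<le> kb"
    "\<forall>y\<in>U. \<exists>x\<in>Xb. u y - (u x + G x \<bullet> (y - x)) \<le> B * real kb powr (- (2 / ?n))"
    using rate(2) kb by (rule tangent_rateE)
  define g where "g = (\<lambda>(x, c, h) y. c + (h *\<^sub>R shape x) *v y)"
  have g_tile: "g t ` ucube = tile t" for t
    by (cases t) (simp add: g_def tile_def cell_def)
  define X where "X = (\<Union>t\<in>C. g t ` Q t) \<union> Xb"
  have finC: "finite C"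
    by (rule tiling_finite[OF Cs])
  have X: "finite X" "X \<noteq> {}"
    using finC Q Xb by (auto simp: X_def)
  have XU: "X \<subseteq> U"
  proof -
    have "g t ` Q t \<subseteq> U" if "t \<in> C" for t
      using Q[OF that] g_tile[of t] tiling_subset[OF Cs that] by blast
    then show ?thesis
      unfolding X_def using Xb(3) by (intro Un_least UN_least) auto
  qed
  have "card X \<le> card (\<Union>t\<in>C. g t ` Q t) + card Xb"
    unfolding X_def by (rule card_Un_le)
  also have "card (\<Union>t\<in>C. g t ` Q t) \<le> (\<Sum>t\<in>C. card (g t ` Q t))"
    by (rule card_UN_le[OF finC])
  also have "\<dots> \<le> (\<Sum>t\<in>C. k t)"
    using Q by (intro sum_mono) (meson card_image_le le_trans)
  finally have cardX: "card X \<le> m"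
    using Xb(4) m by linarith
  define F where "F = (\<lambda>z. (u z - affmax (tangents X) z) powr p)"
  have fin: "finite (tangents X)" "tangents X \<noteq> {}"
    using X by (auto simp: tangents_def)
  have le: "affmax (tangents X) y \<le> u y" if "y \<in> U" for y
    using tangents_le[OF X XU] that interior_subset[of D] by blast
  have intF: "F integrable_on Z" if "Z \<subseteq> U" "Z \<in> lmeasurable" for Z
    unfolding F_def by (rule error_integrable) (use p fin le that in auto)
  let ?V = "\<Union>t\<in>C. tile t"
  have V: "?V \<subseteq> U" "?V \<in> lmeasurable"
    using tiling_subset[OF Cs] tiling_Union_lmeasurable[OF Cs] by blast+
  have UV: "U - ?V \<in> lmeasurable"
    using U_lmeasurable V(2) by (intro fmeasurable.Diff) (auto intro: fmeasurableD)
  have tile_le: "integral (tile t) F \<le> ((1 + \<eta>) / 2) powr p * (weight s t powr (1 + 2 * p / ?n) * q t)" if t: "t \<in> C" for t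
  proof -
    obtain x c h where xch: "t = (x, c, h)"
      by (cases t)
    have x: "x \<in> U" "h > 0" "cell (shape x) c h \<subseteq> U" "near_quadratic \<eta> x (cell (shape x) c h)"
      using Cs t unfolding tiling_def xch by blast+
    have Qt: "finite (Q t)" "Q t \<noteq> {}" "Q t \<subseteq> ucube" "quant_err p (Q t) \<le> q t"
      using Q[OF t] by auto
    have "(\<lambda>y. c + (h *\<^sub>R shape x) *v y) ` Q t \<subseteq> X"
      using t unfolding X_def by (auto simp: g_def xch)
    from cell_integral_le[OF x \<eta> p X XU Qt(1-3) this]
    have "integral (tile t) F \<le> ((1 + \<eta>) / 2) powr p * (weight s t powr (1 + 2 * p / ?n) * quant_err p (Q t))"
      by (simp add: F_def tile_def xch s_def)
    also have "\<dots> \<le> ((1 + \<eta>) / 2) powr p * (weight s t powr (1 + 2 * p / ?n) * q t)"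
      using Qt(4) by (intro mult_left_mono) auto
    finally show ?thesis .
  qed
  have "tri_p p D u m \<le> integral U F"
    unfolding F_def by (rule tri_p_le[OF X XU cardX])
  also have "\<dots> \<le> integral ?V F + integral (U - ?V) F"
    by (intro integral_le_split intF V UV U_lmeasurable) (auto simp: F_def)
  also have "integral ?V F \<le> (\<Sum>t\<in>C. integral (tile t) F)"
    by (intro integral_le_sum_cover finC intF V tiling_subset[OF Cs] tile_lmeasurable) (auto simp: F_def)
  also have "\<dots> \<le> (\<Sum>t\<in>C. ((1 + \<eta>) / 2) powr p * (weight s t powr (1 + 2 * p / ?n) * q t))"
    by (intro sum_mono tile_le)
  also have "integral (U - ?V) F \<le> integral (U - ?V) (\<lambda>_. (B * real kb powr (- (2 / ?n))) powr p)"
  proof (intro integral_le intF UV integrable_on_const)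
    fix y assume y: "y \<in> U - ?V"
    obtain x where x: "x \<in> Xb" "u y - (u x + G x \<bullet> (y - x)) \<le> B * real kb powr (- (2 / ?n))"
      using Xb(5) y by blast
    then have "u y - affmax (tangents X) y \<le> B * real kb powr (- (2 / ?n))"
      using tangents_error_le[OF X(1), of x y] by (auto simp: X_def)
    then show "F y \<le> (B * real kb powr (- (2 / ?n))) powr p"
      unfolding F_def using p le[of y] y by (intro powr_mono2) auto
  qed auto
  also have "\<dots> = (B powr p * real kb powr (- (2 * p / ?n))) * measure lebesgue (U - ?V)"
    by (simp add: integral_const_lmeasurable[OF UV] powr_mult powr_powr mult_ac)
  also have "\<dots> \<le> (B powr p * real kb powr (- (2 * p / ?n))) * \<eta>"
    using tiling_rest[OF Cs] by (intro mult_left_mono) auto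
  finally show ?thesis
    by (simp add: s_def mult_ac)
qed

text \<open>Shares proportional to the weights are the equality case of
  \<open>sum_powr_Holder\<close>, so this bound matches the lower one. The share
  \<open>\<epsilon>\<close> goes to the rest and costs a negative power of
  \<open>\<epsilon>\<close>, which the factor \<open>\<eta>\<close> is later chosen to
  absorb.\<close>

lemma tri_p_upper:
  fixes p :: real
  assumes C: "tiling (p / (CARD('n) + 2 * p)) \<eta> C" and \<eta>: "\<eta> > 0" and p: "p > 0"
    and rate: "B > 0" "tangent_rate B" and \<epsilon>: "0 < \<epsilon>" "\<epsilon> < 1"
    and \<delta>: "\<forall>\<^sub>F k in sequentially. \<exists>S :: (real^'n) set. finite S \<and> S \<noteq> {} \<and> S \<subseteq> ucube \<and> card S \<le> k \<and>
       quant_err p S \<le> (\<delta> + \<epsilon>) * real k powr (- (2 * p / CARD('n)))"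
  shows "\<forall>\<^sub>F m in sequentially. real m powr (2 * p / CARD('n)) * tri_p p D u m \<le>
     ((1 + \<eta>) / 2) powr p * ((\<delta> + \<epsilon>) * (1 - \<epsilon>) powr (- (2 * p / CARD('n))) *
       (\<Sum>t\<in>C. weight (p / (CARD('n) + 2 * p)) t) powr (1 + 2 * p / CARD('n)))
     + \<eta> * (B powr p * \<epsilon> powr (- (2 * p / CARD('n)))) + \<epsilon>"
proof -
  let ?n = "real CARD('n)"
  define a where "a = 2 * p / ?n"
  define s where "s = p / (?n + 2 * p)"
  have Cs: "tiling s \<eta> C"
    using C by (simp add: s_def)
  have finC: "finite C"
    by (rule tiling_finite[OF Cs])
  define W where "W = (\<Sum>t\<in>C. weight s t)"
  have w: "weight s t > 0" if "t \<in> C" for t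
    by (rule tiling_weight_pos[OF Cs that])
  \<comment> \<open>Stated with a tile at hand, because a tiling may be empty when \<open>U\<close>
    has measure below \<open>\<eta>\<close>, and then \<open>W = 0\<close>.\<close>
  have W: "W > 0" if "t \<in> C" for t
    unfolding W_def using finC that w by (intro sum_pos) auto
  define \<rho> where "\<rho> = (\<lambda>t. (1 - \<epsilon>) * weight s t / W)"
  have \<rho>: "\<rho> t > 0" if "t \<in> C" for t
    using w[OF that] W[OF that] \<epsilon> by (simp add: \<rho>_def)
  define k where "k = (\<lambda>t m. nat \<lfloor>\<rho> t * real m\<rfloor>)"
  define kb where "kb = (\<lambda>m. nat \<lfloor>\<epsilon> * real m\<rfloor>)"
  define \<kappa> where "\<kappa> = ((1 + \<eta>) / 2) powr p"
  define R where "R = (\<lambda>m. (\<Sum>t\<in>C. \<kappa> * (weight s t powr (1 + a) * ((\<delta> + \<epsilon>) * (real m powr a * real (k t m) powr (- a)))))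
     + \<eta> * (B powr p * (real m powr a * real (kb m) powr (- a))))"
  define L where "L = (\<Sum>t\<in>C. \<kappa> * (weight s t powr (1 + a) * ((\<delta> + \<epsilon>) * \<rho> t powr (- a)))) + \<eta> * (B powr p * \<epsilon> powr (- a))"
  have "R \<longlonglongrightarrow> L"
    unfolding R_def L_def k_def kb_def
    by (intro tendsto_add tendsto_sum tendsto_mult tendsto_const nat_floor_ratio_powr_tendsto \<rho> \<epsilon>)
  then have ev1: "\<forall>\<^sub>F m in sequentially. R m < L + \<epsilon>"
    using \<epsilon> by (intro order_tendstoD) auto
  have "\<forall>t\<in>C. \<forall>\<^sub>F m in sequentially. \<exists>S :: (real^'n) set. finite S \<and> S \<noteq> {} \<and> S \<subseteq> ucube \<and> card S \<le> k t m \<and>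
       quant_err p S \<le> (\<delta> + \<epsilon>) * real (k t m) powr (- a)"
    unfolding k_def using eventually_compose_filterlim[OF \<delta>[folded a_def] nat_floor_ratio_tendsto(2)[OF \<rho>]] by blast
  then have ev2: "\<forall>\<^sub>F m in sequentially. \<forall>t\<in>C. \<exists>S :: (real^'n) set. finite S \<and> S \<noteq> {} \<and> S \<subseteq> ucube \<and> card S \<le> k t m \<and>
       quant_err p S \<le> (\<delta> + \<epsilon>) * real (k t m) powr (- a)"
    by (rule eventually_ball_finite[OF finC])
  have ev3: "\<forall>\<^sub>F m in sequentially. kb m \<ge> 1"
    unfolding kb_def by (rule eventually_compose_filterlim[OF eventually_ge_at_top nat_floor_ratio_tendsto(2)[OF \<epsilon>(1)]])
  have ksum: "(\<Sum>t\<in>C. k t m) + kb m \<le> m" for m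
  proof -
    have "real ((\<Sum>t\<in>C. k t m) + kb m) \<le> (\<Sum>t\<in>C. \<rho> t * real m) + \<epsilon> * real m"
      unfolding k_def kb_def of_nat_add of_nat_sum using \<epsilon>
      by (intro add_mono sum_mono of_nat_floor mult_nonneg_nonneg less_imp_le[OF \<rho>]) auto
    also have "\<dots> \<le> real m"
    proof (cases "C = {}")
      case True
      then show ?thesis
        using \<epsilon> by (simp add: mult_left_le_one_le)
    next
      case False
      then have "W > 0"
        using W by blast
      moreover have "(\<Sum>t\<in>C. \<rho> t * real m) = (1 - \<epsilon>) * W / W * real m"
        unfolding \<rho>_def W_def by (simp add: sum_distrib_right sum_distrib_left sum_divide_distrib)
      ultimately have "(\<Sum>t\<in>C. \<rho> t * real m) = (1 - \<epsilon>) * real m"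
        by simp
      then show ?thesis
        by (simp add: left_diff_distrib)
    qed
    finally show ?thesis
      by linarith
  qed
  have Leq: "L = \<kappa> * ((\<delta> + \<epsilon>) * (1 - \<epsilon>) powr (- a) * W powr (1 + a)) + \<eta> * (B powr p * \<epsilon> powr (- a))"
  proof -
    \<comment> \<open>With these shares the powers of a single weight cancel down to the first one,
      so the sum over the tiles closes up to \<open>W powr (1 + a)\<close>.\<close>
    have eq: "weight s t powr (1 + a) * ((\<delta> + \<epsilon>) * \<rho> t powr (- a)) = ((\<delta> + \<epsilon>) * (1 - \<epsilon>) powr (- a) * W powr a) * weight s t" if "t \<in> C" for t
    proof -
      have "\<rho> t powr (- a) = (1 - \<epsilon>) powr (- a) * weight s t powr (- a) * W powr a"
        unfolding \<rho>_def using \<epsilon> w[OF that] W[OF that] by (simp add: powr_mult powr_divide powr_minus_divide)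
      moreover have "weight s t powr (1 + a) * weight s t powr (- a) = weight s t"
        using w[OF that] by (simp flip: powr_add)
      ultimately show ?thesis
        by (simp add: mult_ac)
    qed
    have "(\<Sum>t\<in>C. \<kappa> * (weight s t powr (1 + a) * ((\<delta> + \<epsilon>) * \<rho> t powr (- a))))
        = (\<Sum>t\<in>C. \<kappa> * (((\<delta> + \<epsilon>) * (1 - \<epsilon>) powr (- a) * W powr a) * weight s t))"
      by (rule sum.cong[OF refl]) (simp only: eq)
    also have "\<dots> = \<kappa> * (((\<delta> + \<epsilon>) * (1 - \<epsilon>) powr (- a) * W powr a) * (\<Sum>t\<in>C. weight s t))"
      by (simp only: sum_distrib_left)
    also have "(\<Sum>t\<in>C. weight s t) = W"
      by (simp only: W_def)
    finally have "(\<Sum>t\<in>C. \<kappa> * (weight s t powr (1 + a) * ((\<delta> + \<epsilon>) * \<rho> t powr (- a))))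
        = \<kappa> * (((\<delta> + \<epsilon>) * (1 - \<epsilon>) powr (- a) * W powr a) * W)" .
    moreover have "W powr a * W = W powr (1 + a)"
    proof (cases "C = {}")
      case False
      then have "W > 0"
        using W by blast
      then show ?thesis
        by (simp add: powr_add)
    qed (simp add: W_def)
    ultimately show ?thesis
      by (simp add: L_def mult.assoc)
  qed
  show ?thesis
    using ev1 ev2 ev3 eventually_gt_at_top[of 0]
  proof eventually_elim
    case (elim m)
    from bchoice[OF elim(2)] obtain Q :: "_ \<Rightarrow> (real^'n) set" where Q: "\<forall>t\<in>C. finite (Q t) \<and> Q t \<noteq> {} \<and> Q t \<subseteq> ucube \<and> card (Q t) \<le> k t m \<and>
       quant_err p (Q t) \<le> (\<delta> + \<epsilon>) * real (k t m) powr (- a)" ..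
    have "tri_p p D u m \<le> (\<Sum>t\<in>C. \<kappa> * (weight s t powr (1 + a) * ((\<delta> + \<epsilon>) * real (k t m) powr (- a))))
       + \<eta> * (B powr p * real (kb m) powr (- a))"
      unfolding \<kappa>_def s_def a_def
      by (rule tri_p_upper_step[OF C \<eta> p rate elim(3) Q[rule_format, unfolded a_def] ksum])
    then have "real m powr a * tri_p p D u m \<le> real m powr a * ((\<Sum>t\<in>C. \<kappa> * (weight s t powr (1 + a) * ((\<delta> + \<epsilon>) * real (k t m) powr (- a))))
       + \<eta> * (B powr p * real (kb m) powr (- a)))"
      by (intro mult_left_mono) auto
    also have "\<dots> = R m"
      unfolding R_def distrib_left sum_distrib_left by (simp add: mult_ac)
    also have "\<dots> \<le> L + \<epsilon>"
      using elim(1) by simp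
    finally show ?case
      by (simp add: Leq \<kappa>_def W_def s_def a_def)
  qed
qed

end

section \<open>The limit\<close>

text \<open>The threshold in \<open>m\<close> depends on \<open>\<epsilon>\<close>; for each level
  off \<open>L\<close> one fixed \<open>\<epsilon>\<close> already gives the required bound.\<close>

lemma tendsto_squeeze_family:
  fixes f :: "nat \<Rightarrow> real" and \<phi> \<Phi> :: "real \<Rightarrow> real"
  assumes low: "\<And>\<epsilon>. 0 < \<epsilon> \<Longrightarrow> \<epsilon> < 1 \<Longrightarrow> \<forall>\<^sub>F m in sequentially. \<phi> \<epsilon> \<le> f m"
    and upp: "\<And>\<epsilon>. 0 < \<epsilon> \<Longrightarrow> \<epsilon> < 1 \<Longrightarrow> \<forall>\<^sub>F m in sequentially. f m \<le> \<Phi> \<epsilon>"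
    and lim: "(\<phi> \<longlongrightarrow> L) (at_right 0)" "(\<Phi> \<longlongrightarrow> L) (at_right 0)"
  shows "f \<longlonglongrightarrow> L"
proof (rule order_tendstoI)
  have small: "\<forall>\<^sub>F \<epsilon> in at_right (0::real). 0 < \<epsilon> \<and> \<epsilon> < 1"
    by (rule eventually_at_rightI[of 0 1]) auto
  show "\<forall>\<^sub>F m in sequentially. y < f m" if y: "y < L" for y
  proof -
    obtain \<epsilon> where \<epsilon>: "0 < \<epsilon>" "\<epsilon> < 1" "y < \<phi> \<epsilon>"
      using eventually_happens[OF eventually_conj[OF small order_tendstoD(1)[OF lim(1) y]]] by auto
    show ?thesis
      using low[OF \<epsilon>(1,2)] by eventually_elim (use \<epsilon>(3) in linarith)
  qed
  show "\<forall>\<^sub>F m in sequentially. f m < y" if y: "L < y" for y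
  proof -
    obtain \<epsilon> where \<epsilon>: "0 < \<epsilon>" "\<epsilon> < 1" "\<Phi> \<epsilon> < y"
      using eventually_happens[OF eventually_conj[OF small order_tendstoD(2)[OF lim(2) y]]] by auto
    show ?thesis
      using upp[OF \<epsilon>(1,2)] by eventually_elim (use \<epsilon>(3) in linarith)
  qed
qed

context C2_convex
begin

lemma tri_p_limit:
  fixes p :: real
  assumes p: "p > 0" and U: "U \<noteq> {}" and \<delta>: "\<delta> > 0"
      "\<And>S :: (real^'n) set. finite S \<Longrightarrow> S \<noteq> {} \<Longrightarrow> \<delta> * real (card S) powr (- (2 * p / CARD('n))) \<le> quant_err p S"
      "\<And>\<epsilon>. \<epsilon> > 0 \<Longrightarrow> \<forall>\<^sub>F k in sequentially. \<exists>S :: (real^'n) set. finite S \<and> S \<noteq> {} \<and> S \<subseteq> ucube \<and> card S \<le> k \<and>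
         quant_err p S \<le> (\<delta> + \<epsilon>) * real k powr (- (2 * p / CARD('n)))"
  shows "(\<lambda>m. real m powr (2 * p / CARD('n)) * tri_p p D u m) \<longlonglongrightarrow>
     \<delta> / 2 powr p * integral U (\<lambda>x. det (H x) powr (p / (CARD('n) + 2 * p))) powr (1 + 2 * p / CARD('n))"
proof -
  let ?n = "real CARD('n)"
  define a where "a = 2 * p / ?n"
  define s where "s = p / (?n + 2 * p)"
  define f where "f = (\<lambda>y. det (H y) powr s)"
  define I where "I = integral U f"
  define \<mu> where "\<mu> = measure lebesgue U"
  have a: "a > 0"
    using p by (simp add: a_def)
  have \<mu>: "\<mu> \<ge> 0"
    by (simp add: \<mu>_def)
  have fint: "f integrable_on U"
    unfolding f_def by (rule det_H_integrable(1)[OF p U \<delta>(1,2) s_def])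
  have I: "I \<ge> 0"
    unfolding I_def using fint by (intro integral_nonneg) (auto simp: f_def)
  obtain B where B: "B > 0" "tangent_rate B"
    using tangent_rate_exists[OF U] by blast
  \<comment> \<open>The maximum with 0 keeps the base nonnegative, where \<open>powr\<close> is
    monotone; the last factor \<open>1 - \<epsilon>\<close> absorbs the ratio of \<open>m\<close> to
    \<open>m + N\<close>.\<close>
  define \<phi> where "\<phi> = (\<lambda>\<epsilon>. ((1 - \<epsilon>) / 2) powr p * (1 - \<epsilon>) ^ CARD('n) * (1 - \<epsilon>) powr (2 * p) * \<delta> * ((max 0 (I - \<epsilon>)) powr (1 + a) * (1 - \<epsilon>)))"
  define \<Phi> where "\<Phi> = (\<lambda>\<epsilon>. ((1 + \<epsilon>) / 2) powr p * ((\<delta> + \<epsilon>) * (1 - \<epsilon>) powr (- a) * (I + \<epsilon>) powr (1 + a)) + \<epsilon> * B powr p + \<epsilon>)"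
  have lower: "\<forall>\<^sub>F m in sequentially. \<phi> \<epsilon> \<le> real m powr a * tri_p p D u m" if \<epsilon>: "0 < \<epsilon>" "\<epsilon> < 1" for \<epsilon>
  proof -
    have "\<epsilon> / 2 > 0"
      using \<epsilon> by simp
    then obtain Y where Y: "compact Y" "Y \<subseteq> U" "I - \<epsilon> / 2 < integral Y f"
      using det_H_integrable(2)[OF p U \<delta>(1,2) s_def] unfolding f_def I_def by blast
    have "bounded (f ` Y)"
      unfolding f_def
      by (intro compact_imp_bounded compact_continuous_image continuous_on_subset[OF continuous_on_det_H] Y)
    then obtain M where M: "M > 0" "\<And>y. y \<in> Y \<Longrightarrow> \<bar>f y\<bar> \<le> M"
      unfolding bounded_pos by auto
    \<comment> \<open>Chosen after \<open>M\<close>: oscillation and uncovered part of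
      \<open>Y\<close> together cost at most \<open>\<epsilon> / 2\<close>, and the passage from
      \<open>I\<close> to \<open>Y\<close> costs the other half.\<close>
    define \<eta> where "\<eta> = min \<epsilon> (\<epsilon> / 2 / (\<mu> + M))"
    have \<mu>M: "\<mu> + M > 0"
      using \<mu> M(1) by simp
    have \<eta>: "\<eta> > 0" "\<eta> \<le> \<epsilon>"
      using \<epsilon> \<mu>M by (auto simp: \<eta>_def)
    obtain C where C: "tiling s \<eta> C"
      using tiling_exists[OF \<eta>(1)] by blast
    define W where "W = (\<Sum>t\<in>C. weight s t)"
    have "integral Y f \<le> W + \<eta> * (\<mu> + M)"
      unfolding f_def W_def \<mu>_def using M
      by (intro compact_integral_le_weights[OF C \<eta>(1) Y(1,2)]) (auto simp: f_def)
    also have "\<eta> * (\<mu> + M) \<le> \<epsilon> / 2 / (\<mu> + M) * (\<mu> + M)"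
      using \<mu>M by (intro mult_right_mono) (auto simp: \<eta>_def)
    also have "\<dots> = \<epsilon> / 2"
      using \<mu>M by (intro nonzero_divide_eq_eq[THEN iffD1, OF _ refl, symmetric]) simp
    finally have WI: "I - \<epsilon> \<le> W"
      using Y(3) by linarith
    have W0: "W \<ge> 0"
      unfolding W_def using tiling_weight_pos[OF C] by (intro sum_nonneg) (auto intro: less_imp_le)
    define k0 where "k0 = ((1 - \<epsilon>) / 2) powr p * (1 - \<epsilon>) ^ CARD('n) * (1 - \<epsilon>) powr (2 * p) * \<delta>"
    have k0: "k0 \<ge> 0"
      using \<epsilon> \<delta>(1) by (simp add: k0_def)
    obtain N where N: "N \<ge> 0" "\<And>m. m \<ge> 1 \<Longrightarrow> k0 * (W powr (1 + a) * (real m + N) powr (- a)) \<le> tri_p p D u m"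
    proof -
      show ?thesis
        by (rule tri_p_lower[OF tiling_mono[OF C[unfolded s_def] \<eta>(2)] \<epsilon> U p \<delta>(1,2)])
           (use that in \<open>auto simp: k0_def W_def a_def s_def\<close>)
    qed
    have "(\<lambda>m. real m / (real m + N)) \<longlonglongrightarrow> 1"
      by real_asymp
    then have "(\<lambda>m. (real m / (real m + N)) powr a) \<longlonglongrightarrow> 1 powr a"
      by (intro tendsto_powr tendsto_const) auto
    then have "\<forall>\<^sub>F m in sequentially. 1 - \<epsilon> < (real m / (real m + N)) powr a"
      using \<epsilon> by (intro order_tendstoD) auto
    then show ?thesis
      using eventually_ge_at_top[of 1]
    proof eventually_elim
      case (elim m)
      have "(max 0 (I - \<epsilon>)) powr (1 + a) * (1 - \<epsilon>) \<le> W powr (1 + a) * (real m / (real m + N)) powr a"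
        using elim(1) WI W0 a \<epsilon> by (intro mult_mono powr_mono2) auto
      also have "(real m / (real m + N)) powr a = real m powr a * (real m + N) powr (- a)"
        using N(1) by (simp add: powr_divide powr_minus_divide)
      finally have "\<phi> \<epsilon> \<le> k0 * (W powr (1 + a) * (real m powr a * (real m + N) powr (- a)))"
        unfolding \<phi>_def k0_def[symmetric] using k0 by (intro mult_left_mono) auto
      also have "\<dots> = real m powr a * (k0 * (W powr (1 + a) * (real m + N) powr (- a)))"
        by (simp add: mult_ac)
      also have "\<dots> \<le> real m powr a * tri_p p D u m"
        using N(2)[OF elim(2)] by (intro mult_left_mono) auto
      finally show ?case .
    qed
  qed
  have upper: "\<forall>\<^sub>F m in sequentially. real m powr a * tri_p p D u m \<le> \<Phi> \<epsilon>" if \<epsilon>: "0 < \<epsilon>" "\<epsilon> < 1" for \<epsilon>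
  proof -
    \<comment> \<open>The three bounds control the Hessian, the weights against \<open>I\<close>,
      and the rest: the last one cancels the factor \<open>\<epsilon> powr (- a)\<close> caused by
      the small share of extra tangents.\<close>
    define \<eta> where "\<eta> = min \<epsilon> (min (\<epsilon> / (\<mu> + 1)) (\<epsilon> * \<epsilon> powr a))"
    have \<eta>: "\<eta> > 0" "\<eta> \<le> \<epsilon>" "\<eta> \<le> \<epsilon> / (\<mu> + 1)" "\<eta> \<le> \<epsilon> * \<epsilon> powr a"
      using \<epsilon> \<mu> by (auto simp: \<eta>_def)
    obtain C where C: "tiling s \<eta> C"
      using tiling_exists[OF \<eta>(1)] by blast
    define W where "W = (\<Sum>t\<in>C. weight s t)"
    have W0: "W \<ge> 0"
      unfolding W_def using tiling_weight_pos[OF C] by (intro sum_nonneg) (auto intro: less_imp_le)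
    have "W \<le> integral (\<Union>t\<in>C. tile t) f + \<eta> * \<mu>"
      using tiling_sum_near_integral(2)[OF C \<eta>(1)] unfolding f_def W_def \<mu>_def by linarith
    also have "integral (\<Union>t\<in>C. tile t) f \<le> I"
      unfolding I_def using fint tiling_sum_near_integral(1)[OF C \<eta>(1)] tiling_subset[OF C]
      by (intro integral_subset_le) (auto simp: f_def)
    also have "\<eta> * \<mu> \<le> \<epsilon> / (\<mu> + 1) * (\<mu> + 1)"
      using \<eta> \<mu> \<epsilon> by (intro mult_mono) auto
    also have "\<dots> = \<epsilon>"
      using \<mu> by simp
    finally have WI: "W \<le> I + \<epsilon>"
      by linarith
    have le1: "((1 + \<eta>) / 2) powr p \<le> ((1 + \<epsilon>) / 2) powr p"
      using \<eta> p by (intro powr_mono2) auto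
    have le2: "W powr (1 + a) \<le> (I + \<epsilon>) powr (1 + a)"
      using W0 WI a by (intro powr_mono2) auto
    have "((1 + \<eta>) / 2) powr p * ((\<delta> + \<epsilon>) * (1 - \<epsilon>) powr (- a) * W powr (1 + a)) \<le> ((1 + \<epsilon>) / 2) powr p * ((\<delta> + \<epsilon>) * (1 - \<epsilon>) powr (- a) * (I + \<epsilon>) powr (1 + a))"
      using \<epsilon> \<delta>(1) by (intro mult_mono[OF le1] mult_left_mono[OF le2]) auto
    moreover have "\<eta> * (B powr p * \<epsilon> powr (- a)) \<le> \<epsilon> * B powr p"
    proof -
      have "\<eta> * (B powr p * \<epsilon> powr (- a)) \<le> \<epsilon> * \<epsilon> powr a * (B powr p * \<epsilon> powr (- a))"
        using \<eta>(4) by (intro mult_right_mono) auto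
      also have "\<dots> = \<epsilon> * B powr p * (\<epsilon> powr a * \<epsilon> powr (- a))"
        by (simp add: mult_ac)
      also have "\<epsilon> powr a * \<epsilon> powr (- a) = 1"
        using \<epsilon> by (simp flip: powr_add)
      finally show ?thesis by simp
    qed
    moreover have "\<forall>\<^sub>F m in sequentially. real m powr a * tri_p p D u m \<le>
       ((1 + \<eta>) / 2) powr p * ((\<delta> + \<epsilon>) * (1 - \<epsilon>) powr (- a) * W powr (1 + a)) + \<eta> * (B powr p * \<epsilon> powr (- a)) + \<epsilon>"
      unfolding a_def W_def s_def by (rule tri_p_upper[OF C[unfolded s_def] \<eta>(1) p B \<epsilon> \<delta>(3)[OF \<epsilon>(1)]])
    ultimately show ?thesis
      unfolding \<Phi>_def by (elim eventually_mono) linarith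
  qed
  have "(\<lambda>m. real m powr a * tri_p p D u m) \<longlonglongrightarrow> \<delta> / 2 powr p * I powr (1 + a)"
  proof (rule tendsto_squeeze_family[OF lower upper])
    have "(\<phi> \<longlongrightarrow> ((1 - 0) / 2) powr p * (1 - 0) ^ CARD('n) * (1 - 0) powr (2 * p) * \<delta> * ((max 0 (I - 0)) powr (1 + a) * (1 - 0))) (at_right 0)"
      unfolding \<phi>_def using a by (intro tendsto_intros) auto
    then show "(\<phi> \<longlongrightarrow> \<delta> / 2 powr p * I powr (1 + a)) (at_right 0)"
      using I by (simp add: powr_divide)
    have "(\<Phi> \<longlongrightarrow> ((1 + 0) / 2) powr p * ((\<delta> + 0) * (1 - 0) powr (- a) * (I + 0) powr (1 + a)) + 0 * B powr p + 0) (at_right 0)"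
      unfolding \<Phi>_def using a I by (intro tendsto_intros) (auto simp: eventually_at_filter)
    then show "(\<Phi> \<longlongrightarrow> \<delta> / 2 powr p * I powr (1 + a)) (at_right 0)"
      by (simp add: powr_divide)
  qed
  then show ?thesis
    by (simp add: a_def I_def f_def s_def)
qed

end

text \<open>All errors are integrals over a null set. The affine minorant is there to make the class
  nonempty, so that the infimum is that of the set containing just 0; this is where \<open>m\<close>
  must be positive.\<close>

lemma tri_p_empty_interior:
  fixes D :: "(real^'n) set"
  assumes "convex D" "convex_on D u" "interior D = {}" "m \<ge> 1"
  shows "tri_p p D u m = 0"
proof -
  have neg: "negligible D"
    using negligible_convex_interior[OF assms(1)] assms(3) by simp
  obtain a b where ab: "\<And>x. x \<in> D \<Longrightarrow> a \<bullet> x + b \<le> u x"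
    using affine_minorant_exists[OF assms(1,2)] by blast
  have "affmax {(a, b)} \<in> Pc m D u"
    unfolding Pc_def using ab assms(4) by (intro CollectI exI[of _ "{(a, b)}"]) (auto simp: affmax_def)
  then have "(\<lambda>l. integral D (\<lambda>x. (u x - l x) powr p)) ` Pc m D u = {0}"
    using integral_negligible[OF neg] by auto
  then show ?thesis
    by (simp add: tri_p_def)
qed

text \<open>The constant is chosen before \<open>D\<close> and \<open>u\<close>, which expresses its
  dependence on \<open>n\<close> and \<open>p\<close> alone. Integrability is part of the
  conclusion, because a divergent integral would have the default value 0 and the limit formula
  would lose its meaning.\<close>

theorem mainTheorem2:
  fixes p :: real
  assumes "p > 0"
  shows "\<exists>\<delta>::real. \<forall>(D :: (real^'n) set) (u :: real^'n \<Rightarrow> real) H.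
     convex D \<and> compact D \<and> convex_on D u \<and>
     (\<exists>C. C-lipschitz_on (interior D) u) \<and> C2plus_hessian (interior D) u H \<longrightarrow>
       (\<lambda>x. det (H x) powr (p / (CARD('n) + 2 * p))) integrable_on D \<and>
       ((\<lambda>m. real m powr (2 * p / CARD('n)) * tri_p p D u m) \<longlonglongrightarrow>
          \<delta> / 2 powr p *
          (integral D (\<lambda>x. det (H x) powr (p / (CARD('n) + 2 * p)))) powr ((CARD('n) + 2 * p) / CARD('n)))"
proof -
  obtain \<delta> :: real where \<delta>: "\<delta> > 0"
    "\<And>S :: (real^'n) set. finite S \<Longrightarrow> S \<noteq> {} \<Longrightarrow> \<delta> * real (card S) powr (- (2 * p / CARD('n))) \<le> quant_err p S"
    "\<And>\<epsilon>. \<epsilon> > 0 \<Longrightarrow> \<forall>\<^sub>F k in sequentially. \<exists>S :: (real^'n) set. finite S \<and> S \<noteq> {} \<and> S \<subseteq> ucube \<and> card S \<le> k \<and>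
       quant_err p S \<le> (\<delta> + \<epsilon>) * real k powr (- (2 * p / CARD('n)))"
  proof -
    show ?thesis
      by (rule quantization_constant[OF assms]) (rule that)
  qed
  have expo: "(real CARD('n) + 2 * p) / real CARD('n) = 1 + 2 * p / real CARD('n)"
    by (simp add: add_divide_distrib)
  have "(\<lambda>x. det (H x) powr (p / (CARD('n) + 2 * p))) integrable_on D \<and>
       ((\<lambda>m. real m powr (2 * p / CARD('n)) * tri_p p D u m) \<longlonglongrightarrow>
          \<delta> / 2 powr p *
          (integral D (\<lambda>x. det (H x) powr (p / (CARD('n) + 2 * p)))) powr ((CARD('n) + 2 * p) / CARD('n)))"
    if D: "convex D" "compact D" "convex_on D u" "C-lipschitz_on (interior D) u" and H: "C2plus_hessian (interior D) u H"
    for D :: "(real^'n) set" and u H C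
  proof (cases "interior D = {}")
    case True
    have neg: "negligible D"
      using negligible_convex_interior[OF D(1)] True by simp
    have "\<forall>\<^sub>F m in sequentially. real m powr (2 * p / CARD('n)) * tri_p p D u m = 0"
      using eventually_ge_at_top[of 1] by eventually_elim (simp add: tri_p_empty_interior[OF D(1,3) True])
    then have "(\<lambda>m. real m powr (2 * p / CARD('n)) * tri_p p D u m) \<longlonglongrightarrow> 0"
      by (rule tendsto_eventually)
    then show ?thesis
      using integral_negligible[OF neg, of "\<lambda>x. det (H x) powr (p / (CARD('n) + 2 * p))"]
        integrable_negligible[OF neg, of "\<lambda>x. det (H x) powr (p / (CARD('n) + 2 * p))"] by simp
  next
    case False
    obtain G where G: "\<forall>x\<in>interior D. (u has_derivative (\<lambda>h. G x \<bullet> h)) (at x) \<and> (G has_derivative (\<lambda>h. H x *v h)) (at x)"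
      "continuous_on (interior D) H" "\<forall>x\<in>interior D. \<forall>v. v \<noteq> 0 \<longrightarrow> 0 < v \<bullet> (H x *v v)"
      using H unfolding C2plus_hessian_def by blast
    interpret C2_convex D u G H C
      by unfold_locales (use D G in auto)
    show ?thesis
      unfolding integral_D integrable_on_D expo
      using det_H_integrable(1)[OF assms False \<delta>(1,2) refl] tri_p_limit[OF assms False \<delta>] by blast
  qed
  then show ?thesis
    by blast
qed

end
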